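(* Let $u$ and $v$ be entropy solutions of the periodic Ostrovsky-Hunter equation $u_t+f(x,u)_x=P[u]$ on $(0,T)\times(0,1)$ with initial data $u_0$ and $v_0$ respectively, where $u_0,v_0\in BV([0,1])$ satisfy $\int_0^1u_0\,dx=\int_0^1v_0\,dx=0$. Then $$\|u(T,\cdot)-v(T,\cdot)\|_{L^1((0,1))}\le e^{2T}\,\|u_0-v_0\|_{L^1((0,1))}.$$
   Context: Equation. Let $T>0$. The problem is $$u_t+f(x,u)_x=P[u],\quad x\in(0,1),\ t\in(0,T);\qquad u(0,x)=u_0(x);\qquad u(t,0)=u(t,1),$$ with $P[u](t,x)=\int_0^x u(t,y)\,dy-\int_0^1\int_0^y u(t,z)\,dz\,dy$. The flux $f=f(x,u)$ is twice continuously differentiable and $1$-periodic in $x$; functions of $x\in[0,1]$ are extended $1$-periodically. $f_x(x,u)$ denotes the partial derivative with respect to the first variable. Entropy solution. Let $\Pi_T=[0,T]\times[0,1]$, $\operatorname{sign}(0)=0$, $\eta(u,k)=|u-k|$ and $q(x,u,k)=\operatorname{sign}(u-k)(f(x,u)-f(x,k))$. A function $u\in C([0,T];L^1((0,1)))\cap L^\infty(\Pi_T)$ with $u(0,\cdot)=u_0$ is an entropy solution with initial data $u_0$ if for all constants $k\in\mathbb{R}$ and all non-negative smooth test functions $\varphi(t,x)$ that are $1$-periodic in $x$, $$\int_{\Pi_T}\Big(\eta(u,k)\varphi_t+q(x,u,k)\varphi_x-\operatorname{sign}(u-k)f_x(x,k)\varphi+\operatorname{sign}(u-k)P[u]\varphi\Big)dx\,dt-\int_0^1\eta(u(t,x),k)\varphi(t,x)\,dx\Big|_{t=0}^{t=T}\ge0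 .$$ *)

theory Defs
  imports "HOL-Analysis.Analysis"
begin

definition partial1 :: "(real \<Rightarrow> real \<Rightarrow> real) \<Rightarrow> real \<Rightarrow> real \<Rightarrow> real" where
  "partial1 g a b = deriv (\<lambda>s. g s b) a"

definition partial2 :: "(real \<Rightarrow> real \<Rightarrow> real) \<Rightarrow> real \<Rightarrow> real \<Rightarrow> real" where
  "partial2 g a b = deriv (\<lambda>s. g a s) b"

text \<open>
  \<open>Ck n g\<close>: all partial derivatives of \<open>g\<close> of order at most \<open>n\<close> exist and are jointly
  continuous on the plane.
\<close>

primrec Ck :: "nat \<Rightarrow> (real \<Rightarrow> real \<Rightarrow> real) \<Rightarrow> bool" where
  "Ck 0 g \<longleftrightarrow> continuous_on UNIV (\<lambda>(a, b). g a b)"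
| "Ck (Suc n) g \<longleftrightarrow>
     continuous_on UNIV (\<lambda>(a, b). g a b) \<and>
     (\<forall>a b. (\<lambda>s. g s b) differentiable (at a)) \<and>
     (\<forall>a b. (\<lambda>s. g a s) differentiable (at b)) \<and>
     Ck n (partial1 g) \<and> Ck n (partial2 g)"

definition smooth :: "(real \<Rightarrow> real \<Rightarrow> real) \<Rightarrow> bool" where
  "smooth g \<longleftrightarrow> (\<forall>n. Ck n g)"

definition bounded_variation_on :: "real \<Rightarrow> real \<Rightarrow> (real \<Rightarrow> real) \<Rightarrow> bool" where
  "bounded_variation_on a b g \<longleftrightarrow>
     (\<exists>M. \<forall>(n::nat) p. (\<forall>i\<le>n. p i \<in> {a..b}) \<and> (\<forall>i<n. p i \<le> p (Suc i)) \<longrightarrow>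
        (\<Sum>i<n. \<bar>g (p (Suc i)) - g (p i)\<bar>) \<le> M)"

text \<open>
  Elements of \<open>L\<^sup>1\<close> are classes modulo null sets, so membership in \<open>BV\<close> means that some
  representative has bounded variation.  All integrals are taken with respect to
  \<^const>\<open>lebesgue\<close> rather than \<^const>\<open>lborel\<close>, so that an arbitrary Lebesgue
  measurable representative is allowed.
\<close>

definition BV01 :: "(real \<Rightarrow> real) \<Rightarrow> bool" where
  "BV01 w \<longleftrightarrow>
     (\<exists>g. bounded_variation_on 0 1 g \<and> (AE x in lebesgue. x \<in> {0..1} \<longrightarrow> w x = g x))"

definition L1_norm :: "(real \<Rightarrow> real) \<Rightarrow> real" where
  "L1_norm w = (LINT x:{0<..<1}|lebesgue. \<bar>w x\<bar>)"

text \<open>The space \<open>C([0,T]; L\<^sup>1((0,1)))\<close>; throughout, \<open>u t x\<close> is the value at time \<open>t\<close> and position \<open>x\<close>.\<close>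

definition continuous_L1 :: "real \<Rightarrow> (real \<Rightarrow> real \<Rightarrow> real) \<Rightarrow> bool" where
  "continuous_L1 T u \<longleftrightarrow>
     (\<forall>t\<in>{0..T}. set_integrable lebesgue {0<..<1} (u t)) \<and>
     (\<forall>t\<in>{0..T}. ((\<lambda>s. L1_norm (\<lambda>x. u s x - u t x)) \<longlongrightarrow> 0) (at t within {0..T}))"

definition PiT :: "real \<Rightarrow> (real \<times> real) set" where
  "PiT T = {0..T} \<times> {0..1}"

definition Linf :: "real \<Rightarrow> (real \<Rightarrow> real \<Rightarrow> real) \<Rightarrow> bool" where
  "Linf T u \<longleftrightarrow>
     set_borel_measurable lebesgue (PiT T) (\<lambda>(t, x). u t x) \<and>
     (\<exists>C. AE (t, x) in lebesgue. (t, x) \<in> PiT T \<longrightarrow> \<bar>u t x\<bar> \<le> C)"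

definition nonlocal_P :: "(real \<Rightarrow> real \<Rightarrow> real) \<Rightarrow> real \<Rightarrow> real \<Rightarrow> real" where
  "nonlocal_P u t x = (LINT y:{0..x}|lebesgue. u t y)
     - (LINT y:{0..1}|lebesgue. (LINT z:{0..y}|lebesgue. u t z))"

definition entropy_eta :: "real \<Rightarrow> real \<Rightarrow> real" where
  "entropy_eta w k = \<bar>w - k\<bar>"

definition entropy_q :: "(real \<Rightarrow> real \<Rightarrow> real) \<Rightarrow> real \<Rightarrow> real \<Rightarrow> real \<Rightarrow> real" where
  "entropy_q f x w k = sgn (w - k) * (f x w - f x k)"

text \<open>
  Test functions are smooth and non-negative on the whole plane; in particular they are smooth
  up to \<open>t = 0\<close> and \<open>t = T\<close>, and they need not vanish there.
\<close>

definition test_function :: "(real \<Rightarrow> real \<Rightarrow> real) \<Rightarrow> bool" where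
  "test_function \<phi> \<longleftrightarrow>
     smooth \<phi> \<and> (\<forall>t x. 0 \<le> \<phi> t x) \<and> (\<forall>t x. \<phi> t (x + 1) = \<phi> t x)"

definition entropy_solution ::
  "real \<Rightarrow> (real \<Rightarrow> real \<Rightarrow> real) \<Rightarrow> (real \<Rightarrow> real) \<Rightarrow> (real \<Rightarrow> real \<Rightarrow> real) \<Rightarrow> bool" where
  "entropy_solution T f u0 u \<longleftrightarrow>
     continuous_L1 T u \<and> Linf T u \<and>
     (AE x in lebesgue. x \<in> {0<..<1} \<longrightarrow> u 0 x = u0 x) \<and>
     (\<forall>k \<phi>. test_function \<phi> \<longrightarrow>
        0 \<le> (LINT (t, x):PiT T|lebesgue.
               entropy_eta (u t x) k * partial1 \<phi> t x
               + entropy_q f x (u t x) k * partial2 \<phi> t x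
               - sgn (u t x - k) * partial1 f x k * \<phi> t x
               + sgn (u t x - k) * nonlocal_P u t x * \<phi> t x)
            - ((LINT x:{0..1}|lebesgue. entropy_eta (u T x) k * \<phi> T x)
               - (LINT x:{0..1}|lebesgue. entropy_eta (u 0 x) k * \<phi> 0 x)))"

end

theory Submission
  imports Defs "HOL-Real_Asymp.Real_Asymp"
begin

text \<open>
  Kruzkov's doubling of variables.  Test the entropy inequality of \<open>u\<close> at \<open>(t, x)\<close> with the constant
  \<open>k = v(s, y)\<close>, test that of \<open>v\<close> at \<open>(s, y)\<close> with \<open>k = u(t, x)\<close>, use for both the test function
  \<open>\<omega>(t - s) e^{-(t + s)} \<rho>(x - y)\<close> with concentrating kernels \<open>\<omega>\<close> and \<open>\<rho>\<close>, integrate over all four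
  variables and add.

  The factor \<open>e^{-(t + s)}\<close> takes the place of Gronwall's lemma.  The kernel \<open>\<omega>\<close> is even, so in the sum of
  the two time derivatives only this factor is differentiated, and \<open>- 2 |u - v|\<close> remains.  The two
  sources satisfy \<open>|P[u] - P[v]| \<le> 2 \<parallel>u(t) - v(t)\<parallel>\<close>, so on the diagonal source and time derivative
  together have a space integral that is at most \<open>0\<close>.  Each of the four boundary terms sees half of
  the mass of \<open>\<omega>\<close>; at time \<open>T\<close> they add up to \<open>e^{-2T} \<parallel>u(T) - v(T)\<parallel>\<close>, at time \<open>0\<close> to
  \<open>\<parallel>u\<^sub>0 - v\<^sub>0\<parallel>\<close>.  This is the claim, provided that everything else tends to \<open>0\<close>.

  The flux is the delicate term, because \<open>\<rho>'\<close> is large.  Near the diagonal \<open>f(x, w) - f(y, w)\<close> is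
  \<open>f\<^sub>x(y, w) sin(2 \<pi> (x - y)) / (2 \<pi>)\<close> up to a quadratic error, small enough to compensate \<open>\<rho>'\<close>.  The linear
  part meets the kernel \<open>sin(2 \<pi> z) / (2 \<pi>) \<rho>'(z) + \<rho>(z)\<close>, whose total mass tends to \<open>0\<close> while its absolute
  value stays below a concentrating kernel of bounded mass.  It is multiplied by
  \<open>sgn(u - v) (f\<^sub>x(y, u) - f\<^sub>x(y, v))\<close>, which is Lipschitz continuous in \<open>u\<close> in spite of the sign, so
  \<open>u(t, x)\<close> may be replaced by \<open>u(t, y)\<close> at the price of the mean oscillation of \<open>u(t)\<close> on the scale
  of the kernel.  That oscillation vanishes in the limit for every bounded measurable function.

  For \<open>\<rho>\<close> a normalised power \<open>cos(\<pi> z)^{2n}\<close> is taken: it has period one, and all its moments follow from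
  one recursion, because multiplication by \<open>sin\<^sup>2\<close> only shifts the exponent.  The same kernel with period
  \<open>2 T\<close> serves as \<open>\<omega>\<close>.

  The estimates are carried out for bounded Borel functions, so that all integrals may be exchanged
  freely.  The lemmas that carry the proof are \<open>osc_tendsto_0\<close> (mean oscillation), \<open>flux_pointwise\<close>
  (flux), \<open>doubled_entropy\<close> (the added inequalities), \<open>integral_doubled_le\<close> (the interior term),
  \<open>L1_contraction\<close> (the limit), and \<open>kruzkov_representative\<close> (from an entropy solution to a Borel
  function).
\<close>

section \<open>Interval measures and bounded functions\<close>

text \<open>
  A density instead of a restricted space: every Borel function on the line stays measurable.
\<close>

definition leb :: "real set \<Rightarrow> real measure" where
  "leb S = density lborel (indicator S)"

lemma sets_leb [simp, measurable_cong]: "sets (leb S) = sets borel"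
  by (simp add: leb_def)

lemma space_leb [simp]: "space (leb S) = UNIV"
  by (simp add: leb_def)

lemma AE_leb: "S \<in> sets borel \<Longrightarrow> (AE x in leb S. P x) \<longleftrightarrow> (AE x in lborel. x \<in> S \<longrightarrow> P x)"
  unfolding leb_def by (subst AE_density) (auto simp: indicator_def)

lemma AE_leb_mem: "S \<in> sets borel \<Longrightarrow> AE x in leb S. x \<in> S"
  by (simp add: AE_leb)

lemma emeasure_leb_Icc: "a \<le> b \<Longrightarrow> emeasure (leb {a..b}) UNIV = ennreal (b - a)"
  unfolding leb_def by (subst emeasure_density) auto

lemma finite_measure_leb: "finite_measure (leb {a..b})"
  by (rule finite_measureI)
    (cases "a \<le> b", auto simp: emeasure_leb_Icc leb_def emeasure_density)

interpretation leb: finite_measure "leb {a..b}" for a b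
  by (rule finite_measure_leb)

lemma prob_measure_leb: "measure (leb {0..1}) UNIV = 1"
  by (simp add: measure_def emeasure_leb_Icc)

lemma integral_leb: "g \<in> borel_measurable borel \<Longrightarrow> S \<in> sets borel \<Longrightarrow>
   (\<integral>x. g x \<partial>leb S) = (\<integral>x. g x * indicator S x \<partial>lborel)" for g :: "real \<Rightarrow> real"
  using integral_density[of g lborel "indicator S"]
  by (simp add: leb_def ennreal_indicator mult.commute)

text \<open>
  Boundedness on the whole type, rather than almost everywhere, is inherited along the syntax of an
  integrand, including inner integrals; with measurability it gives integrability over finite measures.
\<close>

definition bdd_fun :: "('a \<Rightarrow> real) \<Rightarrow> bool" where
  "bdd_fun g \<longleftrightarrow> (\<exists>B. \<forall>x. \<bar>g x\<bar> \<le> B)"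

lemma bdd_funI: "(\<And>x. \<bar>g x\<bar> \<le> B) \<Longrightarrow> bdd_fun g"
  by (auto simp: bdd_fun_def)

lemma bdd_funE: assumes "bdd_fun g" obtains B where "0 \<le> B" "\<And>x. \<bar>g x\<bar> \<le> B"
proof -
  from assms obtain B where B: "\<forall>x. \<bar>g x\<bar> \<le> B" by (auto simp: bdd_fun_def)
  then have "0 \<le> B" using abs_ge_zero order_trans by blast
  with B that show ?thesis by blast
qed

named_theorems bdd_fun_intros

lemma bdd_fun_const [bdd_fun_intros]: "bdd_fun (\<lambda>x. c)"
  by (rule bdd_funI[of _ "\<bar>c\<bar>"]) simp

lemma bdd_fun_add [bdd_fun_intros]: "bdd_fun g \<Longrightarrow> bdd_fun h \<Longrightarrow> bdd_fun (\<lambda>x. g x + h x)"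
proof -
  assume "bdd_fun g" "bdd_fun h"
  then obtain A B where "\<And>x. \<bar>g x\<bar> \<le> A" "\<And>x. \<bar>h x\<bar> \<le> B" by (meson bdd_funE)
  then show ?thesis
    by (intro bdd_funI[of _ "A + B"]) (meson abs_triangle_ineq add_mono order_trans)
qed

lemma bdd_fun_minus [bdd_fun_intros]: "bdd_fun g \<Longrightarrow> bdd_fun (\<lambda>x. - g x)"
  by (simp add: bdd_fun_def)

lemma bdd_fun_diff [bdd_fun_intros]: "bdd_fun g \<Longrightarrow> bdd_fun h \<Longrightarrow> bdd_fun (\<lambda>x. g x - h x)"
  using bdd_fun_add[of g "\<lambda>x. - h x"] bdd_fun_minus[of h] by simp

lemma bdd_fun_mult [bdd_fun_intros]: "bdd_fun g \<Longrightarrow> bdd_fun h \<Longrightarrow> bdd_fun (\<lambda>x. g x * h x)"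
proof -
  assume "bdd_fun g" "bdd_fun h"
  then obtain A B where "0 \<le> A" "\<And>x. \<bar>g x\<bar> \<le> A" "\<And>x. \<bar>h x\<bar> \<le> B" by (meson bdd_funE)
  then show ?thesis
    by (intro bdd_funI[of _ "A * B"]) (simp add: abs_mult mult_mono)
qed

lemma bdd_fun_divide [bdd_fun_intros]: "bdd_fun g \<Longrightarrow> bdd_fun (\<lambda>x. g x / c)"
  using bdd_fun_mult[OF _ bdd_fun_const, of g "1 / c"] by simp

lemma bdd_fun_abs [bdd_fun_intros]: "bdd_fun g \<Longrightarrow> bdd_fun (\<lambda>x. \<bar>g x\<bar>)"
  by (simp add: bdd_fun_def)

lemma bdd_fun_power [bdd_fun_intros]: "bdd_fun g \<Longrightarrow> bdd_fun (\<lambda>x. g x ^ n)"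
  by (induction n) (simp_all add: bdd_fun_const bdd_fun_mult)

lemma bdd_fun_sgn [bdd_fun_intros]: "bdd_fun (\<lambda>x. sgn (g x))"
  by (rule bdd_funI[of _ 1]) (simp add: sgn_if)

lemma bdd_fun_sin [bdd_fun_intros]: "bdd_fun (\<lambda>x. sin (g x))"
  by (rule bdd_funI[of _ 1]) simp

lemma bdd_fun_cos [bdd_fun_intros]: "bdd_fun (\<lambda>x. cos (g x))"
  by (rule bdd_funI[of _ 1]) simp

lemma bdd_fun_compose: "bdd_fun g \<Longrightarrow> bdd_fun (\<lambda>x. g (h x))"
  by (auto simp: bdd_fun_def)

text \<open>
  The integral of a function that is not integrable is \<open>0\<close>, which obeys the bound as well.
\<close>

lemma abs_integral_le_const:
  fixes g :: "'a \<Rightarrow> real"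
  assumes "finite_measure M" and B: "\<And>x. \<bar>g x\<bar> \<le> B"
  shows "\<bar>\<integral>x. g x \<partial>M\<bar> \<le> B * measure M (space M)"
proof (cases "integrable M g")
  case True
  interpret finite_measure M by fact
  have "\<bar>\<integral>x. g x \<partial>M\<bar> \<le> (\<integral>x. \<bar>g x\<bar> \<partial>M)" by simp
  also have "\<dots> \<le> (\<integral>x. B \<partial>M)"
    using True B by (intro integral_mono) auto
  finally show ?thesis by (simp add: mult.commute)
next
  case False
  have "0 \<le> B" using B[of undefined] by linarith
  with False show ?thesis by (simp add: not_integrable_integral_eq)
qed

lemma bdd_fun_integral [bdd_fun_intros]:
  assumes "finite_measure M" and "bdd_fun (\<lambda>p. g (fst p) (snd p))"
  shows "bdd_fun (\<lambda>x. \<integral>y. g x y \<partial>M)"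
proof -
  obtain B where "\<And>p. \<bar>g (fst p) (snd p)\<bar> \<le> B" using assms(2) unfolding bdd_fun_def by blast
  then have "\<bar>g x y\<bar> \<le> B" for x y by (metis fst_conv snd_conv)
  then show ?thesis by (intro bdd_funI) (rule abs_integral_le_const[OF assms(1)])
qed

lemma bdd_fun_integrable:
  assumes "finite_measure M" "g \<in> borel_measurable M" "bdd_fun g"
  shows "integrable M g"
proof -
  interpret finite_measure M by fact
  obtain B where "\<And>x. \<bar>g x\<bar> \<le> B" using assms(3) unfolding bdd_fun_def by blast
  then show ?thesis using assms(2) by (intro integrable_const_bound[of _ B]) auto
qed

lemma integral_pair:
  fixes F :: "'a \<times> 'b \<Rightarrow> real"
  assumes "finite_measure M" "finite_measure N"
    and "F \<in> borel_measurable (M \<Otimes>\<^sub>M N)" "bdd_fun F"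
  shows "(\<integral>p. F p \<partial>(M \<Otimes>\<^sub>M N)) = (\<integral>x. (\<integral>y. F (x, y) \<partial>N) \<partial>M)"
proof -
  interpret M: finite_measure M by fact
  interpret N: finite_measure N by fact
  interpret pair_sigma_finite M N ..
  show ?thesis
    using integral_fst'[OF bdd_fun_integrable[OF finite_measure_pair_measure[OF assms(2,1)] assms(3,4)]] by simp
qed

lemma integral_swap:
  fixes g :: "'a \<Rightarrow> 'b \<Rightarrow> real"
  assumes "finite_measure M" "finite_measure N"
    and "(\<lambda>p. g (fst p) (snd p)) \<in> borel_measurable (M \<Otimes>\<^sub>M N)"
    and "bdd_fun (\<lambda>p. g (fst p) (snd p))"
  shows "(\<integral>x. (\<integral>y. g x y \<partial>N) \<partial>M) = (\<integral>y. (\<integral>x. g x y \<partial>M) \<partial>N)"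
proof -
  interpret M: finite_measure M by fact
  interpret N: finite_measure N by fact
  interpret pair_sigma_finite M N ..
  have i: "integrable (M \<Otimes>\<^sub>M N) (case_prod g)"
    using bdd_fun_integrable[OF finite_measure_pair_measure[OF assms(2,1)] assms(3,4)]
    by (simp add: case_prod_unfold)
  show ?thesis
    using Fubini_integral[OF i] by simp
qed

text \<open>
  On the compact set where \<open>D \<ge> \<epsilon>\<close> the function \<open>k\<close> is positive, hence bounded below.  With a squared sine
  that vanishes on the diagonal for \<open>k\<close>, this turns uniform continuity into an estimate that can be
  integrated against a kernel with small second moment.
\<close>

lemma bound_by_small_plus_multiple:
  fixes D k :: "'a :: topological_space \<Rightarrow> real"
  assumes "compact X" "continuous_on X D" "continuous_on X k"
    and "\<And>x. x \<in> X \<Longrightarrow> 0 \<le> k x" and "\<And>x. x \<in> X \<Longrightarrow> k x = 0 \<Longrightarrow> D x \<le> 0" and "0 < \<epsilon>"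
  shows "\<exists>K\<ge>0. \<forall>x\<in>X. D x \<le> \<epsilon> + K * k x"
proof -
  define Y where "Y = X \<inter> D -` {\<epsilon>..}"
  show ?thesis
  proof (cases "Y = {}")
    case True
    then have "\<forall>x\<in>X. D x \<le> \<epsilon> + 0 * k x" by (force simp: Y_def)
    then show ?thesis by blast
  next
    case False
    have "closedin (top_of_set X) Y"
      unfolding Y_def using assms(2) by (intro continuous_closedin_preimage) auto
    then have "compact Y" using assms(1) closedin_compact by blast
    moreover have "Y \<subseteq> X" by (auto simp: Y_def)
    ultimately obtain y where y: "y \<in> Y" "\<And>z. z \<in> Y \<Longrightarrow> k y \<le> k z"
      using continuous_attains_inf[of Y k] False continuous_on_subset[OF assms(3)] by blast
    have "0 < k y"
      using assms(4)[of y] assms(5)[of y] y(1) \<open>0 < \<epsilon>\<close> by (force simp: Y_def)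
    obtain z where z: "z \<in> Y" "\<And>x. x \<in> Y \<Longrightarrow> D x \<le> D z"
      using continuous_attains_sup[of Y D] \<open>compact Y\<close> False
        continuous_on_subset[OF assms(2) \<open>Y \<subseteq> X\<close>] by blast
    have "D z > 0" using z(1) \<open>0 < \<epsilon>\<close> by (auto simp: Y_def)
    have "D x \<le> \<epsilon> + (D z / k y) * k x" if "x \<in> X" for x
    proof (cases "x \<in> Y")
      case True
      have "D x \<le> (D z / k y) * k y" using z(2)[OF True] \<open>0 < k y\<close> by simp
      also have "\<dots> \<le> (D z / k y) * k x"
        using y(2)[OF True] \<open>0 < k y\<close> \<open>D z > 0\<close> by (intro mult_left_mono) auto
      finally show ?thesis using \<open>0 < \<epsilon>\<close> by linarith
    next
      case False
      then have "D x \<le> \<epsilon>" using that by (auto simp: Y_def)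
      also have "\<epsilon> \<le> \<epsilon> + (D z / k y) * k x"
        using assms(4)[OF that] \<open>0 < k y\<close> \<open>D z > 0\<close> by simp
      finally show ?thesis .
    qed
    then show ?thesis using \<open>0 < k y\<close> \<open>D z > 0\<close> by (intro exI[of _ "D z / k y"]) auto
  qed
qed

section \<open>The cosine kernel\<close>

text \<open>
  The mean of \<open>cos\<^sup>2\<^sup>n\<close> over a period.
\<close>

primrec cos_mass :: "nat \<Rightarrow> real" where
  "cos_mass 0 = 1"
| "cos_mass (Suc n) = cos_mass n * (2 * real n + 1) / (2 * real n + 2)"

lemma cos_mass_pos: "0 < cos_mass n"
  by (induction n) (auto intro!: divide_pos_pos mult_pos_pos)

definition kern :: "nat \<Rightarrow> real \<Rightarrow> real" where
  "kern n z = cos (pi * z) ^ (2 * n) / cos_mass n"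

text \<open>
  The derivative of the kernel.
\<close>

definition dkern :: "nat \<Rightarrow> real \<Rightarrow> real" where
  "dkern n z = - (2 * real n * pi * cos (pi * z) ^ (2 * n - 1) * sin (pi * z)) / cos_mass n"

lemma kern_nonneg: "0 \<le> kern n z"
  using cos_mass_pos[of n] by (simp add: kern_def)

lemma kern_measurable [measurable]: "kern n \<in> borel_measurable borel"
  unfolding kern_def by measurable

lemma dkern_measurable [measurable]: "dkern n \<in> borel_measurable borel"
  unfolding dkern_def by measurable

lemma bdd_fun_kern [bdd_fun_intros]: "bdd_fun (\<lambda>x. kern n (g x))"
  unfolding kern_def by (intro bdd_fun_intros)

lemma bdd_fun_dkern [bdd_fun_intros]: "bdd_fun (\<lambda>x. dkern n (g x))"
  unfolding dkern_def by (intro bdd_fun_intros)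

lemma kern_minus: "kern n (- z) = kern n z"
  by (simp add: kern_def)

lemma dkern_minus: "dkern n (- z) = - dkern n z"
  by (simp add: dkern_def)

lemma DERIV_kern: "(kern n has_real_derivative dkern n z) (at z)"
  using cos_mass_pos[of n] unfolding kern_def[abs_def] dkern_def
  by (auto intro!: derivative_eq_intros simp: field_simps)

text \<open>
  Since \<open>sin\<^sup>2 = 1 - cos\<^sup>2\<close>, a moment of the kernel is a combination of masses of kernels.
\<close>

lemma kern_sin2: "kern n z * sin (pi * z) ^ 2 =
    kern n z - (2 * real n + 1) / (2 * real n + 2) * kern (Suc n) z"
proof -
  have "sin (pi * z) ^ 2 = 1 - cos (pi * z) ^ 2" by (simp add: sin_squared_eq)
  then show ?thesis
    using cos_mass_pos[of n]
    by (simp add: kern_def divide_simps) (simp add: algebra_simps power2_eq_square)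
qed

text \<open>
  Integration of the derivative of \<open>cos\<^sup>2\<^sup>n\<^sup>+\<^sup>1 sin\<close> relates consecutive powers.  The premise lets the boundary terms
  cancel; it covers a full period as well as the half period between a peak and a zero.
\<close>

lemma integral_cos_power:
  fixes \<alpha> \<beta> :: real
  assumes "a \<le> b" "\<alpha> \<noteq> 0"
    and "\<And>n. cos (pi * (\<alpha> * b + \<beta>)) ^ (2 * n + 1) * sin (pi * (\<alpha> * b + \<beta>)) =
      cos (pi * (\<alpha> * a + \<beta>)) ^ (2 * n + 1) * sin (pi * (\<alpha> * a + \<beta>))"
  shows "(\<integral>x. cos (pi * (\<alpha> * x + \<beta>)) ^ (2 * n) \<partial>leb {a..b}) = cos_mass n * (b - a)"
proof (induction n)
  case 0
  then show ?case using assms(1) by (simp add: measure_def emeasure_leb_Icc)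
next
  case (Suc n)
  let ?c = "\<lambda>x. cos (pi * (\<alpha> * x + \<beta>))" and ?s = "\<lambda>x. sin (pi * (\<alpha> * x + \<beta>))"
  define F where "F x = ?c x ^ (2 * n + 1) * ?s x / (pi * \<alpha>)" for x
  define f where "f x = (2 * real n + 2) * ?c x ^ (2 * Suc n) - (2 * real n + 1) * ?c x ^ (2 * n)" for x
  have D: "(F has_real_derivative f x) (at x)" for x
  proof -
    have s2: "?s x * ?s x = 1 - ?c x ^ 2"
      using sin_squared_eq[of "pi * (\<alpha> * x + \<beta>)"] by (simp add: power2_eq_square)
    have "(F has_real_derivative
       (((2 * real n + 1) * ?c x ^ (2 * n) * (- ?s x * (pi * \<alpha>))) * ?s x
        + ?c x ^ (2 * n + 1) * (?c x * (pi * \<alpha>))) / (pi * \<alpha>)) (at x)"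
    proof -
      have Dc: "(?c has_real_derivative - ?s x * (pi * \<alpha>)) (at x)"
        and Ds: "(?s has_real_derivative ?c x * (pi * \<alpha>)) (at x)"
        by (auto intro!: derivative_eq_intros simp: algebra_simps)
      show ?thesis
        using DERIV_cdivide[OF DERIV_mult[OF DERIV_power[OF Dc, of "2 * n + 1"] Ds], of "pi * \<alpha>"]
        unfolding F_def[abs_def] by (simp add: algebra_simps)
    qed
    also have "(((2 * real n + 1) * ?c x ^ (2 * n) * (- ?s x * (pi * \<alpha>))) * ?s x
        + ?c x ^ (2 * n + 1) * (?c x * (pi * \<alpha>))) / (pi * \<alpha>)
        = - ((2 * real n + 1) * ?c x ^ (2 * n) * (?s x * ?s x)) + ?c x ^ (2 * n) * ?c x ^ 2"
      using assms(2) by (simp add: field_simps power2_eq_square)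
    also have "\<dots> = f x" unfolding s2 f_def by (simp add: algebra_simps power2_eq_square)
    finally show ?thesis .
  qed
  have [measurable]: "f \<in> borel_measurable borel" unfolding f_def[abs_def] by measurable
  have cont: "isCont f x" for x unfolding f_def by (intro continuous_intros)
  have "(\<integral>x. f x \<partial>leb {a..b}) = F b - F a"
    using integral_FTC_Icc_real[OF assms(1) D cont]
    by (subst integral_leb) simp_all
  also have "\<dots> = 0" using assms(3)[of n] by (simp add: F_def)
  also have "(\<integral>x. f x \<partial>leb {a..b}) =
     (2 * real n + 2) * (\<integral>x. ?c x ^ (2 * Suc n) \<partial>leb {a..b}) - (2 * real n + 1) * (\<integral>x. ?c x ^ (2 * n) \<partial>leb {a..b})"
    unfolding f_def
    by (subst Bochner_Integration.integral_diff)
       (auto intro!: bdd_fun_integrable[OF finite_measure_leb] bdd_fun_intros)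
  finally have "(2 * real n + 2) * (\<integral>x. ?c x ^ (2 * Suc n) \<partial>leb {a..b}) =
      (2 * real n + 1) * (cos_mass n * (b - a))"
    using Suc by simp
  then have "(\<integral>x. ?c x ^ (2 * Suc n) \<partial>leb {a..b}) =
      (2 * real n + 1) * (cos_mass n * (b - a)) / (2 * real n + 2)"
    by (simp add: eq_divide_eq mult.commute)
  then show ?case by simp
qed

lemma integral_kern_affine:
  fixes \<alpha> \<beta> :: real
  assumes "a \<le> b" "\<alpha> \<noteq> 0"
    and "\<And>n. cos (pi * (\<alpha> * b + \<beta>)) ^ (2 * n + 1) * sin (pi * (\<alpha> * b + \<beta>)) =
      cos (pi * (\<alpha> * a + \<beta>)) ^ (2 * n + 1) * sin (pi * (\<alpha> * a + \<beta>))"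
  shows "(\<integral>x. kern n (\<alpha> * x + \<beta>) \<partial>leb {a..b}) = b - a"
  using integral_cos_power[OF assms, of n] cos_mass_pos[of n] by (simp add: kern_def)

lemma integral_kern: "(\<integral>x. kern n (x - y) \<partial>leb {0..1}) = 1"
  using integral_kern_affine[of 0 1 1 "- y" n]
  by (simp add: algebra_simps sin_diff cos_diff)

lemma integral_kern': "(\<integral>y. kern n (x - y) \<partial>leb {0..1}) = 1"
  using integral_kern[of n x] by (metis (no_types, lifting) Bochner_Integration.integral_cong kern_minus minus_diff_eq)

lemma integral_kern_sin2_affine:
  assumes K: "\<And>n. (\<integral>x. kern n (g x) \<partial>leb {a..b}) = m"
    and [measurable]: "g \<in> borel_measurable borel"
  shows "(\<integral>x. kern n (g x) * sin (pi * g x) ^ 2 \<partial>leb {a..b}) = m / (2 * real n + 2)"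
    and "(\<integral>x. kern n (g x) * sin (pi * g x) ^ 4 \<partial>leb {a..b}) =
      3 * m / ((2 * real n + 2) * (2 * real n + 4))"
proof -
  have i: "integrable (leb {a..b}) (\<lambda>x. kern n (g x) * c)" for n c
    by (intro bdd_fun_integrable[OF finite_measure_leb] bdd_fun_intros) measurable
  show 2: "(\<integral>x. kern n (g x) * sin (pi * g x) ^ 2 \<partial>leb {a..b}) = m / (2 * real n + 2)" for n
  proof -
    have "(\<integral>x. kern n (g x) * sin (pi * g x) ^ 2 \<partial>leb {a..b}) =
      (\<integral>x. kern n (g x) * 1 - kern (Suc n) (g x) * ((2 * real n + 1) / (2 * real n + 2)) \<partial>leb {a..b})"
      by (subst kern_sin2) (simp add: mult.commute)
    also have "\<dots> = m - m * ((2 * real n + 1) / (2 * real n + 2))"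
      by (subst Bochner_Integration.integral_diff[OF i i]) (simp add: K)
    also have "\<dots> = m / (2 * real n + 2)" by (simp add: field_simps)
    finally show ?thesis .
  qed
  have i2: "integrable (leb {a..b}) (\<lambda>x. kern n (g x) * sin (pi * g x) ^ 2 * c)" for n c
    by (intro bdd_fun_integrable[OF finite_measure_leb] bdd_fun_intros) measurable
  have "kern n z * sin (pi * z) ^ 4 = kern n z * sin (pi * z) ^ 2 * 1 -
    kern (Suc n) z * sin (pi * z) ^ 2 * ((2 * real n + 1) / (2 * real n + 2))" for z
  proof -
    have "kern n z * sin (pi * z) ^ 4 = (kern n z * sin (pi * z) ^ 2) * sin (pi * z) ^ 2"
      by (simp flip: power_add)
    also have "\<dots> = kern n z * sin (pi * z) ^ 2 * 1 -
    kern (Suc n) z * sin (pi * z) ^ 2 * ((2 * real n + 1) / (2 * real n + 2))"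
      by (subst kern_sin2) (simp add: algebra_simps)
    finally show ?thesis .
  qed
  then have "(\<integral>x. kern n (g x) * sin (pi * g x) ^ 4 \<partial>leb {a..b}) =
     (\<integral>x. kern n (g x) * sin (pi * g x) ^ 2 * 1 -
    kern (Suc n) (g x) * sin (pi * g x) ^ 2 * ((2 * real n + 1) / (2 * real n + 2)) \<partial>leb {a..b})"
    by simp
  also have "\<dots> = m / (2 * real n + 2) - m / (2 * real (Suc n) + 2) * ((2 * real n + 1) / (2 * real n + 2))"
    by (subst Bochner_Integration.integral_diff[OF i2 i2]) (simp add: 2)
  also have "\<dots> = 3 * m / ((2 * real n + 2) * (2 * real n + 4))"
    by (simp add: divide_simps) (simp add: algebra_simps)
  finally show "(\<integral>x. kern n (g x) * sin (pi * g x) ^ 4 \<partial>leb {a..b}) =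
      3 * m / ((2 * real n + 2) * (2 * real n + 4))" .
qed

section \<open>Mean oscillation of a bounded function\<close>

text \<open>
  A common majorant of the mollifier and of the kernel that remains from the flux.
\<close>

definition osc_kern :: "nat \<Rightarrow> real \<Rightarrow> real" where
  "osc_kern n z = kern n z * (1 + 2 * real n * sin (pi * z) ^ 2)"

text \<open>
  Convergence of this quantity to \<open>0\<close> is the continuity of translations in \<open>L\<^sup>1\<close>, averaged over the
  kernel.
\<close>

definition osc :: "nat \<Rightarrow> (real \<Rightarrow> real) \<Rightarrow> real" where
  "osc n w = (\<integral>x. (\<integral>y. \<bar>w x - w y\<bar> * osc_kern n (x - y) \<partial>leb {0..1}) \<partial>leb {0..1})"

lemma osc_kern_measurable [measurable]: "osc_kern n \<in> borel_measurable borel"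
  unfolding osc_kern_def[abs_def] by measurable

lemma bdd_fun_osc_kern [bdd_fun_intros]: "bdd_fun (\<lambda>x. osc_kern n (g x))"
  unfolding osc_kern_def by (intro bdd_fun_intros)

lemma osc_kern_nonneg: "0 \<le> osc_kern n z"
  by (simp add: osc_kern_def kern_nonneg)

lemma kern_le_osc_kern: "kern n z \<le> osc_kern n z"
  using kern_nonneg[of n z] by (simp add: osc_kern_def algebra_simps)

lemma osc_kern_minus: "osc_kern n (- z) = osc_kern n z"
  by (simp add: osc_kern_def kern_minus)

text \<open>
  The second moment of the oscillation kernel.
\<close>

definition osc_rate :: "nat \<Rightarrow> real" where
  "osc_rate n = 1 / (2 * real n + 2) + 2 * real n * (3 / ((2 * real n + 2) * (2 * real n + 4)))"

lemma osc_rate_tendsto: "osc_rate \<longlonglongrightarrow> 0"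
proof -
  have "(\<lambda>n. 1 / (2 * real n + 2)) \<longlonglongrightarrow> 0" by real_asymp
  moreover have "(\<lambda>n. 2 * real n * (3 / ((2 * real n + 2) * (2 * real n + 4)))) \<longlonglongrightarrow> 0" by real_asymp
  ultimately show ?thesis unfolding osc_rate_def[abs_def] using tendsto_add by fastforce
qed

lemma integral_osc_kern_le: "(\<integral>x. osc_kern n (x - y) \<partial>leb {0..1}) \<le> 2"
  and integral_osc_kern_sin2: "(\<integral>x. osc_kern n (x - y) * sin (pi * (x - y)) ^ 2 \<partial>leb {0..1}) = osc_rate n"
proof -
  have i: "integrable (leb {0..1}) (\<lambda>x. kern n (x - y) * sin (pi * (x - y)) ^ k * c)" for k c
    by (intro bdd_fun_integrable[OF finite_measure_leb] bdd_fun_intros) measurable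
  note s = integral_kern_sin2_affine[where g = "\<lambda>x. x - y", OF integral_kern, of n]
  have "(\<integral>x. osc_kern n (x - y) \<partial>leb {0..1}) =
    (\<integral>x. kern n (x - y) * sin (pi * (x - y)) ^ 0 * 1 + kern n (x - y) * sin (pi * (x - y)) ^ 2 * (2 * real n) \<partial>leb {0..1})"
    by (simp add: osc_kern_def algebra_simps)
  also have "\<dots> = 1 + 2 * real n / (2 * real n + 2)"
    by (subst Bochner_Integration.integral_add[OF i i]) (simp add: integral_kern s)
  also have "\<dots> \<le> 2" by (simp add: divide_simps)
  finally show "(\<integral>x. osc_kern n (x - y) \<partial>leb {0..1}) \<le> 2" .
  have "(\<integral>x. osc_kern n (x - y) * sin (pi * (x - y)) ^ 2 \<partial>leb {0..1}) =
    (\<integral>x. kern n (x - y) * sin (pi * (x - y)) ^ 2 * 1 + kern n (x - y) * sin (pi * (x - y)) ^ 4 * (2 * real n) \<partial>leb {0..1})"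
    by (simp add: osc_kern_def algebra_simps flip: power_add)
  also have "\<dots> = osc_rate n"
    by (subst Bochner_Integration.integral_add[OF i i]) (simp add: s osc_rate_def)
  finally show "(\<integral>x. osc_kern n (x - y) * sin (pi * (x - y)) ^ 2 \<partial>leb {0..1}) = osc_rate n" .
qed

lemma integral_osc_kern_le': "(\<integral>y. osc_kern n (x - y) \<partial>leb {0..1}) \<le> 2"
proof -
  have "(\<lambda>y. osc_kern n (x - y)) = (\<lambda>y. osc_kern n (y - x))"
    by (metis osc_kern_minus minus_diff_eq)
  then show ?thesis using integral_osc_kern_le[of n x] by (simp only:)
qed

text \<open>
  A measurable function is almost everywhere a limit of continuous ones.  Truncation allows dominated
  convergence, and a cut-off at the end points makes the approximants continuous on the circle.
\<close>

lemma bounded_approx_continuous: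
  fixes w :: "real \<Rightarrow> real"
  assumes [measurable]: "w \<in> borel_measurable borel" and C: "\<And>x. \<bar>w x\<bar> \<le> C" and "0 < \<epsilon>"
  shows "\<exists>g. continuous_on UNIV g \<and> bdd_fun g \<and> g 0 = 0 \<and> g 1 = 0 \<and> (\<integral>x. \<bar>w x - g x\<bar> \<partial>leb {0..1}) < \<epsilon>"
proof -
  have "w measurable_on UNIV"
    using measurable_completion[of w lborel borel]
    by (simp add: lebesgue_measurable_imp_measurable_on)
  then obtain N g where N: "negligible N" and cont: "\<And>n. continuous_on UNIV (g n)"
    and lim: "\<And>x. x \<notin> N \<Longrightarrow> (\<lambda>n. g n x) \<longlonglongrightarrow> w x"
    unfolding measurable_on_def by auto
  have "0 \<le> C" using C[of 0] by linarith
  define h :: "nat \<Rightarrow> real \<Rightarrow> real"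
    where "h n x = max (- C) (min C (g n x)) * min 1 (real n * max 0 (x * (1 - x)))" for n x
  have conth: "continuous_on UNIV (h n)" for n
    unfolding h_def by (intro continuous_intros cont)
  then have [measurable]: "h n \<in> borel_measurable borel" for n
    by (rule borel_measurable_continuous_onI)
  have hC: "\<bar>h n x\<bar> \<le> C" for n x
  proof -
    have "\<bar>h n x\<bar> \<le> C * 1"
      unfolding h_def abs_mult using \<open>0 \<le> C\<close> by (intro mult_mono) auto
    then show ?thesis by simp
  qed
  have "N \<in> null_sets lebesgue" using N by (simp add: negligible_iff_null_sets)
  then have "AE x in lborel. x \<notin> N" using AE_not_in AE_completion_iff by blast
  moreover have "AE x in lborel. x \<noteq> (0::real)" "AE x in lborel. x \<noteq> (1::real)"
    by (rule AE_lborel_singleton)+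
  ultimately have "AE x in leb {0..1}. (\<lambda>n. \<bar>w x - h n x\<bar>) \<longlonglongrightarrow> 0"
    unfolding AE_leb[OF borel_closed[OF closed_atLeastAtMost]]
  proof eventually_elim
    case (elim x)
    show ?case
    proof
      assume "x \<in> {0..1}"
      with elim have x: "0 < x * (1 - x)" by auto
      have "eventually (\<lambda>n. 1 \<le> real n * (x * (1 - x))) sequentially"
        using x by real_asymp
      then have 1: "eventually (\<lambda>n. max (- C) (min C (g n x)) = h n x) sequentially"
        by eventually_elim (use x in \<open>simp add: h_def\<close>)
      have "(\<lambda>n. max (- C) (min C (g n x))) \<longlonglongrightarrow> max (- C) (min C (w x))"
        using lim elim by (intro tendsto_intros) auto
      then have "(\<lambda>n. h n x) \<longlonglongrightarrow> max (- C) (min C (w x))"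
        using 1 by (rule Lim_transform_eventually)
      also have "max (- C) (min C (w x)) = w x" using C[of x] by auto
      finally show "(\<lambda>n. \<bar>w x - h n x\<bar>) \<longlonglongrightarrow> 0"
        using tendsto_rabs[OF tendsto_diff[OF tendsto_const[of "w x"]]] by fastforce
    qed
  qed
  then have "(\<lambda>n. \<integral>x. \<bar>w x - h n x\<bar> \<partial>leb {0..1}) \<longlonglongrightarrow> (\<integral>x. 0 \<partial>leb {0..1})"
  proof (intro integral_dominated_convergence[where w = "\<lambda>x. 2 * C"])
    show "integrable (leb {0..1}) (\<lambda>x. 2 * C)"
      by (intro bdd_fun_integrable[OF finite_measure_leb] bdd_fun_intros) measurable
    show "AE x in leb {0..1}. norm \<bar>w x - h n x\<bar> \<le> 2 * C" for n
    proof (rule AE_I2)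
      fix x show "norm \<bar>w x - h n x\<bar> \<le> 2 * C" using C[of x] hC[of n x] by simp
    qed
  qed auto
  then have "(\<lambda>n. \<integral>x. \<bar>w x - h n x\<bar> \<partial>leb {0..1}) \<longlonglongrightarrow> 0" by simp
  then have "eventually (\<lambda>n. (\<integral>x. \<bar>w x - h n x\<bar> \<partial>leb {0..1}) < \<epsilon>) sequentially"
    using \<open>0 < \<epsilon>\<close> by (rule order_tendstoD)
  then obtain n where "(\<integral>x. \<bar>w x - h n x\<bar> \<partial>leb {0..1}) < \<epsilon>"
    by (auto simp: eventually_sequentially)
  then show ?thesis
    using conth[of n] bdd_funI[of "h n", OF hC] by (intro exI[of _ "h n"]) (auto simp: h_def)
qed

text \<open>
  In the unit square \<open>sin\<^sup>2 (\<pi> (x - y))\<close> vanishes on the diagonal and at two corners, and there \<open>g\<close> takes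
  equal values.
\<close>

lemma continuous_le_sin2:
  fixes g :: "real \<Rightarrow> real"
  assumes "continuous_on UNIV g" "g 0 = 0" "g 1 = 0" "0 < \<epsilon>"
  shows "\<exists>K\<ge>0. \<forall>x\<in>{0..1}. \<forall>y\<in>{0..1}. \<bar>g x - g y\<bar> \<le> \<epsilon> + K * sin (pi * (x - y)) ^ 2"
proof -
  have "\<exists>K\<ge>0. \<forall>p\<in>{0..1} \<times> {0..1}. \<bar>g (fst p) - g (snd p)\<bar> \<le> \<epsilon> + K * sin (pi * (fst p - snd p)) ^ 2"
  proof (intro bound_by_small_plus_multiple)
    show "continuous_on ({0..1} \<times> {0..1}) (\<lambda>p. \<bar>g (fst p) - g (snd p)\<bar>)"
      by (intro continuous_on_rabs continuous_on_diff continuous_on_compose2[OF assms(1)]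
        continuous_on_fst continuous_on_snd continuous_on_id) auto
    fix p :: "real \<times> real" assume p: "p \<in> {0..1} \<times> {0..1}" and "sin (pi * (fst p - snd p)) ^ 2 = 0"
    then have "sin (pi * (fst p - snd p)) = 0" by simp
    then obtain i where i: "pi * (fst p - snd p) = of_int i * pi" by (auto simp: sin_zero_iff_int2)
    then have "fst p - snd p = of_int i" by (simp add: mult.commute)
    moreover from this p have "-1 \<le> i" "i \<le> 1" by auto
    ultimately have "fst p - snd p = -1 \<or> fst p = snd p \<or> fst p - snd p = 1"
    proof -
      assume "fst p - snd p = of_int i" "-1 \<le> i" "i \<le> 1"
      moreover from this(2,3) have "i = -1 \<or> i = 0 \<or> i = 1" by linarith
      ultimately show ?thesis by auto
    qed
    with p have "fst p = 0 \<and> snd p = 1 \<or> fst p = snd p \<or> fst p = 1 \<and> snd p = 0" by auto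
    then show "\<bar>g (fst p) - g (snd p)\<bar> \<le> 0" using assms by auto
  qed (auto intro!: compact_Times assms(4) continuous_on_power continuous_on_sin continuous_on_mult
      continuous_on_diff continuous_on_fst continuous_on_snd)
  then show ?thesis by force
qed

lemma osc_nonneg: "0 \<le> osc n w"
  unfolding osc_def by (intro Bochner_Integration.integral_nonneg mult_nonneg_nonneg abs_ge_zero osc_kern_nonneg)

text \<open>
  For a continuous function on the circle the oscillation is controlled by the second moment of the
  kernel.  The kernels have bounded mass, so an approximation in \<open>L\<^sup>1\<close> changes the oscillation little,
  uniformly in \<open>n\<close>.
\<close>

lemma osc_tendsto_0:
  fixes w :: "real \<Rightarrow> real"
  assumes [measurable]: "w \<in> borel_measurable borel" and "bdd_fun w"
  shows "(\<lambda>n. osc n w) \<longlonglongrightarrow> 0"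
proof (rule LIMSEQ_I)
  fix r :: real assume "0 < r"
  define \<epsilon> where "\<epsilon> = r / 8"
  have "0 < \<epsilon>" using \<open>0 < r\<close> by (simp add: \<epsilon>_def)
  let ?M = "leb {0..1}"
  have fin: "finite_measure ?M" by (rule finite_measure_leb)
  obtain C where "\<And>x. \<bar>w x\<bar> \<le> C" using \<open>bdd_fun w\<close> unfolding bdd_fun_def by blast
  from bounded_approx_continuous[OF assms(1) this \<open>0 < \<epsilon>\<close>]
  obtain g where g: "continuous_on UNIV g" "bdd_fun g" "g 0 = 0" "g 1 = 0" "(\<integral>x. \<bar>w x - g x\<bar> \<partial>?M) < \<epsilon>"
    by blast
  have [measurable]: "g \<in> borel_measurable borel" using g(1) by (rule borel_measurable_continuous_onI)
  note [bdd_fun_intros] = bdd_fun_compose[OF g(2)] bdd_fun_compose[OF \<open>bdd_fun w\<close>]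
  from continuous_le_sin2[OF g(1,3,4) \<open>0 < \<epsilon>\<close>] obtain K where K: "0 \<le> K"
    and "\<forall>x\<in>{0..1}. \<forall>y\<in>{0..1}. \<bar>g x - g y\<bar> \<le> \<epsilon> + K * sin (pi * (x - y)) ^ 2" by (elim exE conjE)
  then have K2: "\<bar>g x - g y\<bar> \<le> \<epsilon> + K * sin (pi * (x - y)) ^ 2" if "x \<in> {0..1}" "y \<in> {0..1}" for x y
    using that by (elim ballE) auto
  have bound: "osc n w \<le> 6 * \<epsilon> + K * osc_rate n" for n
  proof -
    let ?P = "?M \<Otimes>\<^sub>M ?M"
    have finP: "finite_measure ?P" by (intro finite_measure_pair_measure fin)
    let ?k = "\<lambda>p. osc_kern n (fst p - snd p)" and ?d = "\<lambda>x. \<bar>w x - g x\<bar>"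
    have AEM: "AE x in ?M. x \<in> {0..1}" by (rule AE_leb_mem) simp
    have AEP: "AE p in ?P. fst p \<in> {0..1} \<and> snd p \<in> {0..1}"
    proof -
      interpret finite_measure ?M by (rule fin)
      interpret pair_sigma_finite ?M ?M ..
      show ?thesis
      proof (rule AE_pair_measure)
        show "AE x in ?M. AE y in ?M. fst (x, y) \<in> {0..1} \<and> snd (x, y) \<in> {0..1}"
          using AEM
        proof eventually_elim
          case (elim x)
          show ?case using AEM by eventually_elim (use elim in simp)
        qed
      qed measurable
    qed
    have I1: "integrable ?M h" if "h \<in> borel_measurable ?M" "bdd_fun h" for h
      using bdd_fun_integrable[OF fin that] .
    have I: "integrable ?P h" if "h \<in> borel_measurable (?M \<Otimes>\<^sub>M ?M)" "bdd_fun h" for h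
      using bdd_fun_integrable[OF finP that] .
    have "osc n w = (\<integral>p. \<bar>w (fst p) - w (snd p)\<bar> * ?k p \<partial>?P)"
      unfolding osc_def by (subst integral_pair[OF fin fin]) (measurable, intro bdd_fun_intros, simp)
    also have "\<dots> \<le> (\<integral>p. ?d (fst p) * ?k p + ?d (snd p) * ?k p + (\<epsilon> * ?k p + K * (?k p * sin (pi * (fst p - snd p)) ^ 2)) \<partial>?P)"
    proof (rule integral_mono_AE)
      show "AE p in ?P. \<bar>w (fst p) - w (snd p)\<bar> * ?k p \<le> ?d (fst p) * ?k p + ?d (snd p) * ?k p + (\<epsilon> * ?k p + K * (?k p * sin (pi * (fst p - snd p)) ^ 2))"
        using AEP
      proof eventually_elim
        case (elim p)
        then have "\<bar>w (fst p) - w (snd p)\<bar> \<le> ?d (fst p) + ?d (snd p) + (\<epsilon> + K * sin (pi * (fst p - snd p)) ^ 2)"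
          using K2[of "fst p" "snd p"] by linarith
        from mult_right_mono[OF this osc_kern_nonneg[of n "fst p - snd p"]]
        show ?case by (simp add: algebra_simps)
      qed
    qed (rule I, measurable, intro bdd_fun_intros)+
    also have "\<dots> = (\<integral>p. ?d (fst p) * ?k p \<partial>?P) + (\<integral>p. ?d (snd p) * ?k p \<partial>?P)
       + (\<epsilon> * (\<integral>p. ?k p \<partial>?P) + K * (\<integral>p. ?k p * sin (pi * (fst p - snd p)) ^ 2 \<partial>?P))"
    proof -
      have i: "integrable ?P (\<lambda>p. ?d (fst p) * ?k p)" "integrable ?P (\<lambda>p. ?d (snd p) * ?k p)"
        "integrable ?P ?k" "integrable ?P (\<lambda>p. ?k p * sin (pi * (fst p - snd p)) ^ 2)"
        by (rule I, measurable, intro bdd_fun_intros)+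
      show ?thesis using i by simp
    qed
    also have "(\<integral>p. ?d (fst p) * ?k p \<partial>?P) \<le> 2 * \<epsilon>"
    proof -
      have "(\<integral>p. ?d (fst p) * ?k p \<partial>?P) = (\<integral>x. (\<integral>y. ?d x * osc_kern n (x - y) \<partial>?M) \<partial>?M)"
        by (subst integral_pair[OF fin fin]) (measurable, intro bdd_fun_intros, simp)
      also have "\<dots> = (\<integral>x. ?d x * (\<integral>y. osc_kern n (x - y) \<partial>?M) \<partial>?M)" by simp
      also have "\<dots> \<le> (\<integral>x. ?d x * 2 \<partial>?M)"
        by (rule integral_mono[OF I1 I1 mult_left_mono[OF integral_osc_kern_le']])
          (measurable, intro bdd_fun_intros fin, measurable, intro bdd_fun_intros fin, simp)
      also have "\<dots> \<le> 2 * \<epsilon>" using g(5) by simp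
      finally show ?thesis .
    qed
    also have "(\<integral>p. ?d (snd p) * ?k p \<partial>?P) \<le> 2 * \<epsilon>"
    proof -
      have "(\<integral>p. ?d (snd p) * ?k p \<partial>?P) = (\<integral>x. (\<integral>y. ?d y * osc_kern n (x - y) \<partial>?M) \<partial>?M)"
        by (subst integral_pair[OF fin fin]) (measurable, intro bdd_fun_intros, simp)
      also have "\<dots> = (\<integral>y. (\<integral>x. ?d y * osc_kern n (x - y) \<partial>?M) \<partial>?M)"
        by (rule integral_swap[OF fin fin]) (measurable, intro bdd_fun_intros)
      also have "\<dots> = (\<integral>y. ?d y * (\<integral>x. osc_kern n (x - y) \<partial>?M) \<partial>?M)" by simp
      also have "\<dots> \<le> (\<integral>x. ?d x * 2 \<partial>?M)"
        by (rule integral_mono[OF I1 I1 mult_left_mono[OF integral_osc_kern_le]])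
          (measurable, intro bdd_fun_intros fin, measurable, intro bdd_fun_intros fin, simp)
      also have "\<dots> \<le> 2 * \<epsilon>" using g(5) by simp
      finally show ?thesis .
    qed
    also have "(\<integral>p. ?k p \<partial>?P) \<le> 2"
    proof -
      have "(\<integral>p. ?k p \<partial>?P) = (\<integral>x. (\<integral>y. osc_kern n (x - y) \<partial>?M) \<partial>?M)"
        by (subst integral_pair[OF fin fin]) (measurable, intro bdd_fun_intros, simp)
      also have "\<dots> \<le> (\<integral>x. 2 \<partial>?M)"
        by (rule integral_mono[OF I1 I1 integral_osc_kern_le'])
          (measurable, intro bdd_fun_intros fin, measurable, intro bdd_fun_intros fin)
      finally show ?thesis by (simp add: prob_measure_leb)
    qed
    also have "(\<integral>p. ?k p * sin (pi * (fst p - snd p)) ^ 2 \<partial>?P) = osc_rate n"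
    proof -
      have "(\<integral>p. ?k p * sin (pi * (fst p - snd p)) ^ 2 \<partial>?P) = (\<integral>x. (\<integral>y. osc_kern n (x - y) * sin (pi * (x - y)) ^ 2 \<partial>?M) \<partial>?M)"
        by (subst integral_pair[OF fin fin]) (measurable, intro bdd_fun_intros, simp)
      also have "\<dots> = (\<integral>y. (\<integral>x. osc_kern n (x - y) * sin (pi * (x - y)) ^ 2 \<partial>?M) \<partial>?M)"
        by (rule integral_swap[OF fin fin]) (measurable, intro bdd_fun_intros)
      finally show ?thesis by (simp add: prob_measure_leb integral_osc_kern_sin2)
    qed
    finally show ?thesis using \<open>0 < \<epsilon>\<close> K by simp
  qed
  have "(\<lambda>n. 6 * \<epsilon> + K * osc_rate n) \<longlonglongrightarrow> 6 * \<epsilon> + K * 0"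
    by (intro tendsto_intros osc_rate_tendsto)
  moreover have "6 * \<epsilon> + K * 0 < r" using \<open>0 < r\<close> by (simp add: \<epsilon>_def)
  ultimately have "eventually (\<lambda>n. 6 * \<epsilon> + K * osc_rate n < r) sequentially"
    by (rule order_tendstoD(2))
  then obtain N where "\<And>n. n \<ge> N \<Longrightarrow> 6 * \<epsilon> + K * osc_rate n < r"
    by (auto simp: eventually_sequentially)
  then show "\<exists>N. \<forall>n\<ge>N. norm (osc n w - 0) < r"
  proof (intro exI[of _ N] allI impI)
    fix n assume "N \<le> n"
    with \<open>\<And>n. n \<ge> N \<Longrightarrow> _\<close> have "6 * \<epsilon> + K * osc_rate n < r" by blast
    with bound[of n] osc_nonneg[of n w] show "norm (osc n w - 0) < r" by simp
  qed
qed

section \<open>The flux near the diagonal\<close>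

lemma abs_le_abs_sin_pi:
  fixes z :: real
  assumes "\<bar>z\<bar> \<le> 1 / 2"
  shows "\<bar>z\<bar> \<le> \<bar>sin (pi * z)\<bar>"
proof -
  have pos: "z \<le> sin (pi * z)" if "0 \<le> z" "z \<le> 1 / 2" for z :: real
  proof (cases "z \<le> 1 / 3")
    case True
    have "\<exists>l. ((\<lambda>z. sin (pi * z) - z) has_real_derivative l) (at x) \<and> 0 \<le> l" if "0 \<le> x" "x \<le> z" for x
    proof (intro exI conjI)
      show "((\<lambda>z. sin (pi * z) - z) has_real_derivative cos (pi * x) * pi - 1) (at x)"
        by (auto intro!: derivative_eq_intros)
      have "pi * x \<le> pi / 3" using that True by simp
      then have "cos (pi / 3) \<le> cos (pi * x)"
        using that by (intro cos_monotone_0_pi_le) auto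
      then have "1 / 2 * 2 \<le> cos (pi * x) * pi"
        using pi_ge_two by (intro mult_mono) (auto simp: cos_60)
      then show "0 \<le> cos (pi * x) * pi - 1" by simp
    qed
    from DERIV_nonneg_imp_nondecreasing[of 0 z, OF that(1) this] show ?thesis by simp
  next
    case False
    then have "sin (pi / 6) \<le> sin (pi * z)"
      using that by (intro sin_monotone_2pi_le) (auto simp: field_simps)
    then show ?thesis using that by (simp add: sin_30)
  qed
  show ?thesis
  proof (cases "0 \<le> z")
    case True then show ?thesis using pos[of z] assms by simp
  next
    case False then show ?thesis using pos[of "- z"] assms by simp
  qed
qed

lemma periodic_add_int:
  assumes "\<And>x. g (x + 1) = (g x :: 'a)"
  shows "g (x + of_int i) = g (x :: real)"
proof (induction i rule: int_induct[where k = 0])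
  case (step1 i)
  then show ?case using assms[of "x + of_int i"] by (simp add: add.assoc)
next
  case (step2 i)
  then show ?case using assms[of "x + of_int (i - 1)"] by (simp add: algebra_simps)
qed simp

lemma sin_pi_add_int: "\<bar>sin (pi * (z + of_int i))\<bar> = \<bar>sin (pi * z)\<bar>"
  by (rule periodic_add_int[of "\<lambda>z. \<bar>sin (pi * z)\<bar>"]) (simp add: distrib_left)

lemma continuous_periodic_bounded:
  fixes g :: "real \<Rightarrow> real \<Rightarrow> real"
  assumes "continuous_on UNIV (\<lambda>(a, b). g a b)" "\<And>x w. g (x + 1) w = g x w"
  shows "\<exists>B\<ge>0. \<forall>x w. \<bar>w\<bar> \<le> C \<longrightarrow> \<bar>g x w\<bar> \<le> B"
proof -
  have "compact ((\<lambda>(a, b). g a b) ` ({0..1} \<times> {-C..C}))"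
    using assms(1) by (intro compact_continuous_image compact_Times continuous_on_subset[OF assms(1)]) auto
  then obtain B where B: "0 < B" "\<And>p. p \<in> {0..1} \<times> {-C..C} \<Longrightarrow> \<bar>(\<lambda>(a, b). g a b) p\<bar> \<le> B"
    using compact_imp_bounded bounded_pos by (metis image_eqI real_norm_def)
  have "\<bar>g x w\<bar> \<le> B" if "\<bar>w\<bar> \<le> C" for x w
  proof -
    have "g x w = g (frac x) w"
      using periodic_add_int[of "\<lambda>x. g x w" "frac x" "\<lfloor>x\<rfloor>"] assms(2) by (simp add: frac_def)
    moreover have "frac x \<in> {0..1}" using frac_ge_0[of x] frac_lt_1[of x] by simp
    moreover have "w \<in> {-C..C}" using that by auto
    ultimately show ?thesis using B(2)[of "(frac x, w)"] by auto
  qed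
  then show ?thesis using B(1) by (intro exI[of _ B]) auto
qed

lemma partial1_periodic: "(\<And>x w. f (x + 1) w = f x w) \<Longrightarrow> partial1 f (x + 1) w = partial1 f x w"
  unfolding partial1_def deriv_def
  by (simp add: DERIV_shift)

lemma partial2_periodic: "(\<And>x w. f (x + 1) w = f x w) \<Longrightarrow> partial2 f (x + 1) w = partial2 f x w"
proof -
  assume "\<And>x w. f (x + 1) w = f x w"
  then have "f (x + 1) = f x" by blast
  then show ?thesis unfolding partial2_def by simp
qed

lemma has_derivative_partial1:
  "(\<lambda>s. g s b) differentiable (at a) \<Longrightarrow> ((\<lambda>s. g s b) has_real_derivative partial1 g a b) (at a)"
  unfolding partial1_def by (simp add: DERIV_deriv_iff_real_differentiable)

lemma has_derivative_partial2:
  "(\<lambda>s. g a s) differentiable (at b) \<Longrightarrow> ((\<lambda>s. g a s) has_real_derivative partial2 g a b) (at b)"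
  unfolding partial2_def by (simp add: DERIV_deriv_iff_real_differentiable)

lemma abs_diff_le_of_deriv_bound:
  fixes g :: "real \<Rightarrow> real"
  assumes D: "\<And>z. min a b \<le> z \<Longrightarrow> z \<le> max a b \<Longrightarrow> (g has_real_derivative g' z) (at z)"
    and B: "\<And>z. min a b \<le> z \<Longrightarrow> z \<le> max a b \<Longrightarrow> \<bar>g' z\<bar> \<le> B"
  shows "\<bar>g a - g b\<bar> \<le> B * \<bar>a - b\<bar>"
proof -
  have "norm (g a - g b) \<le> B * norm (a - b)"
  proof (rule differentiable_bound[of "{min a b..max a b}" g "\<lambda>z. (*) (g' z)"])
    fix z assume z: "z \<in> {min a b..max a b}"
    then show "(g has_derivative (*) (g' z)) (at z within {min a b..max a b})"
      using D[of z] by (auto simp: has_field_derivative_def intro: has_derivative_at_withinI)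
    show "onorm ((*) (g' z)) \<le> B"
      using B[of z] z by (intro onorm_le) (auto simp: abs_mult intro!: mult_right_mono)
  qed auto
  then show ?thesis by simp
qed

text \<open>
  The constants of a periodic flux on \<open>|w| \<le> C\<close>.  In the last clause, the linearisation in \<open>x\<close> at \<open>y\<close>,
  the periodic function \<open>sin (\<pi> z) cos (\<pi> z) / \<pi>\<close> replaces \<open>z = x - y\<close>.
\<close>

definition flux_const :: "(real \<Rightarrow> real \<Rightarrow> real) \<Rightarrow> real \<Rightarrow> real \<Rightarrow> bool" where
  "flux_const f C B \<longleftrightarrow> 0 \<le> B \<and> (\<forall>x y w w'. \<bar>w\<bar> \<le> C \<longrightarrow> \<bar>w'\<bar> \<le> C \<longrightarrow>
     \<bar>f x w\<bar> \<le> B \<and> \<bar>partial1 f x w\<bar> \<le> B \<and>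
     \<bar>partial1 f x w - partial1 f x w'\<bar> \<le> B * \<bar>w - w'\<bar> \<and>
     \<bar>partial1 f x w - partial1 f y w\<bar> \<le> B * \<bar>sin (pi * (x - y))\<bar> \<and>
     \<bar>f x w - f y w - partial1 f y w * (sin (pi * (x - y)) * cos (pi * (x - y)) / pi)\<bar>
       \<le> B * sin (pi * (x - y)) ^ 2)"

text \<open>
  By periodicity \<open>x\<close> may be assumed within \<open>1/2\<close> of \<open>y\<close>, where \<open>|x - y| \<le> |sin (\<pi> (x - y))|\<close>.  The
  mean value theorem then gives all clauses; for the last one the derivative of the remainder
  vanishes at the diagonal to first order.
\<close>

lemma flux_const_exists:
  assumes "Ck 2 f" and per: "\<And>x w. f (x + 1) w = f x w"
  shows "\<exists>B. flux_const f C B"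
proof -
  let ?fx = "partial1 f"
  have ck: "continuous_on UNIV (\<lambda>(a, b). f a b)" "\<And>a b. (\<lambda>s. f s b) differentiable (at a)"
    "continuous_on UNIV (\<lambda>(a, b). ?fx a b)" "\<And>a b. (\<lambda>s. ?fx s b) differentiable (at a)"
    "\<And>a b. (\<lambda>s. ?fx a s) differentiable (at b)"
    "continuous_on UNIV (\<lambda>(a, b). partial1 ?fx a b)" "continuous_on UNIV (\<lambda>(a, b). partial2 ?fx a b)"
    using assms(1) by (auto simp: numeral_2_eq_2)
  have perx: "?fx (x + 1) w = ?fx x w" for x w using per by (rule partial1_periodic)
  have perxx: "partial1 ?fx (x + 1) w = partial1 ?fx x w" for x w
    by (rule partial1_periodic[where f = ?fx]) (rule perx)
  have perxw: "partial2 ?fx (x + 1) w = partial2 ?fx x w" for x w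
    by (rule partial2_periodic[where f = ?fx]) (rule perx)
  obtain B1 where B1: "0 \<le> B1" "\<And>x w. \<bar>w\<bar> \<le> C \<Longrightarrow> \<bar>f x w\<bar> \<le> B1"
    using continuous_periodic_bounded[OF ck(1) per] by blast
  obtain B2 where B2: "0 \<le> B2" "\<And>x w. \<bar>w\<bar> \<le> C \<Longrightarrow> \<bar>?fx x w\<bar> \<le> B2"
    using continuous_periodic_bounded[OF ck(3) perx] by blast
  obtain B3 where B3: "0 \<le> B3" "\<And>x w. \<bar>w\<bar> \<le> C \<Longrightarrow> \<bar>partial1 ?fx x w\<bar> \<le> B3"
    using continuous_periodic_bounded[OF ck(6) perxx] by blast
  obtain B4 where B4: "0 \<le> B4" "\<And>x w. \<bar>w\<bar> \<le> C \<Longrightarrow> \<bar>partial2 ?fx x w\<bar> \<le> B4"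
    using continuous_periodic_bounded[OF ck(7) perxw] by blast
  define B where "B = B1 + B3 + B4 + B2 * (1 + 2 * pi)"
  have B2pi: "B2 \<le> B2 * (1 + 2 * pi)" using B2(1) by (simp add: algebra_simps)
  have B0: "0 \<le> B" using B1(1) B2(1) B3(1) B4(1) by (simp add: B_def)
  have lipx: "\<bar>?fx x w - ?fx y w\<bar> \<le> B3 * \<bar>x - y\<bar>" if "\<bar>w\<bar> \<le> C" for x y w
    by (rule abs_diff_le_of_deriv_bound[where g' = "\<lambda>z. partial1 ?fx z w"])
      (use B3(2)[OF that] has_derivative_partial1[OF ck(4)] in auto)
  have lipw: "\<bar>?fx x w - ?fx x w'\<bar> \<le> B4 * \<bar>w - w'\<bar>" if "\<bar>w\<bar> \<le> C" "\<bar>w'\<bar> \<le> C" for x w w'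
    by (rule abs_diff_le_of_deriv_bound[where g' = "\<lambda>z. partial2 ?fx x z"])
      (use that B4(2) has_derivative_partial2[OF ck(5)] in auto)
  let ?R = "\<lambda>w y z. f (y + z) w - f y w - ?fx y w * (sin (pi * z) * cos (pi * z) / pi)"
  \<comment> \<open>the derivative of the remainder is \<open>O(|z|)\<close>, so the remainder is \<open>O(z\<^sup>2)\<close>\<close>
  have rem: "\<bar>?R w y z\<bar> \<le> (B3 + B2 * (2 * pi)) * z ^ 2" if w: "\<bar>w\<bar> \<le> C" for w y z
  proof -
    have "\<bar>?R w y z - ?R w y 0\<bar> \<le> ((B3 + B2 * (2 * pi)) * \<bar>z\<bar>) * \<bar>z - 0\<bar>"
    proof (rule abs_diff_le_of_deriv_bound[where g' = "\<lambda>z. ?fx (y + z) w - ?fx y w * (1 - 2 * sin (pi * z) ^ 2)"])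
      fix t
      have "((\<lambda>z. f (y + z) w) has_real_derivative ?fx (y + t) w) (at t)"
      proof -
        have "((\<lambda>s. f s w) has_real_derivative ?fx (y + t) w) (at (y + t))"
          by (rule has_derivative_partial1[where g = f]) (rule ck(2))
        moreover have "((\<lambda>z. y + z) has_real_derivative 1) (at t)"
          by (auto intro!: derivative_eq_intros)
        ultimately show ?thesis
          using DERIV_chain2[where f = "\<lambda>s. f s w" and g = "\<lambda>z. y + z" and x = t and s = UNIV] by fastforce
      qed
      moreover have "((\<lambda>z. sin (pi * z) * cos (pi * z) / pi) has_real_derivative 1 - 2 * sin (pi * t) ^ 2) (at t)"
      proof -
        have "((\<lambda>z. sin (pi * z) * cos (pi * z) / pi) has_real_derivative
          (cos (pi * t) * pi * cos (pi * t) + (- sin (pi * t) * pi) * sin (pi * t)) / pi) (at t)"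
          by (auto intro!: derivative_eq_intros)
        also have "(cos (pi * t) * pi * cos (pi * t) + (- sin (pi * t) * pi) * sin (pi * t)) / pi
           = cos (pi * t) ^ 2 - sin (pi * t) ^ 2" by (simp add: field_simps power2_eq_square)
        also have "\<dots> = 1 - 2 * sin (pi * t) ^ 2" by (simp add: cos_squared_eq)
        finally show ?thesis .
      qed
      ultimately show "(?R w y has_real_derivative ?fx (y + t) w - ?fx y w * (1 - 2 * sin (pi * t) ^ 2)) (at t)"
        by (rule DERIV_cong[OF DERIV_diff[OF DERIV_diff[OF _ DERIV_const] DERIV_cmult]]) simp
      assume "min z 0 \<le> t" "t \<le> max z 0"
      then have tz: "\<bar>t\<bar> \<le> \<bar>z\<bar>" by auto
      have "sin (pi * t) ^ 2 \<le> \<bar>sin (pi * t)\<bar>"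
        using power_le_one_iff abs_sin_le_one[of "pi * t"] mult_left_le_one_le[of "\<bar>sin (pi * t)\<bar>" "\<bar>sin (pi * t)\<bar>"]
        by (simp add: power2_eq_square flip: abs_mult)
      also have "\<dots> \<le> pi * \<bar>t\<bar>" using abs_sin_x_le_abs_x[of "pi * t"] by (simp add: abs_mult)
      also have "\<dots> \<le> pi * \<bar>z\<bar>" using tz by simp
      finally have s: "sin (pi * t) ^ 2 \<le> pi * \<bar>z\<bar>" .
      have "?fx (y + t) w - ?fx y w * (1 - 2 * sin (pi * t) ^ 2) = (?fx (y + t) w - ?fx y w) + ?fx y w * (2 * sin (pi * t) ^ 2)"
        by (simp add: algebra_simps)
      also have "\<bar>\<dots>\<bar> \<le> B3 * \<bar>z\<bar> + B2 * (2 * (pi * \<bar>z\<bar>))"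
      proof -
        have "\<bar>?fx (y + t) w - ?fx y w\<bar> \<le> B3 * \<bar>z\<bar>"
          using lipx[OF w, of "y + t" y] mult_left_mono[OF tz B3(1)] by simp
        moreover have "\<bar>?fx y w * (2 * sin (pi * t) ^ 2)\<bar> \<le> B2 * (2 * (pi * \<bar>z\<bar>))"
          unfolding abs_mult using B2(2)[OF w, of y] s B2(1) by (intro mult_mono) auto
        ultimately show ?thesis by linarith
      qed
      finally show "\<bar>?fx (y + t) w - ?fx y w * (1 - 2 * sin (pi * t) ^ 2)\<bar> \<le> (B3 + B2 * (2 * pi)) * \<bar>z\<bar>"
        by (simp add: algebra_simps)
    qed
    then show ?thesis by (simp add: power2_eq_square mult.assoc)
  qed
  \<comment> \<open>an integer shift brings \<open>x\<close> to within \<open>1/2\<close> of \<open>y\<close>\<close>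
  have red: "\<exists>x'. \<bar>x' - y\<bar> \<le> \<bar>sin (pi * (x - y))\<bar> \<and> f x w = f x' w \<and> ?fx x w = ?fx x' w \<and>
      sin (pi * (x - y)) * cos (pi * (x - y)) = sin (pi * (x' - y)) * cos (pi * (x' - y))" for x y w
  proof -
    define i where "i = round (x - y)"
    define x' where "x' = x + of_int (- i)"
    have "\<bar>x' - y\<bar> \<le> 1 / 2"
      using of_int_round_abs_le[of "x - y"] by (simp add: x'_def i_def abs_minus_commute algebra_simps)
    then have "\<bar>x' - y\<bar> \<le> \<bar>sin (pi * (x' - y))\<bar>" by (rule abs_le_abs_sin_pi)
    also have "\<dots> = \<bar>sin (pi * (x - y))\<bar>"
      using sin_pi_add_int[of "x - y" "- i"] by (simp add: x'_def algebra_simps)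
    finally have "\<bar>x' - y\<bar> \<le> \<bar>sin (pi * (x - y))\<bar>" .
    moreover have "f x w = f x' w" "?fx x w = ?fx x' w"
      unfolding x'_def using periodic_add_int[of "\<lambda>x. f x w" x "- i"] periodic_add_int[of "\<lambda>x. ?fx x w" x "- i"] per perx
      by auto
    moreover have "sin (pi * (x - y)) * cos (pi * (x - y)) = sin (pi * (x' - y)) * cos (pi * (x' - y))"
      using periodic_add_int[of "\<lambda>z. sin (pi * z) * cos (pi * z)" "x - y" "- i"]
      by (simp add: x'_def algebra_simps sin_add cos_add)
    ultimately show ?thesis by blast
  qed
  have "\<bar>f x w\<bar> \<le> B \<and> \<bar>?fx x w\<bar> \<le> B \<and> \<bar>?fx x w - ?fx x w'\<bar> \<le> B * \<bar>w - w'\<bar> \<and>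
     \<bar>?fx x w - ?fx y w\<bar> \<le> B * \<bar>sin (pi * (x - y))\<bar> \<and>
     \<bar>f x w - f y w - ?fx y w * (sin (pi * (x - y)) * cos (pi * (x - y)) / pi)\<bar> \<le> B * sin (pi * (x - y)) ^ 2"
    if w: "\<bar>w\<bar> \<le> C" "\<bar>w'\<bar> \<le> C" for x y w w'
  proof (intro conjI)
    show "\<bar>f x w\<bar> \<le> B" "\<bar>?fx x w\<bar> \<le> B"
      using B1 B2 B3(1) B4(1) B2pi B1(2)[OF w(1), of x] B2(2)[OF w(1), of x] by (auto simp: B_def)
    have "B4 * \<bar>w - w'\<bar> \<le> B * \<bar>w - w'\<bar>"
      using B1(1) B2(1) B3(1) by (intro mult_right_mono) (auto simp: B_def)
    then show "\<bar>?fx x w - ?fx x w'\<bar> \<le> B * \<bar>w - w'\<bar>" using lipw[OF w, of x] by linarith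
    obtain x' where x': "\<bar>x' - y\<bar> \<le> \<bar>sin (pi * (x - y))\<bar>" "f x w = f x' w" "?fx x w = ?fx x' w"
      "sin (pi * (x - y)) * cos (pi * (x - y)) = sin (pi * (x' - y)) * cos (pi * (x' - y))"
      using red by blast
    have "B3 * \<bar>x' - y\<bar> \<le> B * \<bar>sin (pi * (x - y))\<bar>"
      using B1(1) B2(1) B4(1) B3(1) x'(1) by (intro mult_mono B0) (auto simp: B_def)
    then show "\<bar>?fx x w - ?fx y w\<bar> \<le> B * \<bar>sin (pi * (x - y))\<bar>"
      using lipx[OF w(1), of x' y] x'(3) by linarith
    have "(x' - y) ^ 2 \<le> sin (pi * (x - y)) ^ 2" using x'(1) by (simp add: abs_le_square_iff)
    then have "(B3 + B2 * (2 * pi)) * (x' - y) ^ 2 \<le> B * sin (pi * (x - y)) ^ 2"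
      using B1(1) B2(1) B4(1) B3(1) by (intro mult_mono B0) (auto simp: B_def algebra_simps)
    then show "\<bar>f x w - f y w - ?fx y w * (sin (pi * (x - y)) * cos (pi * (x - y)) / pi)\<bar> \<le> B * sin (pi * (x - y)) ^ 2"
      using rem[OF w(1), of y "x' - y"] x'(2,4) by simp
  qed
  then show ?thesis unfolding flux_const_def using B0 by blast
qed

text \<open>
  The kernel \<open>sin (2 \<pi> z) / (2 \<pi>) \<rho>'(z) + \<rho>(z)\<close>, as \<open>flux_kern_eq\<close> shows.
\<close>

definition flux_kern :: "nat \<Rightarrow> real \<Rightarrow> real" where
  "flux_kern n z = kern n z * (1 - 2 * real n * sin (pi * z) ^ 2)"

lemma flux_kern_eq: "sin (pi * z) * cos (pi * z) / pi * dkern n z + kern n z = flux_kern n z"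
proof (cases n)
  case (Suc m)
  then show ?thesis
    using cos_mass_pos[of n]
    by (simp add: flux_kern_def dkern_def kern_def divide_simps) (simp add: algebra_simps power2_eq_square)
qed (simp add: flux_kern_def dkern_def kern_def)

lemma abs_flux_kern_le: "\<bar>flux_kern n z\<bar> \<le> osc_kern n z"
proof -
  have "\<bar>1 - 2 * real n * sin (pi * z) ^ 2\<bar> \<le> 1 + 2 * real n * sin (pi * z) ^ 2"
    by (simp add: abs_le_iff)
  then show ?thesis
    unfolding flux_kern_def osc_kern_def abs_mult using kern_nonneg[of n z] by (simp add: mult_left_mono)
qed

lemma flux_kern_measurable [measurable]: "flux_kern n \<in> borel_measurable borel"
  unfolding flux_kern_def[abs_def] by measurable

lemma bdd_fun_flux_kern [bdd_fun_intros]: "bdd_fun (\<lambda>x. flux_kern n (g x))"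
  unfolding flux_kern_def by (intro bdd_fun_intros)

text \<open>
  The cancellation that makes the flux harmless: derivative and mollifier almost compensate.
\<close>

lemma integral_flux_kern: "(\<integral>x. flux_kern n (x - y) \<partial>leb {0..1}) = 1 / (real n + 1)"
proof -
  have i: "integrable (leb {0..1}) (\<lambda>x. kern n (x - y) * sin (pi * (x - y)) ^ k * c)" for k c
    by (intro bdd_fun_integrable[OF finite_measure_leb] bdd_fun_intros) measurable
  note s = integral_kern_sin2_affine[where g = "\<lambda>x. x - y", OF integral_kern, of n]
  have "(\<integral>x. flux_kern n (x - y) \<partial>leb {0..1}) =
    (\<integral>x. kern n (x - y) * sin (pi * (x - y)) ^ 0 * 1 - kern n (x - y) * sin (pi * (x - y)) ^ 2 * (2 * real n) \<partial>leb {0..1})"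
    by (simp add: flux_kern_def algebra_simps)
  also have "\<dots> = 1 - 2 * real n / (2 * real n + 2)"
    by (subst Bochner_Integration.integral_diff[OF i i]) (simp add: integral_kern s)
  also have "\<dots> = 1 / (real n + 1)" by (simp add: divide_simps)
  finally show ?thesis .
qed

text \<open>
  A majorant of \<open>sin\<^sup>2 |\<rho>'| + |sin| \<rho>\<close> without odd powers, so that its mass is again a combination of
  masses of kernels.  The square roots come from the arithmetic-geometric mean inequality, with the
  weight that balances the second and the fourth moment.
\<close>

definition rem_kern :: "nat \<Rightarrow> real \<Rightarrow> real" where
  "rem_kern m z = kern m z * sin (pi * z) ^ 4 * (2 * (real m + 1) * pi * sqrt (real m + 1))
     + kern m z * sin (pi * z) ^ 2 * (2 * (real m + 1) * pi / sqrt (real m + 1))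
     + (kern (Suc m) z * sin (pi * z) ^ 2 * sqrt (real m + 1) + kern (Suc m) z * (1 / sqrt (real m + 1)))"

lemma rem_kern_measurable [measurable]: "rem_kern m \<in> borel_measurable borel"
  unfolding rem_kern_def[abs_def] by measurable

lemma bdd_fun_rem_kern [bdd_fun_intros]: "bdd_fun (\<lambda>x. rem_kern m (g x))"
  unfolding rem_kern_def by (intro bdd_fun_intros)

lemma weighted_am_gm: "0 < l \<Longrightarrow> 2 * (a * b) \<le> l * a ^ 2 + b ^ 2 / l" for a b l :: real
proof -
  assume "0 < l"
  have "0 \<le> (l * a - b) ^ 2 / l" using \<open>0 < l\<close> by simp
  also have "\<dots> = l * a ^ 2 + b ^ 2 / l - 2 * (a * b)"
    using \<open>0 < l\<close> by (simp add: power2_eq_square field_simps)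
  finally show ?thesis by simp
qed

lemma le_rem_kern:
  "sin (pi * z) ^ 2 * \<bar>dkern (Suc m) z\<bar> + \<bar>sin (pi * z)\<bar> * kern (Suc m) z \<le> rem_kern m z"
proof -
  define l where "l = sqrt (real m + 1)"
  have l: "0 < l" by (simp add: l_def)
  let ?s = "\<bar>sin (pi * z)\<bar>" and ?c = "\<bar>cos (pi * z)\<bar>"
  have c1: "?c ^ 2 \<le> 1" by (simp add: abs_square_le_1)
  \<comment> \<open>lowering the index of the kernel by one costs a factor of at most \<open>2\<close>\<close>
  have J: "cos_mass m \<le> 2 * cos_mass (Suc m)"
  proof -
    have "cos_mass m * 1 \<le> cos_mass m * (2 * ((2 * real m + 1) / (2 * real m + 2)))"
      using cos_mass_pos[of m] by (intro mult_left_mono) (auto simp: divide_simps)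
    then show ?thesis by (simp add: algebra_simps)
  qed
  have "\<bar>dkern (Suc m) z\<bar> = 2 * (real m + 1) * pi * (?c * ?s) * (?c ^ (2 * m) / cos_mass (Suc m))"
  proof -
    have "\<bar>dkern (Suc m) z\<bar> = \<bar>2 * (real m + 1) * pi\<bar> * \<bar>cos (pi * z) ^ (2 * m + 1)\<bar> * ?s / \<bar>cos_mass (Suc m)\<bar>"
      by (simp only: dkern_def abs_minus_cancel abs_divide abs_mult) simp
    also have "\<dots> = 2 * (real m + 1) * pi * (?c * ?s) * (?c ^ (2 * m) / cos_mass (Suc m))"
      using cos_mass_pos[of "Suc m"] by (simp add: power_abs abs_mult del: cos_mass.simps)
    finally show ?thesis .
  qed
  also have "\<dots> \<le> 2 * (real m + 1) * pi * (?c * ?s) * (2 * kern m z)"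
  proof (rule mult_left_mono)
    have "?c ^ (2 * m) / cos_mass (Suc m) \<le> ?c ^ (2 * m) / (cos_mass m / 2)"
      using J cos_mass_pos[of m] cos_mass_pos[of "Suc m"]
      by (intro divide_left_mono) (auto simp del: cos_mass.simps)
    then show "?c ^ (2 * m) / cos_mass (Suc m) \<le> 2 * kern m z"
      by (simp add: kern_def power_even_abs mult.commute del: cos_mass.simps)
  qed simp
  finally have "sin (pi * z) ^ 2 * \<bar>dkern (Suc m) z\<bar> \<le> sin (pi * z) ^ 2 * (2 * (real m + 1) * pi * (?c * ?s) * (2 * kern m z))"
    by (rule mult_left_mono) simp
  also have "\<dots> = (2 * (real m + 1) * pi * kern m z * sin (pi * z) ^ 2) * (2 * (?s * ?c))"
    by (simp add: algebra_simps)
  also have "\<dots> \<le> (2 * (real m + 1) * pi * kern m z * sin (pi * z) ^ 2) * (l * sin (pi * z) ^ 2 + 1 / l)"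
  proof (rule mult_left_mono)
    have "2 * (?s * ?c) \<le> l * ?s ^ 2 + ?c ^ 2 / l" using l by (rule weighted_am_gm)
    also have "\<dots> \<le> l * ?s ^ 2 + 1 / l" using c1 l by (simp add: divide_right_mono)
    finally show "2 * (?s * ?c) \<le> l * sin (pi * z) ^ 2 + 1 / l" by simp
  qed (simp add: kern_nonneg)
  also have "\<dots> = kern m z * sin (pi * z) ^ 4 * (2 * (real m + 1) * pi * l)
     + kern m z * sin (pi * z) ^ 2 * (2 * (real m + 1) * pi / l)"
    by (simp add: algebra_simps power4_eq_xxxx power2_eq_square add_divide_distrib)
  finally have 1: "sin (pi * z) ^ 2 * \<bar>dkern (Suc m) z\<bar> \<le> \<dots>" .
  have "?s \<le> 2 * (?s * 1)" by simp
  also have "2 * (?s * 1) \<le> l * ?s ^ 2 + 1 ^ 2 / l" using l by (rule weighted_am_gm)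
  finally have "?s * kern (Suc m) z \<le> (l * ?s ^ 2 + 1 ^ 2 / l) * kern (Suc m) z"
    by (rule mult_right_mono) (rule kern_nonneg)
  then have "?s * kern (Suc m) z \<le> kern (Suc m) z * sin (pi * z) ^ 2 * l + kern (Suc m) z * (1 / l)"
    by (simp add: algebra_simps)
  with 1 show ?thesis unfolding rem_kern_def l_def by linarith
qed

definition rem_rate :: "nat \<Rightarrow> real" where
  "rem_rate m = 3 / ((2 * real m + 2) * (2 * real m + 4)) * (2 * (real m + 1) * pi * sqrt (real m + 1))
     + 1 / (2 * real m + 2) * (2 * (real m + 1) * pi / sqrt (real m + 1))
     + (1 / (2 * real m + 4) * sqrt (real m + 1) + 1 * (1 / sqrt (real m + 1)))"

lemma rem_rate_tendsto: "rem_rate \<longlonglongrightarrow> 0"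
  unfolding rem_rate_def[abs_def] by real_asymp

lemma integral_rem_kern: "(\<integral>x. rem_kern m (x - y) \<partial>leb {0..1}) = rem_rate m"
proof -
  have i: "integrable (leb {0..1}) (\<lambda>x. kern n (x - y) * sin (pi * (x - y)) ^ k * c)"
    "integrable (leb {0..1}) (\<lambda>x. kern n (x - y) * c)" for n k c
    by (intro bdd_fun_integrable[OF finite_measure_leb] bdd_fun_intros; measurable)+
  have s: "(\<integral>x. kern n (x - y) * sin (pi * (x - y)) ^ 2 \<partial>leb {0..1}) = 1 / (2 * real n + 2)"
    "(\<integral>x. kern n (x - y) * sin (pi * (x - y)) ^ 4 \<partial>leb {0..1}) = 3 / ((2 * real n + 2) * (2 * real n + 4))" for n
    using integral_kern_sin2_affine[where g = "\<lambda>x. x - y", OF integral_kern, of n] by simp_all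
  show ?thesis
    unfolding rem_kern_def rem_rate_def
    by (simp only: Bochner_Integration.integral_add i Bochner_Integration.integrable_add
        integral_mult_left_zero s integral_kern) simp
qed

text \<open>
  The jump of the sign is invisible because its factor vanishes there.
\<close>

lemma sgn_lipschitz_compose:
  fixes F :: "real \<Rightarrow> real"
  assumes "\<bar>F a - F b\<bar> \<le> B * \<bar>a - b\<bar>" "\<bar>F c - F b\<bar> \<le> B * \<bar>c - b\<bar>" "\<bar>F a - F c\<bar> \<le> B * \<bar>a - c\<bar>"
  shows "\<bar>sgn (a - b) * (F a - F b) - sgn (c - b) * (F c - F b)\<bar> \<le> B * \<bar>a - c\<bar>"
proof -
  consider "a < b" "c < b" | "a < b" "c = b" | "a < b" "b < c" | "a = b" | "b < a" "c < b" | "b < a" "c = b" | "b < a" "b < c"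
    by linarith
  then show ?thesis
    using assms by cases (auto simp: sgn_if algebra_simps)
qed

lemma sgn_mult_le_abs: "sgn a * b \<le> \<bar>b\<bar>" for a b :: real
  by (simp add: sgn_if abs_if)

text \<open>
  Linearise \<open>f(x, \<cdot>) - f(y, \<cdot>)\<close> at \<open>y\<close>.  The linear part combines with the terms in \<open>f\<^sub>x\<close> to the flux kernel;
  there \<open>a\<close>, the value at \<open>x\<close>, is exchanged for \<open>c\<close>, the value at \<open>y\<close>, by Lipschitz continuity.
\<close>

lemma flux_pointwise:
  assumes B: "flux_const f C B" and C: "\<bar>a\<bar> \<le> C" "\<bar>b\<bar> \<le> C" "\<bar>c\<bar> \<le> C"
  shows "sgn (a - b) * ((f x a - f x b - (f y a - f y b)) * dkern (Suc m) (x - y)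
      + (partial1 f y a - partial1 f x b) * kern (Suc m) (x - y))
    \<le> sgn (c - b) * (partial1 f y c - partial1 f y b) * flux_kern (Suc m) (x - y)
      + B * \<bar>a - c\<bar> * osc_kern (Suc m) (x - y) + 2 * B * rem_kern m (x - y)"
proof -
  let ?fx = "partial1 f"
  define S where "S = sin (pi * (x - y)) * cos (pi * (x - y)) / pi"
  let ?d = "dkern (Suc m) (x - y)" and ?k = "kern (Suc m) (x - y)"
  let ?s = "sin (pi * (x - y))"
  define R where "R w = f x w - f y w - ?fx y w * S" for w
  have B0: "0 \<le> B" and
    lipw: "\<And>w w'. \<bar>w\<bar> \<le> C \<Longrightarrow> \<bar>w'\<bar> \<le> C \<Longrightarrow> \<bar>?fx y w - ?fx y w'\<bar> \<le> B * \<bar>w - w'\<bar>" and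
    lipx: "\<bar>?fx x b - ?fx y b\<bar> \<le> B * \<bar>?s\<bar>" and
    R: "\<And>w. \<bar>w\<bar> \<le> C \<Longrightarrow> \<bar>R w\<bar> \<le> B * ?s ^ 2"
    using B C unfolding flux_const_def R_def S_def by blast+
  have sk: "S * ?d + ?k = flux_kern (Suc m) (x - y)" unfolding S_def by (rule flux_kern_eq)
  have "(f x a - f x b - (f y a - f y b)) * ?d + (?fx y a - ?fx x b) * ?k
     = (?fx y a - ?fx y b) * (S * ?d + ?k) + ((R a - R b) * ?d - (?fx x b - ?fx y b) * ?k)"
    by (simp add: R_def algebra_simps)
  then have "sgn (a - b) * ((f x a - f x b - (f y a - f y b)) * ?d + (?fx y a - ?fx x b) * ?k)
    = sgn (a - b) * (?fx y a - ?fx y b) * flux_kern (Suc m) (x - y)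
      + sgn (a - b) * ((R a - R b) * ?d - (?fx x b - ?fx y b) * ?k)"
    by (simp only: sk distrib_left mult.assoc)
  moreover have "sgn (a - b) * ((R a - R b) * ?d - (?fx x b - ?fx y b) * ?k) \<le> 2 * B * rem_kern m (x - y)"
  proof -
    have "sgn (a - b) * ((R a - R b) * ?d - (?fx x b - ?fx y b) * ?k) \<le> \<bar>(R a - R b) * ?d - (?fx x b - ?fx y b) * ?k\<bar>"
      by (rule sgn_mult_le_abs)
    also have "\<dots> \<le> \<bar>R a - R b\<bar> * \<bar>?d\<bar> + \<bar>?fx x b - ?fx y b\<bar> * ?k"
      using abs_triangle_ineq4[of "(R a - R b) * ?d" "(?fx x b - ?fx y b) * ?k"] kern_nonneg[of "Suc m" "x - y"]
      by (simp add: abs_mult)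
    also have "\<dots> \<le> (2 * (B * ?s ^ 2)) * \<bar>?d\<bar> + (2 * (B * \<bar>?s\<bar>)) * ?k"
    proof (intro add_mono mult_right_mono)
      show "\<bar>R a - R b\<bar> \<le> 2 * (B * ?s ^ 2)" using R[OF C(1)] R[OF C(2)] by linarith
      have "0 \<le> B * \<bar>?s\<bar>" using B0 by simp
      then show "\<bar>?fx x b - ?fx y b\<bar> \<le> 2 * (B * \<bar>?s\<bar>)" using lipx by linarith
    qed (auto simp: kern_nonneg)
    also have "\<dots> = 2 * B * (?s ^ 2 * \<bar>?d\<bar> + \<bar>?s\<bar> * ?k)" by (simp add: algebra_simps)
    also have "\<dots> \<le> 2 * B * rem_kern m (x - y)"
      using B0 by (intro mult_left_mono le_rem_kern) auto
    finally show ?thesis .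
  qed
  moreover have "sgn (a - b) * (?fx y a - ?fx y b) * flux_kern (Suc m) (x - y)
     \<le> sgn (c - b) * (?fx y c - ?fx y b) * flux_kern (Suc m) (x - y) + B * \<bar>a - c\<bar> * osc_kern (Suc m) (x - y)"
  proof -
    have "(sgn (a - b) * (?fx y a - ?fx y b) - sgn (c - b) * (?fx y c - ?fx y b)) * flux_kern (Suc m) (x - y)
      \<le> \<bar>sgn (a - b) * (?fx y a - ?fx y b) - sgn (c - b) * (?fx y c - ?fx y b)\<bar> * \<bar>flux_kern (Suc m) (x - y)\<bar>"
      by (metis abs_ge_self abs_mult)
    also have "\<dots> \<le> B * \<bar>a - c\<bar> * osc_kern (Suc m) (x - y)"
      by (intro mult_mono sgn_lipschitz_compose lipw C abs_flux_kern_le) (use B0 in auto)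
    finally show ?thesis by (simp add: algebra_simps)
  qed
  ultimately show ?thesis by linarith
qed

section \<open>The kernel in time\<close>

lemma bdd_fun_exp [bdd_fun_intros]: "bdd_fun (\<lambda>x. exp (- \<bar>g x\<bar>))"
  by (rule bdd_funI[of _ 1]) simp

declare finite_measure_leb [bdd_fun_intros]

lemma integrable_leb:
  "g \<in> borel_measurable borel \<Longrightarrow> bdd_fun g \<Longrightarrow> integrable (leb {a..b}) g"
  by (rule bdd_fun_integrable[OF finite_measure_leb]) simp

lemma integrable_leb_pair:
  "g \<in> borel_measurable (borel \<Otimes>\<^sub>M borel) \<Longrightarrow> bdd_fun g \<Longrightarrow> integrable (leb {a..b} \<Otimes>\<^sub>M leb {c..d}) g"
  by (rule bdd_fun_integrable[OF finite_measure_pair_measure[OF finite_measure_leb finite_measure_leb]])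
     (simp add: measurable_def sets_pair_measure_cong[OF sets_leb sets_leb] space_pair_measure)

lemma integral_leb_pair:
  "g \<in> borel_measurable (borel \<Otimes>\<^sub>M borel) \<Longrightarrow> bdd_fun g \<Longrightarrow>
    (\<integral>p. g p \<partial>(leb {a..b} \<Otimes>\<^sub>M leb {c..d})) = (\<integral>x. (\<integral>y. g (x, y) \<partial>leb {c..d}) \<partial>leb {a..b})"
  by (rule integral_pair[OF finite_measure_leb finite_measure_leb])
     (simp_all add: measurable_def sets_pair_measure_cong[OF sets_leb sets_leb] space_pair_measure)

lemma integral_leb_swap:
  assumes "case_prod g \<in> borel_measurable (borel \<Otimes>\<^sub>M borel)" "bdd_fun (\<lambda>p. g (fst p) (snd p))"
  shows "(\<integral>x. (\<integral>y. g x y \<partial>leb {c..d}) \<partial>leb {a..b}) = (\<integral>y. (\<integral>x. g x y \<partial>leb {a..b}) \<partial>leb {c..d})"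
  by (rule integral_swap[OF finite_measure_leb finite_measure_leb _ assms(2)])
     (use assms(1) in \<open>simp add: case_prod_unfold measurable_def sets_pair_measure_cong[OF sets_leb sets_leb] space_pair_measure\<close>)

lemma integral_leb_mono:
  assumes "f \<in> borel_measurable borel" "bdd_fun f" "g \<in> borel_measurable borel" "bdd_fun g"
    and "AE x in leb {a..b}. x \<in> {a..b} \<longrightarrow> f x \<le> g x"
  shows "(\<integral>x. f x \<partial>leb {a..b}) \<le> (\<integral>x. g x \<partial>leb {a..b})"
proof (rule integral_mono_AE)
  have "AE x in leb {a..b}. x \<in> {a..b}" by (rule AE_leb_mem) simp
  with assms(5) show "AE x in leb {a..b}. f x \<le> g x" by eventually_elim simp
qed (intro integrable_leb assms)+

lemma integral_leb_const: "a \<le> b \<Longrightarrow> (\<integral>x. c \<partial>leb {a..b}) = c * (b - a)"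
  by (simp add: measure_def emeasure_leb_Icc)

lemma bdd_fun_if [bdd_fun_intros]: "bdd_fun g \<Longrightarrow> bdd_fun h \<Longrightarrow> bdd_fun (\<lambda>x. if P x then g x else h x)"
proof -
  assume "bdd_fun g" "bdd_fun h"
  then obtain A B where "\<And>x. \<bar>g x\<bar> \<le> A" "\<And>x. \<bar>h x\<bar> \<le> B" by (meson bdd_funE)
  then show ?thesis by (intro bdd_funI[of _ "max A B"]) (simp add: le_max_iff_disj)
qed

text \<open>
  With period \<open>2 T\<close> the differences of two times in \<open>[0, T]\<close> fill exactly one period, and \<open>0\<close> is the only
  peak among them.
\<close>

definition tkern :: "real \<Rightarrow> nat \<Rightarrow> real \<Rightarrow> real \<Rightarrow> real" where
  "tkern T n t s = kern n ((t - s) / (2 * T)) / (2 * T)"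

lemma tkern_nonneg: "0 < T \<Longrightarrow> 0 \<le> tkern T n t s"
  by (simp add: tkern_def kern_nonneg)

lemma tkern_commute: "tkern T n t s = tkern T n s t"
  using kern_minus[of n "(t - s) / (2 * T)"] by (simp add: tkern_def minus_divide_left)

lemma tkern_measurable [measurable]: "case_prod (tkern T n) \<in> borel_measurable (borel \<Otimes>\<^sub>M borel)"
  unfolding tkern_def[abs_def] by measurable

lemma bdd_fun_tkern [bdd_fun_intros]: "bdd_fun (\<lambda>x. tkern T n (g x) (h x))"
  unfolding tkern_def by (intro bdd_fun_intros)

lemma cos_half_pi_int: "cos (pi * (1 / 2)) = 0" "cos (pi * - (1 / 2)) = 0"
  by simp_all

lemma integral_tkern_full:
  assumes "0 < T"
  shows "(\<integral>s. kern n ((t - s) / (2 * T)) \<partial>leb {t - T..t + T}) = 2 * T"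
proof -
  have e: "(t - s) / (2 * T) = - (1 / (2 * T)) * s + t / (2 * T)" for s
    using assms by (simp add: field_simps)
  have b: "- (1 / (2 * T)) * (t + T) + t / (2 * T) = - (1 / 2)" "- (1 / (2 * T)) * (t - T) + t / (2 * T) = 1 / 2"
    using assms by (simp_all add: field_simps)
  show ?thesis
    unfolding e using assms
    by (subst integral_kern_affine) (auto simp only: b cos_half_pi_int, simp_all)
qed

text \<open>
  At an end of the time interval only one side of the peak is seen.
\<close>

lemma integral_tkern_half:
  assumes "0 < T" and "t = 0 \<or> t = T"
  shows "(\<integral>s. tkern T n t s \<partial>leb {0..T}) = 1 / 2"
proof -
  have e: "(t - s) / (2 * T) = - (1 / (2 * T)) * s + t / (2 * T)" for s
    using assms by (simp add: field_simps)
  have "(\<integral>s. kern n ((t - s) / (2 * T)) \<partial>leb {0..T}) = T - 0"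
    unfolding e
  proof (rule integral_kern_affine)
    fix n
    let ?z = "\<lambda>s. - (1 / (2 * T)) * s + t / (2 * T)"
    from assms(2) have "(?z T = - (1 / 2) \<and> ?z 0 = 0) \<or> (?z T = 0 \<and> ?z 0 = 1 / 2)"
      using assms(1) by auto
    then show "cos (pi * ?z T) ^ (2 * n + 1) * sin (pi * ?z T) = cos (pi * ?z 0) ^ (2 * n + 1) * sin (pi * ?z 0)"
      by (elim disjE conjE) (simp_all only: cos_half_pi_int, simp_all)
  qed (use assms in auto)
  then show ?thesis using assms(1) by (simp add: tkern_def)
qed

lemma integral_leb_subset:
  fixes g :: "real \<Rightarrow> real"
  assumes "g \<in> borel_measurable borel" "bdd_fun g" "\<And>x. 0 \<le> g x" "{a..b} \<subseteq> {c..d}"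
  shows "(\<integral>x. g x \<partial>leb {a..b}) \<le> (\<integral>x. g x \<partial>leb {c..d})"
proof -
  have i: "integrable lborel (\<lambda>x. g x * indicator {a..b} x)" for a b
    using integrable_leb[OF assms(1,2), of a b] integrable_density[of g lborel "indicator {a..b}"] assms(1)
    by (simp add: leb_def ennreal_indicator mult.commute)
  have "(\<integral>x. g x * indicator {a..b} x \<partial>lborel) \<le> (\<integral>x. g x * indicator {c..d} x \<partial>lborel)"
    using assms(3,4) by (intro integral_mono i) (auto simp: indicator_def)
  then show ?thesis using assms(1) by (simp add: integral_leb)
qed

lemma integral_tkern_le:
  assumes "0 < T" "t \<in> {0..T}"
  shows "(\<integral>s. tkern T n t s \<partial>leb {0..T}) \<le> 1"
    and "(\<integral>s. tkern T n t s * sin (pi * ((t - s) / (2 * T))) ^ 2 \<partial>leb {0..T}) \<le> 1 / (2 * real n + 2)"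
proof -
  have sub: "{0..T} \<subseteq> {t - T..t + T}" using assms by auto
  note s = integral_kern_sin2_affine[where g = "\<lambda>s. (t - s) / (2 * T)", OF integral_tkern_full[OF assms(1)], of n]
  have "(\<integral>s. tkern T n t s \<partial>leb {0..T}) \<le> (\<integral>s. tkern T n t s \<partial>leb {t - T..t + T})"
    by (intro integral_leb_subset sub bdd_fun_intros tkern_nonneg assms) measurable
  also have "\<dots> = 1" unfolding tkern_def using integral_tkern_full[OF assms(1), of t n] assms(1) by simp
  finally show "(\<integral>s. tkern T n t s \<partial>leb {0..T}) \<le> 1" .
  have "(\<integral>s. tkern T n t s * sin (pi * ((t - s) / (2 * T))) ^ 2 \<partial>leb {0..T}) \<le>
     (\<integral>s. tkern T n t s * sin (pi * ((t - s) / (2 * T))) ^ 2 \<partial>leb {t - T..t + T})"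
    by (intro integral_leb_subset sub bdd_fun_intros mult_nonneg_nonneg tkern_nonneg assms zero_le_power2) measurable
  also have "\<dots> = (\<integral>s. kern n ((t - s) / (2 * T)) * sin (pi * ((t - s) / (2 * T))) ^ 2 / (2 * T) \<partial>leb {t - T..t + T})"
    unfolding tkern_def by simp
  also have "\<dots> = (2 * T / (2 * real n + 2)) / (2 * T)"
    using s(1) by (simp only: integral_divide_zero) simp
  also have "\<dots> = 1 / (2 * real n + 2)" using assms(1) by simp
  finally show "(\<integral>s. tkern T n t s * sin (pi * ((t - s) / (2 * T))) ^ 2 \<partial>leb {0..T}) \<le> 1 / (2 * real n + 2)" .
qed

text \<open>
  On \<open>[0, T]\<close> the absolute values do nothing; off it they keep the weight bounded.
\<close>

definition weight :: "real \<Rightarrow> nat \<Rightarrow> real \<Rightarrow> real \<Rightarrow> real" where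
  "weight T n t s = tkern T n t s * (exp (- \<bar>t\<bar>) * exp (- \<bar>s\<bar>))"

text \<open>
  The derivative of the weight in \<open>t\<close> for \<open>t \<ge> 0\<close>.
\<close>

definition dweight :: "real \<Rightarrow> nat \<Rightarrow> real \<Rightarrow> real \<Rightarrow> real" where
  "dweight T n t s = (dkern n ((t - s) / (2 * T)) / (2 * T) ^ 2 - tkern T n t s) * (exp (- \<bar>t\<bar>) * exp (- \<bar>s\<bar>))"

lemma weight_measurable [measurable]: "case_prod (weight T n) \<in> borel_measurable (borel \<Otimes>\<^sub>M borel)"
  unfolding weight_def[abs_def] by measurable

lemma dweight_measurable [measurable]: "case_prod (dweight T n) \<in> borel_measurable (borel \<Otimes>\<^sub>M borel)"
  unfolding dweight_def[abs_def] by measurable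

lemma bdd_fun_weight [bdd_fun_intros]: "bdd_fun (\<lambda>x. weight T n (g x) (h x))"
  unfolding weight_def by (intro bdd_fun_intros)

lemma bdd_fun_dweight [bdd_fun_intros]: "bdd_fun (\<lambda>x. dweight T n (g x) (h x))"
  unfolding dweight_def by (intro bdd_fun_intros)

lemma weight_commute: "weight T n t s = weight T n s t"
  using tkern_commute[of T n t s] by (simp add: weight_def)

text \<open>
  The derivative of the even kernel \<open>\<omega>\<close> is odd and cancels; each exponential contributes \<open>-1\<close>.
\<close>

lemma dweight_add: "dweight T n t s + dweight T n s t = - 2 * weight T n t s"
proof -
  have "dkern n ((s - t) / (2 * T)) = - dkern n ((t - s) / (2 * T))"
    using dkern_minus[of n "(t - s) / (2 * T)"] by (simp add: minus_divide_left)
  then show ?thesis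
    using tkern_commute[of T n t s] by (simp add: dweight_def weight_def algebra_simps)
qed

lemma weight_nonneg: "0 < T \<Longrightarrow> 0 \<le> weight T n t s"
  by (simp add: weight_def tkern_nonneg)

lemma weight_le: "0 < T \<Longrightarrow> weight T n t s \<le> tkern T n t s"
  unfolding weight_def using tkern_nonneg[of T n t s] mult_le_one[of "exp (- \<bar>t\<bar>)" "exp (- \<bar>s\<bar>)"]
  by (simp add: mult_left_le)

lemma weight_ge:
  assumes "0 < T" "t \<in> {0..T}" "s \<in> {0..T}"
  shows "exp (- (2 * T)) * tkern T n t s \<le> weight T n t s"
proof -
  have "exp (- (2 * T)) \<le> exp (- \<bar>t\<bar>) * exp (- \<bar>s\<bar>)"
    using assms by (simp flip: exp_add)
  from mult_left_mono[OF this tkern_nonneg[OF assms(1), of n t s]]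
  show ?thesis unfolding weight_def by (simp add: mult.commute)
qed

section \<open>The nonlocal source\<close>

text \<open>
  The operator \<open>P\<close> acting on one time slice; the integrals run over the unit interval, so that the
  result is bounded for all \<open>x\<close>.
\<close>

definition source :: "(real \<Rightarrow> real) \<Rightarrow> real \<Rightarrow> real" where
  "source w x = (\<integral>y. (if y \<le> x then w y else 0) \<partial>leb {0..1})
     - (\<integral>y. (\<integral>z. (if z \<le> y then w z else 0) \<partial>leb {0..1}) \<partial>leb {0..1})"

lemma source_measurable [measurable (raw)]:
  assumes [measurable]: "case_prod U \<in> borel_measurable (borel \<Otimes>\<^sub>M borel)"
    "g \<in> borel_measurable M" "h \<in> borel_measurable M"
  shows "(\<lambda>p. source (U (g p)) (h p)) \<in> borel_measurable M"
  unfolding source_def by measurable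

lemma bdd_fun_source:
  fixes U :: "real \<Rightarrow> real \<Rightarrow> real"
  assumes "bdd_fun (\<lambda>p. U (fst p) (snd p))"
  shows "bdd_fun (\<lambda>p. source (U (g p)) (h p))"
proof -
  have [bdd_fun_intros]: "bdd_fun (\<lambda>p. U (g p) (h p))" for g :: "'x \<Rightarrow> real" and h :: "'x \<Rightarrow> real"
    using bdd_fun_compose[OF assms, of "\<lambda>p. (g p, h p)"] by simp
  show ?thesis unfolding source_def by (intro bdd_fun_intros)
qed

text \<open>
  Each of the two integrals in \<open>P\<close> changes by at most the \<open>L\<^sup>1\<close> distance.
\<close>

lemma source_diff_le:
  assumes [measurable]: "w \<in> borel_measurable borel" "w' \<in> borel_measurable borel" and "bdd_fun w" "bdd_fun w'"
  shows "\<bar>source w x - source w' x\<bar> \<le> 2 * (\<integral>y. \<bar>w y - w' y\<bar> \<partial>leb {0..1})"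
proof -
  let ?M = "leb {0..1}" and ?D = "\<integral>y. \<bar>w y - w' y\<bar> \<partial>leb {0..1}"
  note [bdd_fun_intros] = bdd_fun_compose[OF assms(3)] bdd_fun_compose[OF assms(4)]
  have i: "integrable ?M (\<lambda>y. (if y \<le> x then w y else 0))" "integrable ?M (\<lambda>y. (if y \<le> x then w' y else 0))" for x
    by (intro integrable_leb bdd_fun_intros; measurable)+
  have 1: "\<bar>(\<integral>y. (if y \<le> x then w y else 0) \<partial>?M) - (\<integral>y. (if y \<le> x then w' y else 0) \<partial>?M)\<bar> \<le> ?D" for x
  proof -
    have "(\<integral>y. (if y \<le> x then w y else 0) \<partial>?M) - (\<integral>y. (if y \<le> x then w' y else 0) \<partial>?M)
       = (\<integral>y. (if y \<le> x then w y else 0) - (if y \<le> x then w' y else 0) \<partial>?M)"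
      by (rule Bochner_Integration.integral_diff[symmetric, OF i])
    also have "\<bar>\<dots>\<bar> \<le> (\<integral>y. \<bar>(if y \<le> x then w y else 0) - (if y \<le> x then w' y else 0)\<bar> \<partial>?M)"
      by (rule Bochner_Integration.integral_abs_bound)
    also have "\<dots> \<le> ?D"
    proof (rule integral_leb_mono)
      show "bdd_fun (\<lambda>y. \<bar>(if y \<le> x then w y else 0) - (if y \<le> x then w' y else 0)\<bar>)"
        "bdd_fun (\<lambda>y. \<bar>w y - w' y\<bar>)" by (intro bdd_fun_intros)+
      show "AE y in ?M. y \<in> {0..1} \<longrightarrow> \<bar>(if y \<le> x then w y else 0) - (if y \<le> x then w' y else 0)\<bar> \<le> \<bar>w y - w' y\<bar>"
        by (rule AE_I2) simp
    qed measurable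
    finally show ?thesis .
  qed
  let ?I = "\<lambda>w y. \<integral>z. (if z \<le> y then w z else 0) \<partial>?M"
  have j: "integrable ?M (?I w)" "integrable ?M (?I w')"
    by (intro integrable_leb bdd_fun_intros; measurable)+
  have "\<bar>(\<integral>y. ?I w y \<partial>?M) - (\<integral>y. ?I w' y \<partial>?M)\<bar> = \<bar>\<integral>y. ?I w y - ?I w' y \<partial>?M\<bar>"
    by (simp only: Bochner_Integration.integral_diff[OF j])
  also have "\<dots> \<le> (\<integral>y. \<bar>?I w y - ?I w' y\<bar> \<partial>?M)"
    by (rule Bochner_Integration.integral_abs_bound)
  also have "\<dots> \<le> (\<integral>y. ?D \<partial>?M)"
  proof (rule integral_leb_mono)
    show "bdd_fun (\<lambda>y. \<bar>?I w y - ?I w' y\<bar>)" by (intro bdd_fun_intros)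
    show "AE y in ?M. y \<in> {0..1} \<longrightarrow> \<bar>?I w y - ?I w' y\<bar> \<le> ?D"
      using 1 by (intro AE_I2 impI)
  qed (measurable, rule bdd_fun_const)
  also have "\<dots> = ?D" by (subst integral_leb_const) simp_all
  finally show ?thesis using 1[of x] unfolding source_def by linarith
qed

section \<open>Doubling of variables\<close>

definition L1_dist :: "(real \<Rightarrow> real) \<Rightarrow> (real \<Rightarrow> real) \<Rightarrow> real" where
  "L1_dist w w' = (\<integral>x. \<bar>w x - w' x\<bar> \<partial>leb {0..1})"

text \<open>
  The integrand of the entropy inequality for the test function
  \<open>\<omega>(t - s) e^{-(t + s)} \<rho>(x - y)\<close>.
\<close>

definition entropy_density ::
  "real \<Rightarrow> (real \<Rightarrow> real \<Rightarrow> real) \<Rightarrow> nat \<Rightarrow> (real \<Rightarrow> real \<Rightarrow> real) \<Rightarrow> real \<Rightarrow> real \<Rightarrow> real \<Rightarrow> real \<Rightarrow> real \<Rightarrow> real" where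
  "entropy_density T f n U k t s x y =
     \<bar>U t x - k\<bar> * dweight T n t s * kern n (x - y)
     + sgn (U t x - k) * (f x (U t x) - f x k) * weight T n t s * dkern n (x - y)
     + sgn (U t x - k) * (source (U t) x - partial1 f x k) * weight T n t s * kern n (x - y)"

text \<open>
  What the doubling argument needs of an entropy solution, for a Borel representative \<open>U\<close>.  The set \<open>G\<close>
  collects the times at which \<open>U\<close> represents the solution, so continuity in time can be claimed only
  there; both end points have to belong to it because the boundary terms live there.
\<close>

definition kruzkov_solution ::
  "real \<Rightarrow> (real \<Rightarrow> real \<Rightarrow> real) \<Rightarrow> real \<Rightarrow> real set \<Rightarrow> (real \<Rightarrow> real \<Rightarrow> real) \<Rightarrow> bool" where
  "kruzkov_solution T f C G U \<longleftrightarrow>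
     case_prod U \<in> borel_measurable (borel \<Otimes>\<^sub>M borel) \<and> (\<forall>t x. \<bar>U t x\<bar> \<le> C) \<and>
     G \<subseteq> {0..T} \<and> 0 \<in> G \<and> T \<in> G \<and> (AE t in leb {0..T}. t \<in> G) \<and>
     (\<forall>\<epsilon>>0. \<exists>K\<ge>0. \<forall>t\<in>G. \<forall>s\<in>G. L1_dist (U t) (U s) \<le> \<epsilon> + K * sin (pi * ((t - s) / (2 * T))) ^ 2) \<and>
     (\<forall>n s y k. 0 \<le> (\<integral>t. (\<integral>x. entropy_density T f n U k t s x y \<partial>leb {0..1}) \<partial>leb {0..T})
        - (\<integral>x. \<bar>U T x - k\<bar> * weight T n T s * kern n (x - y) \<partial>leb {0..1})
        + (\<integral>x. \<bar>U 0 x - k\<bar> * weight T n 0 s * kern n (x - y) \<partial>leb {0..1}))"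

lemma bdd_fun_compose2:
  fixes U :: "real \<Rightarrow> real \<Rightarrow> real"
  assumes "\<And>t x. \<bar>U t x\<bar> \<le> C" shows "bdd_fun (\<lambda>p. U (g p) (h p))"
  by (rule bdd_funI) (rule assms)

lemma measurable_slice:
  "case_prod U \<in> borel_measurable (borel \<Otimes>\<^sub>M borel) \<Longrightarrow> U t \<in> borel_measurable borel"
  using measurable_Pair2[of "case_prod U"] by fastforce

lemma L1_dist_nonneg: "0 \<le> L1_dist w w'"
  unfolding L1_dist_def by simp

lemma L1_dist_commute: "L1_dist w w' = L1_dist w' w"
  unfolding L1_dist_def by (simp add: abs_minus_commute)

lemma osc_measurable [measurable (raw)]:
  fixes U :: "real \<Rightarrow> real \<Rightarrow> real"
  assumes [measurable]: "case_prod U \<in> borel_measurable (borel \<Otimes>\<^sub>M borel)"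
  shows "(\<lambda>t. osc n (U t)) \<in> borel_measurable borel"
  unfolding osc_def by measurable

lemma bdd_fun_osc:
  fixes U :: "real \<Rightarrow> real \<Rightarrow> real"
  assumes C: "\<And>t x. \<bar>U t x\<bar> \<le> C"
  shows "bdd_fun (\<lambda>t. osc n (U t))"
proof -
  note [bdd_fun_intros] = bdd_fun_compose2[OF C]
  show ?thesis unfolding osc_def by (intro bdd_fun_intros)
qed

lemma osc_le:
  assumes [measurable]: "w \<in> borel_measurable borel" and C: "\<And>x. \<bar>w x\<bar> \<le> C"
  shows "osc n w \<le> 4 * C"
proof -
  have "bdd_fun w" by (rule bdd_funI) (rule C)
  note [bdd_fun_intros] = bdd_fun_compose[OF this]
  have "0 \<le> C" using C[of 0] by linarith
  have "osc n w \<le> (\<integral>x. 4 * C \<partial>leb {0..1})"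
    unfolding osc_def
  proof (rule integral_leb_mono)
    have "(\<integral>y. \<bar>w x - w y\<bar> * osc_kern n (x - y) \<partial>leb {0..1}) \<le> 4 * C" for x
    proof -
      have "(\<integral>y. \<bar>w x - w y\<bar> * osc_kern n (x - y) \<partial>leb {0..1}) \<le> (\<integral>y. (2 * C) * osc_kern n (x - y) \<partial>leb {0..1})"
      proof (rule integral_leb_mono)
        have "\<bar>w x - w y\<bar> \<le> 2 * C" for y using C[of x] C[of y] by linarith
        then show "AE y in leb {0..1}. y \<in> {0..1} \<longrightarrow> \<bar>w x - w y\<bar> * osc_kern n (x - y) \<le> 2 * C * osc_kern n (x - y)"
          by (intro AE_I2 impI mult_right_mono osc_kern_nonneg)
      qed (measurable, intro bdd_fun_intros, measurable, intro bdd_fun_intros)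
      also have "\<dots> = 2 * C * (\<integral>y. osc_kern n (x - y) \<partial>leb {0..1})" by simp
      also have "\<dots> \<le> 2 * C * 2"
        using \<open>0 \<le> C\<close> by (intro mult_left_mono integral_osc_kern_le') auto
      finally show ?thesis by simp
    qed
    then show "AE x in leb {0..1}. x \<in> {0..1} \<longrightarrow> (\<integral>y. \<bar>w x - w y\<bar> * osc_kern n (x - y) \<partial>leb {0..1}) \<le> 4 * C"
      by (intro AE_I2 impI)
  qed (measurable, intro bdd_fun_intros, measurable, intro bdd_fun_intros)
  also have "\<dots> = 4 * C" by (subst integral_leb_const) simp_all
  finally show ?thesis .
qed

text \<open>
  Dominated convergence in time; the oscillation is at most \<open>4 C\<close>.
\<close>

lemma integral_osc_tendsto_0:
  fixes U :: "real \<Rightarrow> real \<Rightarrow> real"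
  assumes [measurable]: "case_prod U \<in> borel_measurable (borel \<Otimes>\<^sub>M borel)" and C: "\<And>t x. \<bar>U t x\<bar> \<le> C"
  shows "(\<lambda>n. \<integral>t. osc n (U t) \<partial>leb {0..T}) \<longlonglongrightarrow> 0"
proof -
  have m: "U t \<in> borel_measurable borel" for t using assms(1) by (rule measurable_slice)
  have "(\<lambda>n. \<integral>t. osc n (U t) \<partial>leb {0..T}) \<longlonglongrightarrow> (\<integral>t. 0 \<partial>leb {0..T})"
  proof (rule integral_dominated_convergence)
    show "integrable (leb {0..T}) (\<lambda>t. 4 * C)"
      by (intro integrable_leb bdd_fun_const) measurable
    show "AE t in leb {0..T}. (\<lambda>n. osc n (U t)) \<longlonglongrightarrow> 0"
      by (intro AE_I2 osc_tendsto_0 m bdd_funI[OF C])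
    have "norm (osc n (U t)) \<le> 4 * C" for n t
      using osc_le[OF m C] osc_nonneg by simp
    then show "AE t in leb {0..T}. norm (osc n (U t)) \<le> 4 * C" for n by (intro AE_I2)
  qed measurable
  then show ?thesis by simp
qed

text \<open>
  Two solutions of the same equation with common constants.  The assumptions are symmetric, so each
  one-sided estimate is also available with the roles of \<open>U\<close> and \<open>V\<close> exchanged.
\<close>

locale kruzkov_pair =
  fixes T :: real and f :: "real \<Rightarrow> real \<Rightarrow> real" and C B :: real
    and U V :: "real \<Rightarrow> real \<Rightarrow> real" and G H :: "real set"
  assumes T: "0 < T"
    and f_measurable [measurable]: "case_prod f \<in> borel_measurable (borel \<Otimes>\<^sub>M borel)"
    and fx_measurable [measurable]: "case_prod (partial1 f) \<in> borel_measurable (borel \<Otimes>\<^sub>M borel)"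
    and flux: "flux_const f C B"
    and solU: "kruzkov_solution T f C G U" and solV: "kruzkov_solution T f C H V"
begin

lemma U_measurable [measurable]: "case_prod U \<in> borel_measurable (borel \<Otimes>\<^sub>M borel)"
  and V_measurable [measurable]: "case_prod V \<in> borel_measurable (borel \<Otimes>\<^sub>M borel)"
  and U_le: "\<bar>U t x\<bar> \<le> C" and V_le: "\<bar>V t x\<bar> \<le> C"
  using solU solV unfolding kruzkov_solution_def by blast+

lemma swapped: "kruzkov_pair T f C B V U H G"
  by unfold_locales (fact T f_measurable fx_measurable flux solU solV)+

lemma B_nonneg: "0 \<le> B" and f_le: "\<bar>w\<bar> \<le> C \<Longrightarrow> \<bar>f x w\<bar> \<le> B" and fx_le: "\<bar>w\<bar> \<le> C \<Longrightarrow> \<bar>partial1 f x w\<bar> \<le> B"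
  using flux unfolding flux_const_def by blast+

lemma bdd_fun_flux:
  "bdd_fun (\<lambda>p. U (g p) (h p))" "bdd_fun (\<lambda>p. V (g p) (h p))"
  "bdd_fun (\<lambda>p. f (k p) (U (g p) (h p)))" "bdd_fun (\<lambda>p. f (k p) (V (g p) (h p)))"
  "bdd_fun (\<lambda>p. partial1 f (k p) (U (g p) (h p)))" "bdd_fun (\<lambda>p. partial1 f (k p) (V (g p) (h p)))"
  "bdd_fun (\<lambda>p. source (U (g p)) (h p))" "bdd_fun (\<lambda>p. source (V (g p)) (h p))"
proof -
  show "bdd_fun (\<lambda>p. U (g p) (h p))" "bdd_fun (\<lambda>p. V (g p) (h p))"
    by (rule bdd_fun_compose2, rule U_le) (rule bdd_fun_compose2, rule V_le)
  show "bdd_fun (\<lambda>p. f (k p) (U (g p) (h p)))" "bdd_fun (\<lambda>p. f (k p) (V (g p) (h p)))"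
    by (rule bdd_funI, rule f_le, rule U_le) (rule bdd_funI, rule f_le, rule V_le)
  show "bdd_fun (\<lambda>p. partial1 f (k p) (U (g p) (h p)))" "bdd_fun (\<lambda>p. partial1 f (k p) (V (g p) (h p)))"
    by (rule bdd_funI, rule fx_le, rule U_le) (rule bdd_funI, rule fx_le, rule V_le)
  show "bdd_fun (\<lambda>p. source (U (g p)) (h p))" "bdd_fun (\<lambda>p. source (V (g p)) (h p))"
    by (rule bdd_fun_source, rule bdd_fun_compose2, rule U_le) (rule bdd_fun_source, rule bdd_fun_compose2, rule V_le)
qed

lemmas bdd_fun_UV = bdd_fun_intros bdd_fun_flux

abbreviation "M \<equiv> leb {0..1::real}"
abbreviation "N \<equiv> leb {0..T}"

definition boundary :: "nat \<Rightarrow> real \<Rightarrow> real" where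
  "boundary n \<tau> = (\<integral>s. (\<integral>y. (\<integral>x. \<bar>U \<tau> x - V s y\<bar> * weight T n \<tau> s * kern n (x - y) \<partial>M) \<partial>M) \<partial>N)"

text \<open>
  Set \<open>k = V s y\<close> and integrate over \<open>s\<close> and \<open>y\<close>.
\<close>

lemma integrated_entropy:
  "0 \<le> (\<integral>t. (\<integral>s. (\<integral>x. (\<integral>y. entropy_density T f n U (V s y) t s x y \<partial>M) \<partial>M) \<partial>N) \<partial>N)
     - boundary n T + boundary n 0"
proof -
  let ?E = "\<lambda>t s x y. entropy_density T f n U (V s y) t s x y"
  let ?b = "\<lambda>\<tau> s y. \<integral>x. \<bar>U \<tau> x - V s y\<bar> * weight T n \<tau> s * kern n (x - y) \<partial>M"
  let ?A = "\<lambda>s y. \<integral>t. (\<integral>x. ?E t s x y \<partial>M) \<partial>N"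
  have iA: "integrable M (?A s)" for s
    unfolding entropy_density_def by (rule integrable_leb) (measurable, intro bdd_fun_UV)
  have ib: "integrable M (?b \<tau> s)" for \<tau> s
    by (rule integrable_leb) (measurable, intro bdd_fun_UV)
  have iA2: "integrable N (\<lambda>s. \<integral>y. ?A s y \<partial>M)"
    unfolding entropy_density_def by (rule integrable_leb) (measurable, intro bdd_fun_UV)
  have ib2: "integrable N (\<lambda>s. \<integral>y. ?b \<tau> s y \<partial>M)" for \<tau>
    by (rule integrable_leb) (measurable, intro bdd_fun_UV)
  have "0 \<le> ?A s y - ?b T s y + ?b 0 s y" for s y
    using solU unfolding kruzkov_solution_def by blast
  then have "0 \<le> (\<integral>s. (\<integral>y. ?A s y - ?b T s y + ?b 0 s y \<partial>M) \<partial>N)"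
    by (intro Bochner_Integration.integral_nonneg)
  also have "\<dots> = (\<integral>s. (\<integral>y. ?A s y \<partial>M) - (\<integral>y. ?b T s y \<partial>M) + (\<integral>y. ?b 0 s y \<partial>M) \<partial>N)"
    by (simp only: Bochner_Integration.integral_add Bochner_Integration.integral_diff
        Bochner_Integration.integrable_diff iA ib)
  also have "\<dots> = (\<integral>s. (\<integral>y. ?A s y \<partial>M) \<partial>N) - boundary n T + boundary n 0"
    unfolding boundary_def
    by (simp only: Bochner_Integration.integral_add Bochner_Integration.integral_diff
        Bochner_Integration.integrable_diff iA2 ib2)
  also have "(\<integral>s. (\<integral>y. ?A s y \<partial>M) \<partial>N) = (\<integral>s. (\<integral>t. (\<integral>y. (\<integral>x. ?E t s x y \<partial>M) \<partial>M) \<partial>N) \<partial>N)"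
    by (rule Bochner_Integration.integral_cong[OF refl], rule integral_leb_swap)
      (unfold entropy_density_def, measurable, intro bdd_fun_UV)
  also have "\<dots> = (\<integral>t. (\<integral>s. (\<integral>y. (\<integral>x. ?E t s x y \<partial>M) \<partial>M) \<partial>N) \<partial>N)"
    by (rule integral_leb_swap) (unfold entropy_density_def, measurable, intro bdd_fun_UV)
  also have "\<dots> = (\<integral>t. (\<integral>s. (\<integral>x. (\<integral>y. ?E t s x y \<partial>M) \<partial>M) \<partial>N) \<partial>N)"
    by (rule Bochner_Integration.integral_cong[OF refl], rule Bochner_Integration.integral_cong[OF refl],
        rule integral_leb_swap)
      (unfold entropy_density_def, measurable, intro bdd_fun_UV)
  finally show ?thesis .
qed

text \<open>
  What is left of the sum of the two entropy densities after the weight is factored out.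
\<close>

definition doubled :: "nat \<Rightarrow> real \<Rightarrow> real \<Rightarrow> real \<Rightarrow> real \<Rightarrow> real" where
  "doubled n t s x y = - 2 * \<bar>U t x - V s y\<bar> * kern n (x - y)
     + sgn (U t x - V s y) * ((f x (U t x) - f x (V s y) - (f y (U t x) - f y (V s y))) * dkern n (x - y)
         + (partial1 f y (U t x) - partial1 f x (V s y)) * kern n (x - y))
     + sgn (U t x - V s y) * (source (U t) x - source (V s) y) * kern n (x - y)"

lemma entropy_density_add:
  "entropy_density T f n U (V s y) t s x y + entropy_density T f n V (U t x) s t y x
    = weight T n t s * doubled n t s x y"
proof -
  have k: "kern n (y - x) = kern n (x - y)" "dkern n (y - x) = - dkern n (x - y)"
    using kern_minus[of n "x - y"] dkern_minus[of n "x - y"] by simp_all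
  have s: "sgn (V s y - U t x) = - sgn (U t x - V s y)" by (simp add: sgn_if)
  have d: "dweight T n s t = - 2 * weight T n t s - dweight T n t s"
    using dweight_add[of T n t s] by simp
  show ?thesis
    unfolding entropy_density_def doubled_def k s d weight_commute[of T n s t] abs_minus_commute[of "V s y"]
    by (simp add: algebra_simps)
qed

lemma doubled_entropy:
  "0 \<le> (\<integral>t. (\<integral>s. weight T n t s * (\<integral>x. (\<integral>y. doubled n t s x y \<partial>M) \<partial>M) \<partial>N) \<partial>N)
     - boundary n T + boundary n 0
     - kruzkov_pair.boundary T V U n T + kruzkov_pair.boundary T V U n 0"
proof -
  interpret sw: kruzkov_pair T f C B V U H G by (rule swapped)
  let ?E = "\<lambda>t s x y. entropy_density T f n U (V s y) t s x y"
  let ?F = "\<lambda>t s x y. entropy_density T f n V (U t x) s t y x"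
  have "(\<integral>s. (\<integral>t. (\<integral>y. (\<integral>x. ?F t s x y \<partial>M) \<partial>M) \<partial>N) \<partial>N) = (\<integral>t. (\<integral>s. (\<integral>y. (\<integral>x. ?F t s x y \<partial>M) \<partial>M) \<partial>N) \<partial>N)"
    by (rule integral_leb_swap) (unfold entropy_density_def, measurable, intro bdd_fun_UV)
  also have "\<dots> = (\<integral>t. (\<integral>s. (\<integral>x. (\<integral>y. ?F t s x y \<partial>M) \<partial>M) \<partial>N) \<partial>N)"
    by (rule Bochner_Integration.integral_cong[OF refl], rule Bochner_Integration.integral_cong[OF refl],
        rule integral_leb_swap)
      (unfold entropy_density_def, measurable, intro bdd_fun_UV)
  finally have F: "(\<integral>s. (\<integral>t. (\<integral>y. (\<integral>x. ?F t s x y \<partial>M) \<partial>M) \<partial>N) \<partial>N) = \<dots>" .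
  have i1: "integrable M (\<lambda>y. ?E t s x y)" "integrable M (\<lambda>y. ?F t s x y)" for t s x
    unfolding entropy_density_def by (rule integrable_leb, measurable, intro bdd_fun_UV)+
  have i2: "integrable M (\<lambda>x. \<integral>y. ?E t s x y \<partial>M)" "integrable M (\<lambda>x. \<integral>y. ?F t s x y \<partial>M)" for t s
    unfolding entropy_density_def by (rule integrable_leb, measurable, intro bdd_fun_UV)+
  have i3: "integrable N (\<lambda>s. \<integral>x. (\<integral>y. ?E t s x y \<partial>M) \<partial>M)" "integrable N (\<lambda>s. \<integral>x. (\<integral>y. ?F t s x y \<partial>M) \<partial>M)" for t
    unfolding entropy_density_def by (rule integrable_leb, measurable, intro bdd_fun_UV)+
  have i4: "integrable N (\<lambda>t. \<integral>s. (\<integral>x. (\<integral>y. ?E t s x y \<partial>M) \<partial>M) \<partial>N)"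
      "integrable N (\<lambda>t. \<integral>s. (\<integral>x. (\<integral>y. ?F t s x y \<partial>M) \<partial>M) \<partial>N)"
    unfolding entropy_density_def by (rule integrable_leb, measurable, intro bdd_fun_UV)+
  have "(\<integral>t. (\<integral>s. weight T n t s * (\<integral>x. (\<integral>y. doubled n t s x y \<partial>M) \<partial>M) \<partial>N) \<partial>N)
    = (\<integral>t. (\<integral>s. (\<integral>x. (\<integral>y. weight T n t s * doubled n t s x y \<partial>M) \<partial>M) \<partial>N) \<partial>N)"
    by simp
  also have "\<dots> = (\<integral>t. (\<integral>s. (\<integral>x. (\<integral>y. ?E t s x y \<partial>M) \<partial>M) \<partial>N) \<partial>N)
     + (\<integral>t. (\<integral>s. (\<integral>x. (\<integral>y. ?F t s x y \<partial>M) \<partial>M) \<partial>N) \<partial>N)"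
    unfolding entropy_density_add[symmetric]
    by (simp only: Bochner_Integration.integral_add i1 i2 i3 i4)
  finally show ?thesis
    using integrated_entropy[of n] sw.integrated_entropy[of n] F by simp
qed

section \<open>The interior term\<close>

text \<open>
  The factor of the flux kernel once both states are taken at \<open>y\<close>.
\<close>

definition flux_diag :: "real \<Rightarrow> real \<Rightarrow> real \<Rightarrow> real" where
  "flux_diag t s y = sgn (U t y - V s y) * (partial1 f y (U t y) - partial1 f y (V s y))"

text \<open>
  Every occurrence of \<open>V s y\<close> that has to be compared with \<open>U t x\<close> is moved to \<open>V t x\<close> through
  \<open>V t y\<close>: the first step costs a time increment, the second an oscillation.
\<close>

lemma doubled_le:
  "doubled (Suc m) t s x y \<le>
     (\<bar>source (U t) x - source (V t) x\<bar> - 2 * \<bar>U t x - V t x\<bar>) * kern (Suc m) (x - y)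
     + 2 * (\<bar>V t x - V t y\<bar> * osc_kern (Suc m) (x - y))
     + 2 * (\<bar>V t y - V s y\<bar> * kern (Suc m) (x - y))
     + \<bar>source (V t) x - source (V t) y\<bar> * osc_kern (Suc m) (x - y)
     + \<bar>source (V t) y - source (V s) y\<bar> * kern (Suc m) (x - y)
     + flux_diag t s y * flux_kern (Suc m) (x - y)
     + B * (\<bar>U t x - U t y\<bar> * osc_kern (Suc m) (x - y))
     + 2 * B * rem_kern m (x - y)"
proof -
  let ?k = "kern (Suc m) (x - y)" and ?o = "osc_kern (Suc m) (x - y)"
  have k0: "0 \<le> ?k" and ko: "?k \<le> ?o" by (rule kern_nonneg, rule kern_le_osc_kern)
  have "- 2 * \<bar>U t x - V s y\<bar> \<le> - 2 * \<bar>U t x - V t x\<bar> + 2 * \<bar>V t x - V t y\<bar> + 2 * \<bar>V t y - V s y\<bar>"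
    using abs_triangle_ineq4[of "U t x - V s y" "V t x - V s y"]
      abs_triangle_ineq[of "V t x - V t y" "V t y - V s y"] by simp
  from mult_right_mono[OF this k0]
  have 1: "- 2 * \<bar>U t x - V s y\<bar> * ?k \<le> - 2 * \<bar>U t x - V t x\<bar> * ?k + 2 * (\<bar>V t x - V t y\<bar> * ?k) + 2 * (\<bar>V t y - V s y\<bar> * ?k)"
    by (simp add: algebra_simps)
  have 2: "\<bar>V t x - V t y\<bar> * ?k \<le> \<bar>V t x - V t y\<bar> * ?o"
    "\<bar>source (V t) x - source (V t) y\<bar> * ?k \<le> \<bar>source (V t) x - source (V t) y\<bar> * ?o"
    using ko by (auto intro: mult_left_mono)
  have "sgn (U t x - V s y) * (source (U t) x - source (V s) y) \<le> \<bar>source (U t) x - source (V s) y\<bar>"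
    by (rule sgn_mult_le_abs)
  also have "\<dots> \<le> \<bar>source (U t) x - source (V t) x\<bar> + \<bar>source (V t) x - source (V t) y\<bar> + \<bar>source (V t) y - source (V s) y\<bar>"
    by linarith
  finally have 3: "sgn (U t x - V s y) * (source (U t) x - source (V s) y) * ?k \<le>
     \<bar>source (U t) x - source (V t) x\<bar> * ?k + \<bar>source (V t) x - source (V t) y\<bar> * ?k + \<bar>source (V t) y - source (V s) y\<bar> * ?k"
    using mult_right_mono[OF _ k0] by (simp flip: distrib_right)
  have 4: "(\<bar>source (U t) x - source (V t) x\<bar> - 2 * \<bar>U t x - V t x\<bar>) * ?k
     = \<bar>source (U t) x - source (V t) x\<bar> * ?k + - 2 * \<bar>U t x - V t x\<bar> * ?k"
    by (simp add: algebra_simps)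
  note fl = flux_pointwise[OF flux U_le[of t x] V_le[of s y] U_le[of t y], of x y m]
  show ?thesis
    using 1 2 3 4 fl unfolding doubled_def flux_diag_def by (simp add: mult.assoc)
qed

definition interior_error :: "nat \<Rightarrow> real \<Rightarrow> real" where
  "interior_error m t = 2 * osc (Suc m) (V t) + osc (Suc m) (source (V t)) + B * osc (Suc m) (U t)
     + 2 * B / (real m + 2) + 2 * B * rem_rate m"

lemma slice_measurable [measurable]:
  "U t \<in> borel_measurable borel" "V t \<in> borel_measurable borel"
  using U_measurable V_measurable by (auto intro: measurable_slice)

lemma L1_dist_source_le:
  "\<bar>source (U t) x - source (V t) x\<bar> \<le> 2 * L1_dist (U t) (V t)"
  "\<bar>source (V t) x - source (V s) x\<bar> \<le> 2 * L1_dist (V t) (V s)"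
  unfolding L1_dist_def
  by (rule source_diff_le; (rule slice_measurable | rule bdd_funI, rule U_le | rule bdd_funI, rule V_le))+

text \<open>
  The first term of the pointwise bound has a nonpositive integral because the two sources differ by
  at most twice the \<open>L\<^sup>1\<close> distance; this fixes the rate \<open>2\<close> in the exponent.  The flux term is bounded by
  the mass of the flux kernel.
\<close>

lemma integral_doubled_le:
  "(\<integral>x. (\<integral>y. doubled (Suc m) t s x y \<partial>M) \<partial>M) \<le> interior_error m t + 4 * L1_dist (V t) (V s)"
proof -
  let ?P = "M \<Otimes>\<^sub>M M"
  let ?k = "kern (Suc m)" and ?o = "osc_kern (Suc m)"
  let ?g = "\<lambda>x. \<bar>source (U t) x - source (V t) x\<bar> - 2 * \<bar>U t x - V t x\<bar>"
  let ?t1 = "\<lambda>p. ?g (fst p) * ?k (fst p - snd p)"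
  let ?t2 = "\<lambda>p. \<bar>V t (fst p) - V t (snd p)\<bar> * ?o (fst p - snd p)"
  let ?t3 = "\<lambda>p. \<bar>V t (snd p) - V s (snd p)\<bar> * ?k (fst p - snd p)"
  let ?t4 = "\<lambda>p. \<bar>source (V t) (fst p) - source (V t) (snd p)\<bar> * ?o (fst p - snd p)"
  let ?t5 = "\<lambda>p. \<bar>source (V t) (snd p) - source (V s) (snd p)\<bar> * ?k (fst p - snd p)"
  let ?t6 = "\<lambda>p. flux_diag t s (snd p) * flux_kern (Suc m) (fst p - snd p)"
  let ?t7 = "\<lambda>p. \<bar>U t (fst p) - U t (snd p)\<bar> * ?o (fst p - snd p)"
  let ?t8 = "\<lambda>p. rem_kern m (fst p - snd p)"
  have fd [measurable]: "flux_diag t s \<in> borel_measurable borel"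
    unfolding flux_diag_def[abs_def] by measurable
  have fdb [bdd_fun_intros]: "bdd_fun (\<lambda>p. flux_diag t s (h p))" for h :: "'x \<Rightarrow> real"
    unfolding flux_diag_def by (intro bdd_fun_UV)
  have i: "integrable ?P ?t1" "integrable ?P ?t2" "integrable ?P ?t3" "integrable ?P ?t4"
    "integrable ?P ?t5" "integrable ?P ?t6" "integrable ?P ?t7" "integrable ?P ?t8"
    by (rule integrable_leb_pair, measurable, intro bdd_fun_UV fdb)+
  have bk [bdd_fun_intros]: "bdd_fun (kern n)" "bdd_fun (flux_kern n)" "bdd_fun (rem_kern n)" for n
    using bdd_fun_kern[of n "\<lambda>x. x"] bdd_fun_flux_kern[of n "\<lambda>x. x"] bdd_fun_rem_kern[of n "\<lambda>x. x"] by simp_all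
  have swap_k: "(\<integral>x. (\<integral>y. w y * q (x - y) \<partial>M) \<partial>M) = (\<integral>y. w y * (\<integral>x. q (x - y) \<partial>M) \<partial>M)"
    if [measurable]: "w \<in> borel_measurable borel" "q \<in> borel_measurable borel" and "bdd_fun w" "bdd_fun q" for w q :: "real \<Rightarrow> real"
  proof -
    have "(\<integral>x. (\<integral>y. w y * q (x - y) \<partial>M) \<partial>M) = (\<integral>y. (\<integral>x. w y * q (x - y) \<partial>M) \<partial>M)"
      by (rule integral_leb_swap) (measurable, intro bdd_fun_mult bdd_fun_compose[OF that(3)] bdd_fun_compose[OF that(4)])
    then show ?thesis by simp
  qed
  have e1: "(\<integral>p. ?t1 p \<partial>?P) \<le> 0"
  proof -
    have "(\<integral>p. ?t1 p \<partial>?P) = (\<integral>x. (\<integral>y. ?g x * ?k (x - y) \<partial>M) \<partial>M)"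
      by (subst integral_leb_pair) (measurable, intro bdd_fun_UV, simp)
    also have "\<dots> = (\<integral>x. ?g x \<partial>M)" by (simp add: integral_kern')
    also have "\<dots> \<le> (\<integral>x. 2 * L1_dist (U t) (V t) - 2 * \<bar>U t x - V t x\<bar> \<partial>M)"
    proof (rule integral_leb_mono)
      show "AE x in M. x \<in> {0..1} \<longrightarrow> ?g x \<le> 2 * L1_dist (U t) (V t) - 2 * \<bar>U t x - V t x\<bar>"
        using L1_dist_source_le(1)[of t] by (intro AE_I2 impI) simp
    qed (measurable, intro bdd_fun_UV, measurable, intro bdd_fun_UV)
    also have "\<dots> = (\<integral>x. 2 * L1_dist (U t) (V t) \<partial>M) - (\<integral>x. 2 * \<bar>U t x - V t x\<bar> \<partial>M)"
      by (rule Bochner_Integration.integral_diff; (rule integrable_leb, measurable, intro bdd_fun_UV))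
    also have "\<dots> = 0"
      by (subst integral_leb_const) (simp_all add: L1_dist_def)
    finally show ?thesis .
  qed
  have e2: "(\<integral>p. ?t2 p \<partial>?P) = osc (Suc m) (V t)" "(\<integral>p. ?t7 p \<partial>?P) = osc (Suc m) (U t)"
    "(\<integral>p. ?t4 p \<partial>?P) = osc (Suc m) (source (V t))"
    unfolding osc_def by (subst integral_leb_pair, measurable, intro bdd_fun_UV, simp)+
  have e3: "(\<integral>p. ?t3 p \<partial>?P) = L1_dist (V t) (V s)"
  proof -
    have "(\<integral>p. ?t3 p \<partial>?P) = (\<integral>x. (\<integral>y. \<bar>V t y - V s y\<bar> * ?k (x - y) \<partial>M) \<partial>M)"
      by (subst integral_leb_pair) (measurable, intro bdd_fun_UV, simp)
    also have "\<dots> = (\<integral>y. \<bar>V t y - V s y\<bar> * (\<integral>x. ?k (x - y) \<partial>M) \<partial>M)"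
      by (rule swap_k; (measurable; fail | intro bdd_fun_UV bk))
    finally show ?thesis by (simp add: integral_kern L1_dist_def)
  qed
  have e5: "(\<integral>p. ?t5 p \<partial>?P) \<le> 2 * L1_dist (V t) (V s)"
  proof -
    have "(\<integral>p. ?t5 p \<partial>?P) = (\<integral>x. (\<integral>y. \<bar>source (V t) y - source (V s) y\<bar> * ?k (x - y) \<partial>M) \<partial>M)"
      by (subst integral_leb_pair) (measurable, intro bdd_fun_UV, simp)
    also have "\<dots> = (\<integral>y. \<bar>source (V t) y - source (V s) y\<bar> * (\<integral>x. ?k (x - y) \<partial>M) \<partial>M)"
      by (rule swap_k; (measurable; fail | intro bdd_fun_UV bk))
    also have "\<dots> = (\<integral>y. \<bar>source (V t) y - source (V s) y\<bar> \<partial>M)" by (simp add: integral_kern)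
    also have "\<dots> \<le> (\<integral>y. 2 * L1_dist (V t) (V s) \<partial>M)"
    proof (rule integral_leb_mono)
      show "AE x in M. x \<in> {0..1} \<longrightarrow> \<bar>source (V t) x - source (V s) x\<bar> \<le> 2 * L1_dist (V t) (V s)"
        by (intro AE_I2 impI L1_dist_source_le)
    qed (measurable, intro bdd_fun_UV, measurable, intro bdd_fun_UV)
    also have "\<dots> = 2 * L1_dist (V t) (V s)" by (subst integral_leb_const) simp_all
    finally show ?thesis .
  qed
  have e6: "(\<integral>p. ?t6 p \<partial>?P) \<le> 2 * B / (real m + 2)"
  proof -
    have "(\<integral>p. ?t6 p \<partial>?P) = (\<integral>x. (\<integral>y. flux_diag t s y * flux_kern (Suc m) (x - y) \<partial>M) \<partial>M)"
      by (subst integral_leb_pair) (measurable, intro bdd_fun_UV fdb, simp)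
    also have "\<dots> = (\<integral>y. flux_diag t s y * (\<integral>x. flux_kern (Suc m) (x - y) \<partial>M) \<partial>M)"
      by (rule swap_k; (measurable; fail | intro bdd_fun_UV fdb bk))
    also have "\<dots> = (\<integral>y. flux_diag t s y \<partial>M) * (1 / (real (Suc m) + 1))"
      by (simp only: integral_flux_kern integral_mult_left_zero)
    also have "\<dots> \<le> (2 * B) * (1 / (real (Suc m) + 1))"
    proof (rule mult_right_mono)
      have "(\<integral>y. flux_diag t s y \<partial>M) \<le> (\<integral>y. 2 * B \<partial>M)"
      proof (rule integral_leb_mono)
        have "flux_diag t s y \<le> 2 * B" for y
        proof -
          have "flux_diag t s y \<le> \<bar>partial1 f y (U t y) - partial1 f y (V s y)\<bar>"
            unfolding flux_diag_def by (rule sgn_mult_le_abs)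
          also have "\<dots> \<le> 2 * B" using fx_le[OF U_le[of t y], of y] fx_le[OF V_le[of s y], of y] by linarith
          finally show ?thesis .
        qed
        then show "AE y in M. y \<in> {0..1} \<longrightarrow> flux_diag t s y \<le> 2 * B" by (intro AE_I2 impI)
      qed (measurable, intro bdd_fun_UV fdb, measurable, intro bdd_fun_UV)
      also have "\<dots> = 2 * B" by (subst integral_leb_const) simp_all
      finally show "(\<integral>y. flux_diag t s y \<partial>M) \<le> 2 * B" .
    qed simp
    finally show ?thesis by (simp add: add.commute)
  qed
  have e8: "(\<integral>p. ?t8 p \<partial>?P) = rem_rate m"
  proof -
    have "(\<integral>p. ?t8 p \<partial>?P) = (\<integral>x. (\<integral>y. 1 * rem_kern m (x - y) \<partial>M) \<partial>M)"
      by (subst integral_leb_pair) (measurable, intro bdd_fun_UV, simp)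
    also have "\<dots> = (\<integral>y. 1 * (\<integral>x. rem_kern m (x - y) \<partial>M) \<partial>M)"
      by (rule swap_k; (measurable; fail | intro bdd_fun_UV bk))
    also have "\<dots> = (\<integral>y. rem_rate m \<partial>M)" by (simp only: integral_rem_kern mult_1)
    also have "\<dots> = rem_rate m" by (subst integral_leb_const) simp_all
    finally show ?thesis .
  qed
  have "(\<integral>x. (\<integral>y. doubled (Suc m) t s x y \<partial>M) \<partial>M) = (\<integral>p. doubled (Suc m) t s (fst p) (snd p) \<partial>?P)"
    unfolding doubled_def by (subst integral_leb_pair) (measurable, intro bdd_fun_UV, simp)
  also have "\<dots> \<le> (\<integral>p. ?t1 p + 2 * ?t2 p + 2 * ?t3 p + ?t4 p + ?t5 p + ?t6 p + B * ?t7 p + 2 * B * ?t8 p \<partial>?P)"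
  proof (rule integral_mono)
    show "integrable ?P (\<lambda>p. doubled (Suc m) t s (fst p) (snd p))"
      unfolding doubled_def by (rule integrable_leb_pair, measurable, intro bdd_fun_UV)
    show "integrable ?P (\<lambda>p. ?t1 p + 2 * ?t2 p + 2 * ?t3 p + ?t4 p + ?t5 p + ?t6 p + B * ?t7 p + 2 * B * ?t8 p)"
      by (intro Bochner_Integration.integrable_add integrable_mult_right i)
  qed (rule doubled_le)
  also have "\<dots> = (\<integral>p. ?t1 p \<partial>?P) + 2 * (\<integral>p. ?t2 p \<partial>?P) + 2 * (\<integral>p. ?t3 p \<partial>?P) + (\<integral>p. ?t4 p \<partial>?P)
     + (\<integral>p. ?t5 p \<partial>?P) + (\<integral>p. ?t6 p \<partial>?P) + B * (\<integral>p. ?t7 p \<partial>?P) + 2 * B * (\<integral>p. ?t8 p \<partial>?P)"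
    by (simp only: Bochner_Integration.integral_add Bochner_Integration.integrable_add integrable_mult_right i
        integral_mult_right_zero)
  finally show ?thesis
    using e1 e2 e3 e5 e6 e8 unfolding interior_error_def by simp
qed

lemma source_bound: obtains C' where "\<And>t x. \<bar>source (V t) x\<bar> \<le> C'"
proof -
  have "bdd_fun (\<lambda>p. source (V (fst p)) (snd p))" by (rule bdd_fun_flux)
  then obtain C' where "\<And>p. \<bar>source (V (fst p)) (snd p)\<bar> \<le> C'" unfolding bdd_fun_def by blast
  from this[of "(_, _)"] show ?thesis by (intro that) simp
qed

lemma source_V_measurable [measurable]: "case_prod (\<lambda>t. source (V t)) \<in> borel_measurable (borel \<Otimes>\<^sub>M borel)"
  unfolding case_prod_unfold by measurable

lemma rem_rate_nonneg: "0 \<le> rem_rate m"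
  by (simp add: rem_rate_def)

lemma interior_error_nonneg: "0 \<le> interior_error m t"
  unfolding interior_error_def
  using B_nonneg by (intro add_nonneg_nonneg mult_nonneg_nonneg osc_nonneg divide_nonneg_nonneg rem_rate_nonneg) auto

lemma interior_error_measurable [measurable]: "interior_error m \<in> borel_measurable borel"
  unfolding interior_error_def[abs_def] by measurable

lemma bdd_fun_interior_error: "bdd_fun (interior_error m)"
proof -
  obtain C' where "\<And>t x. \<bar>source (V t) x\<bar> \<le> C'" using source_bound by blast
  then have "bdd_fun (\<lambda>t. osc (Suc m) (source (V t)))" by (rule bdd_fun_osc)
  then show ?thesis
    unfolding interior_error_def[abs_def]
    by (intro bdd_fun_intros bdd_fun_osc[OF U_le] bdd_fun_osc[OF V_le])
qed

lemma integral_interior_error_tendsto_0: "(\<lambda>m. \<integral>t. interior_error m t \<partial>N) \<longlonglongrightarrow> 0"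
proof -
  obtain C' where C': "\<And>t x. \<bar>source (V t) x\<bar> \<le> C'" using source_bound by blast
  have i: "integrable N (\<lambda>t. osc n (V t))" "integrable N (\<lambda>t. osc n (U t))" "integrable N (\<lambda>t. osc n (source (V t)))" for n
    by (rule integrable_leb, measurable, rule bdd_fun_osc, rule V_le U_le C')+
  have "(\<integral>t. interior_error m t \<partial>N) = 2 * (\<integral>t. osc (Suc m) (V t) \<partial>N) + (\<integral>t. osc (Suc m) (source (V t)) \<partial>N)
      + B * (\<integral>t. osc (Suc m) (U t) \<partial>N) + (2 * B / (real m + 2) * T + 2 * B * rem_rate m * T)" for m
  proof -
    have c: "integrable N (\<lambda>t. c)" for c :: real by (rule integrable_leb, measurable, rule bdd_fun_const)
    have cT: "(\<integral>t. c \<partial>N) = c * T" for c :: real using T by (subst integral_leb_const) simp_all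
    show ?thesis unfolding interior_error_def
      by (simp only: Bochner_Integration.integral_add Bochner_Integration.integrable_add integrable_mult_right i c
          integral_mult_right_zero cT add.assoc distrib_right)
  qed
  moreover have "(\<lambda>m. 2 * (\<integral>t. osc (Suc m) (V t) \<partial>N) + (\<integral>t. osc (Suc m) (source (V t)) \<partial>N)
      + B * (\<integral>t. osc (Suc m) (U t) \<partial>N) + (2 * B / (real m + 2) * T + 2 * B * rem_rate m * T))
      \<longlonglongrightarrow> 2 * 0 + 0 + B * 0 + (0 * T + 2 * B * 0 * T)"
  proof (intro tendsto_intros rem_rate_tendsto)
    show "(\<lambda>m. \<integral>t. osc (Suc m) (V t) \<partial>N) \<longlonglongrightarrow> 0" "(\<lambda>m. \<integral>t. osc (Suc m) (U t) \<partial>N) \<longlonglongrightarrow> 0"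
      "(\<lambda>m. \<integral>t. osc (Suc m) (source (V t)) \<partial>N) \<longlonglongrightarrow> 0"
      using integral_osc_tendsto_0[OF V_measurable V_le, of T] integral_osc_tendsto_0[OF U_measurable U_le, of T]
        integral_osc_tendsto_0[OF source_V_measurable C', of T] LIMSEQ_Suc by blast+
    show "(\<lambda>m. 2 * B / (real m + 2)) \<longlonglongrightarrow> 0" by real_asymp
  qed
  ultimately show ?thesis by simp
qed

section \<open>Boundary terms and the limit\<close>

text \<open>
  A modulus of continuity in time in the form that the kernel \<open>\<omega>\<close> can integrate.
\<close>

definition modulus :: "real \<Rightarrow> real \<Rightarrow> bool" where
  "modulus \<epsilon> K \<longleftrightarrow> 0 < \<epsilon> \<and> 0 \<le> K \<and>
    (\<forall>t\<in>H. \<forall>s\<in>H. L1_dist (V t) (V s) \<le> \<epsilon> + K * sin (pi * ((t - s) / (2 * T))) ^ 2)"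

lemma modulus_exists: "0 < \<epsilon> \<Longrightarrow> \<exists>K. modulus \<epsilon> K"
  using solV unfolding kruzkov_solution_def modulus_def by blast

lemma AE_N: "AE t in N. t \<in> H \<and> t \<in> {0..T}"
proof -
  have "AE t in N. t \<in> H" using solV unfolding kruzkov_solution_def by blast
  moreover have "AE t in N. t \<in> {0..T}" by (rule AE_leb_mem) simp
  ultimately show ?thesis by eventually_elim simp
qed

lemma H_ends: "0 \<in> H" "T \<in> H"
  using solV unfolding kruzkov_solution_def by blast+

text \<open>
  The weight is at most \<open>\<omega>\<close>, whose mass multiplies the constant part and whose second moment controls
  the rest.
\<close>

lemma integral_weight_le:
  assumes t: "t \<in> {0..T}" and "0 \<le> a" "0 \<le> K" and [measurable]: "q \<in> borel_measurable borel" and "bdd_fun q"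
    and q: "\<And>s. s \<in> H \<Longrightarrow> q s \<le> a + K * sin (pi * ((t - s) / (2 * T))) ^ 2"
  shows "(\<integral>s. weight T n t s * q s \<partial>N) \<le> (\<integral>s. tkern T n t s \<partial>N) * a + K / (2 * real n + 2)"
proof -
  note [bdd_fun_intros] = \<open>bdd_fun q\<close>
  let ?r = "\<lambda>s. tkern T n t s * sin (pi * ((t - s) / (2 * T))) ^ 2"
  have i: "integrable N (tkern T n t)" "integrable N ?r"
    by (rule integrable_leb, measurable, intro bdd_fun_intros)+
  have "(\<integral>s. weight T n t s * q s \<partial>N) \<le> (\<integral>s. tkern T n t s * a + K * ?r s \<partial>N)"
  proof (rule integral_leb_mono)
    show "AE s in N. s \<in> {0..T} \<longrightarrow> weight T n t s * q s \<le> tkern T n t s * a + K * ?r s"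
      using AE_N
    proof eventually_elim
      case (elim s)
      have "weight T n t s * q s \<le> weight T n t s * (a + K * sin (pi * ((t - s) / (2 * T))) ^ 2)"
        using q elim by (intro mult_left_mono weight_nonneg T) auto
      also have "\<dots> \<le> tkern T n t s * (a + K * sin (pi * ((t - s) / (2 * T))) ^ 2)"
        using assms(2,3) by (intro mult_right_mono weight_le T) auto
      finally show ?case by (simp add: algebra_simps)
    qed
  qed (measurable, intro bdd_fun_intros \<open>bdd_fun q\<close>, measurable, intro bdd_fun_intros)
  also have "\<dots> = (\<integral>s. tkern T n t s \<partial>N) * a + K * (\<integral>s. ?r s \<partial>N)"
    using i by simp
  also have "K * (\<integral>s. ?r s \<partial>N) \<le> K * (1 / (2 * real n + 2))"
    using integral_tkern_le(2)[OF T t] \<open>0 \<le> K\<close> by (rule mult_left_mono)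
  finally show ?thesis by simp
qed

lemma interior_le:
  assumes mod: "modulus \<epsilon> K"
  shows "(\<integral>t. (\<integral>s. weight T (Suc m) t s * (\<integral>x. (\<integral>y. doubled (Suc m) t s x y \<partial>M) \<partial>M) \<partial>N) \<partial>N)
    \<le> (\<integral>t. interior_error m t \<partial>N) + (4 * \<epsilon> + 4 * K / (2 * real (Suc m) + 2)) * T"
proof -
  have e: "0 < \<epsilon>" and K: "0 \<le> K" using mod by (auto simp: modulus_def)
  let ?D = "\<lambda>t s. \<integral>x. (\<integral>y. doubled (Suc m) t s x y \<partial>M) \<partial>M"
  let ?c = "4 * \<epsilon> + 4 * K / (2 * real (Suc m) + 2)"
  have "(\<integral>t. (\<integral>s. weight T (Suc m) t s * ?D t s \<partial>N) \<partial>N) \<le> (\<integral>t. interior_error m t + ?c \<partial>N)"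
  proof (rule integral_leb_mono)
    show "AE t in N. t \<in> {0..T} \<longrightarrow> (\<integral>s. weight T (Suc m) t s * ?D t s \<partial>N) \<le> interior_error m t + ?c"
      using AE_N
    proof eventually_elim
      case (elim t)
      have "(\<integral>s. weight T (Suc m) t s * ?D t s \<partial>N) \<le> (\<integral>s. tkern T (Suc m) t s \<partial>N) * (interior_error m t + 4 * \<epsilon>) + 4 * K / (2 * real (Suc m) + 2)"
      proof (rule integral_weight_le)
        show "?D t \<in> borel_measurable borel" unfolding doubled_def by measurable
        show "bdd_fun (?D t)" unfolding doubled_def by (intro bdd_fun_UV)
        fix s assume "s \<in> H"
        then have "L1_dist (V t) (V s) \<le> \<epsilon> + K * sin (pi * ((t - s) / (2 * T))) ^ 2"
          using mod elim by (auto simp: modulus_def)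
        with integral_doubled_le[of m t s]
        show "?D t s \<le> interior_error m t + 4 * \<epsilon> + 4 * K * sin (pi * ((t - s) / (2 * T))) ^ 2"
          by linarith
      qed (use elim e K interior_error_nonneg[of m t] in auto)
      also have "(\<integral>s. tkern T (Suc m) t s \<partial>N) * (interior_error m t + 4 * \<epsilon>) \<le> 1 * (interior_error m t + 4 * \<epsilon>)"
        using elim e interior_error_nonneg[of m t] by (intro mult_right_mono integral_tkern_le T) auto
      finally show ?case by simp
    qed
    show "bdd_fun (\<lambda>t. interior_error m t + ?c)" by (intro bdd_fun_intros bdd_fun_interior_error)
    show "bdd_fun (\<lambda>t. \<integral>s. weight T (Suc m) t s * ?D t s \<partial>N)" unfolding doubled_def by (intro bdd_fun_UV)
  qed (unfold doubled_def, measurable)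
  also have "\<dots> = (\<integral>t. interior_error m t \<partial>N) + (\<integral>t. ?c \<partial>N)"
  proof (rule Bochner_Integration.integral_add)
    show "integrable N (interior_error m)" by (rule integrable_leb, measurable, rule bdd_fun_interior_error)
    show "integrable N (\<lambda>t. ?c)" by (rule integrable_leb, measurable, rule bdd_fun_const)
  qed
  also have "(\<integral>t. ?c \<partial>N) = ?c * T" using T by (subst integral_leb_const) auto
  finally show ?thesis .
qed

text \<open>
  The \<open>L\<^sup>1\<close> distance of two time slices, smeared out in space.
\<close>

definition slice_dist :: "nat \<Rightarrow> real \<Rightarrow> real \<Rightarrow> real" where
  "slice_dist n \<tau> s = (\<integral>y. (\<integral>x. \<bar>U \<tau> x - V s y\<bar> * kern n (x - y) \<partial>M) \<partial>M)"

lemma slice_dist_approx: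
  "\<bar>slice_dist n \<tau> s - L1_dist (U \<tau>) (V \<tau>)\<bar> \<le> osc n (V \<tau>) + L1_dist (V \<tau>) (V s)"
proof -
  let ?P = "M \<Otimes>\<^sub>M M"
  let ?k = "\<lambda>p. kern n (snd p - fst p)"
  let ?a = "\<lambda>p. \<bar>U \<tau> (snd p) - V s (fst p)\<bar> * ?k p" and ?b = "\<lambda>p. \<bar>U \<tau> (snd p) - V \<tau> (snd p)\<bar> * ?k p"
  let ?c = "\<lambda>p. \<bar>V \<tau> (fst p) - V \<tau> (snd p)\<bar> * osc_kern n (fst p - snd p)" and ?d = "\<lambda>p. \<bar>V \<tau> (fst p) - V s (fst p)\<bar> * ?k p"
  have i: "integrable ?P ?a" "integrable ?P ?b" "integrable ?P ?c" "integrable ?P ?d"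
    by (rule integrable_leb_pair, measurable, intro bdd_fun_UV)+
  have a: "(\<integral>p. ?a p \<partial>?P) = slice_dist n \<tau> s"
    unfolding slice_dist_def by (subst integral_leb_pair) (measurable, intro bdd_fun_UV, simp)
  have b: "(\<integral>p. ?b p \<partial>?P) = L1_dist (U \<tau>) (V \<tau>)"
  proof -
    have "(\<integral>p. ?b p \<partial>?P) = (\<integral>y. (\<integral>x. \<bar>U \<tau> x - V \<tau> x\<bar> * kern n (x - y) \<partial>M) \<partial>M)"
      by (subst integral_leb_pair) (measurable, intro bdd_fun_UV, simp)
    also have "\<dots> = (\<integral>x. (\<integral>y. \<bar>U \<tau> x - V \<tau> x\<bar> * kern n (x - y) \<partial>M) \<partial>M)"
      by (rule integral_leb_swap) (measurable, intro bdd_fun_UV)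
    also have "\<dots> = L1_dist (U \<tau>) (V \<tau>)" by (simp add: integral_kern' L1_dist_def)
    finally show ?thesis .
  qed
  have c: "(\<integral>p. ?c p \<partial>?P) = osc n (V \<tau>)"
    unfolding osc_def by (subst integral_leb_pair) (measurable, intro bdd_fun_UV, simp)
  have d: "(\<integral>p. ?d p \<partial>?P) = L1_dist (V \<tau>) (V s)"
  proof -
    have "(\<integral>p. ?d p \<partial>?P) = (\<integral>y. (\<integral>x. \<bar>V \<tau> y - V s y\<bar> * kern n (x - y) \<partial>M) \<partial>M)"
      by (subst integral_leb_pair) (measurable, intro bdd_fun_UV, simp)
    then show ?thesis by (simp add: integral_kern L1_dist_def)
  qed
  have pw: "\<bar>?a p - ?b p\<bar> \<le> ?c p + ?d p" for p
  proof -
    let ?x = "snd p" and ?y = "fst p"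
    have k0: "0 \<le> ?k p" by (rule kern_nonneg)
    have ko: "?k p \<le> osc_kern n (?y - ?x)"
      using kern_le_osc_kern[of n "?y - ?x"] kern_minus[of n "?y - ?x"] by simp
    have "?a p - ?b p = (\<bar>U \<tau> ?x - V s ?y\<bar> - \<bar>U \<tau> ?x - V \<tau> ?x\<bar>) * ?k p"
      by (simp add: algebra_simps)
    then have "\<bar>?a p - ?b p\<bar> = \<bar>\<bar>U \<tau> ?x - V s ?y\<bar> - \<bar>U \<tau> ?x - V \<tau> ?x\<bar>\<bar> * ?k p"
      using k0 by (simp add: abs_mult)
    also have "\<dots> \<le> (\<bar>V \<tau> ?y - V \<tau> ?x\<bar> + \<bar>V \<tau> ?y - V s ?y\<bar>) * ?k p"
      by (intro mult_right_mono k0) (simp add: abs_if)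
    also have "\<dots> \<le> ?c p + ?d p"
      using mult_left_mono[OF ko, of "\<bar>V \<tau> ?y - V \<tau> ?x\<bar>"] by (simp add: algebra_simps)
    finally show ?thesis .
  qed
  have "\<bar>slice_dist n \<tau> s - L1_dist (U \<tau>) (V \<tau>)\<bar> = \<bar>\<integral>p. ?a p - ?b p \<partial>?P\<bar>"
    using i a b by simp
  also have "\<dots> \<le> (\<integral>p. \<bar>?a p - ?b p\<bar> \<partial>?P)" by (rule Bochner_Integration.integral_abs_bound)
  also have "\<dots> \<le> (\<integral>p. ?c p + ?d p \<partial>?P)"
    by (rule integral_mono[OF _ _ pw])
       (intro Bochner_Integration.integrable_abs Bochner_Integration.integrable_diff Bochner_Integration.integrable_add i)+
  also have "\<dots> = osc n (V \<tau>) + L1_dist (V \<tau>) (V s)"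
    by (subst Bochner_Integration.integral_add[OF i(3,4)]) (simp only: c d)
  finally show ?thesis .
qed

lemma slice_dist_measurable [measurable]: "slice_dist n \<tau> \<in> borel_measurable borel"
  unfolding slice_dist_def[abs_def] by measurable

lemma bdd_fun_slice_dist: "bdd_fun (slice_dist n \<tau>)"
  unfolding slice_dist_def[abs_def] by (intro bdd_fun_UV)

lemma boundary_eq: "boundary n \<tau> = (\<integral>s. weight T n \<tau> s * slice_dist n \<tau> s \<partial>N)"
proof -
  have "\<bar>U \<tau> x - V s y\<bar> * weight T n \<tau> s * kern n (x - y) = weight T n \<tau> s * (\<bar>U \<tau> x - V s y\<bar> * kern n (x - y))" for s x y
    by simp
  then show ?thesis unfolding boundary_def slice_dist_def
    by (simp only: integral_mult_right_zero)
qed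

text \<open>
  Half of the mass of \<open>\<omega>\<close> lies in the time interval; the weight is at most \<open>\<omega>\<close>.
\<close>

lemma boundary_initial_le:
  assumes mod: "modulus \<epsilon> K"
  shows "boundary n 0 \<le> 1 / 2 * L1_dist (U 0) (V 0) + osc n (V 0) + \<epsilon> + K / (2 * real n + 2)"
proof -
  have e: "0 < \<epsilon>" and K: "0 \<le> K" using mod by (auto simp: modulus_def)
  let ?a = "L1_dist (U 0) (V 0) + osc n (V 0) + \<epsilon>"
  have "boundary n 0 \<le> (\<integral>s. tkern T n 0 s \<partial>N) * ?a + K / (2 * real n + 2)"
    unfolding boundary_eq
  proof (rule integral_weight_le)
    fix s assume "s \<in> H"
    then have "L1_dist (V 0) (V s) \<le> \<epsilon> + K * sin (pi * ((0 - s) / (2 * T))) ^ 2"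
      using mod H_ends unfolding modulus_def by blast
    with slice_dist_approx[of n 0 s]
    show "slice_dist n 0 s \<le> ?a + K * sin (pi * ((0 - s) / (2 * T))) ^ 2" by linarith
  qed (use T e K L1_dist_nonneg[of "U 0" "V 0"] osc_nonneg[of n "V 0"] bdd_fun_slice_dist in auto)
  also have "(\<integral>s. tkern T n 0 s \<partial>N) = 1 / 2" using T by (intro integral_tkern_half) auto
  finally show ?thesis using e osc_nonneg[of n "V 0"] by (simp add: add_divide_distrib)
qed

text \<open>
  Half of the mass of \<open>\<omega>\<close> lies in the time interval; there the weight is at least \<open>e^{-2T} \<omega>\<close>.
\<close>

lemma boundary_final_ge:
  assumes mod: "modulus \<epsilon> K"
  shows "1 / 2 * (exp (- (2 * T)) * L1_dist (U T) (V T)) - osc n (V T) - \<epsilon> - K / (2 * real n + 2) \<le> boundary n T"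
proof -
  have e: "0 < \<epsilon>" and K: "0 \<le> K" using mod by (auto simp: modulus_def)
  let ?o = "osc n (V T) + \<epsilon>" and ?E = "exp (- (2 * T))" and ?a = "L1_dist (U T) (V T)"
  let ?s = "\<lambda>s. sin (pi * ((T - s) / (2 * T))) ^ 2"
  have i: "integrable N (tkern T n T)" "integrable N (\<lambda>s. tkern T n T s * ?s s)"
    by (rule integrable_leb, measurable, intro bdd_fun_intros)+
  have "(\<integral>s. tkern T n T s * (?E * ?a - ?o) - K * (tkern T n T s * ?s s) \<partial>N) \<le> boundary n T"
    unfolding boundary_eq
  proof (rule integral_leb_mono)
    show "AE s in N. s \<in> {0..T} \<longrightarrow> tkern T n T s * (?E * ?a - ?o) - K * (tkern T n T s * ?s s) \<le> weight T n T s * slice_dist n T s"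
      using AE_N
    proof eventually_elim
      case (elim s)
      let ?t = "tkern T n T s" and ?I = "slice_dist n T s"
      have t0: "0 \<le> ?t" using T by (rule tkern_nonneg)
      have "L1_dist (V T) (V s) \<le> \<epsilon> + K * ?s s"
        using mod H_ends elim unfolding modulus_def by blast
      with slice_dist_approx[of n T s] have "?a - (?o + K * ?s s) \<le> ?I" by linarith
      then have "?E * (?a - (?o + K * ?s s)) \<le> ?E * ?I" by simp
      moreover have "?E * (?o + K * ?s s) \<le> 1 * (?o + K * ?s s)"
        using e K osc_nonneg[of n "V T"] T by (intro mult_right_mono) auto
      ultimately have "?E * ?a - (?o + K * ?s s) \<le> ?E * ?I" by (simp add: algebra_simps)
      from mult_left_mono[OF this t0]
      have "?t * (?E * ?a - ?o) - K * (?t * ?s s) \<le> (?E * ?t) * ?I" by (simp add: algebra_simps)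
      also have "\<dots> \<le> weight T n T s * ?I"
      proof (rule mult_right_mono)
        show "?E * ?t \<le> weight T n T s" using T elim by (intro weight_ge) auto
        show "0 \<le> ?I" unfolding slice_dist_def
          by (intro Bochner_Integration.integral_nonneg mult_nonneg_nonneg abs_ge_zero kern_nonneg)
      qed
      finally show ?case by simp
    qed
  qed (measurable, intro bdd_fun_intros, measurable, intro bdd_fun_intros bdd_fun_slice_dist)
  moreover have "(\<integral>s. tkern T n T s * (?E * ?a - ?o) - K * (tkern T n T s * ?s s) \<partial>N)
      = 1 / 2 * (?E * ?a - ?o) - K * (\<integral>s. tkern T n T s * ?s s \<partial>N)"
    using i integral_tkern_half[OF T, of T n] by simp
  moreover have "K * (\<integral>s. tkern T n T s * ?s s \<partial>N) \<le> K / (2 * real n + 2)"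
    using mult_left_mono[OF integral_tkern_le(2)[OF T, of T n] K] T by simp
  moreover have "1 / 2 * ?o \<le> ?o" using e osc_nonneg[of n "V T"] by simp
  ultimately have "1 / 2 * (?E * ?a - ?o) - K / (2 * real n + 2) \<le> boundary n T" by linarith
  moreover have "1 / 2 * (?E * ?a - ?o) = 1 / 2 * (?E * ?a) - 1 / 2 * ?o" by (simp add: diff_divide_distrib)
  ultimately show ?thesis using \<open>1 / 2 * ?o \<le> ?o\<close> by linarith
qed

text \<open>
  For fixed \<open>\<epsilon>\<close> the error terms tend to a multiple of \<open>\<epsilon>\<close> as the kernels concentrate; the four boundary
  terms, each with a factor \<open>1/2\<close>, make up the two sides.
\<close>

theorem L1_contraction:
  "exp (- (2 * T)) * L1_dist (U T) (V T) \<le> L1_dist (U 0) (V 0)"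
proof -
  interpret sw: kruzkov_pair T f C B V U H G by (rule swapped)
  let ?l = "exp (- (2 * T)) * L1_dist (U T) (V T)" and ?r = "L1_dist (U 0) (V 0)"
  have osc0: "(\<lambda>m. osc (Suc m) (U t)) \<longlonglongrightarrow> 0" "(\<lambda>m. osc (Suc m) (V t)) \<longlonglongrightarrow> 0" for t
    using osc_tendsto_0[of "U t"] osc_tendsto_0[of "V t"] bdd_funI[of "U t", OF U_le] bdd_funI[of "V t", OF V_le]
      LIMSEQ_Suc slice_measurable by blast+
  have eps: "?l \<le> ?r + (4 * T + 4) * \<epsilon>" if "0 < \<epsilon>" for \<epsilon>
  proof -
    obtain K where K: "modulus \<epsilon> K" using modulus_exists[OF \<open>0 < \<epsilon>\<close>] by blast
    obtain L where L: "sw.modulus \<epsilon> L" using sw.modulus_exists[OF \<open>0 < \<epsilon>\<close>] by blast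
    let ?err = "\<lambda>m. (\<integral>t. interior_error m t \<partial>N) + (4 * \<epsilon> + 4 * K / (2 * real (Suc m) + 2)) * T
        + (osc (Suc m) (V 0) + \<epsilon> + K / (2 * real (Suc m) + 2)) + (osc (Suc m) (V T) + \<epsilon> + K / (2 * real (Suc m) + 2))
        + (osc (Suc m) (U 0) + \<epsilon> + L / (2 * real (Suc m) + 2)) + (osc (Suc m) (U T) + \<epsilon> + L / (2 * real (Suc m) + 2))"
    have main: "?l \<le> ?r + ?err m" for m
      using doubled_entropy[of "Suc m"] interior_le[OF K, of m]
        boundary_initial_le[OF K, of "Suc m"] boundary_final_ge[OF K, of "Suc m"]
        sw.boundary_initial_le[OF L, of "Suc m"] sw.boundary_final_ge[OF L, of "Suc m"]
      unfolding L1_dist_commute[of "V _" "U _"] by linarith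
    have c0: "(\<lambda>m. c / (2 * real (Suc m) + 2)) \<longlonglongrightarrow> 0" for c :: real
      by real_asymp
    have "(\<lambda>m. ?r + ?err m) \<longlonglongrightarrow> ?r + (0 + (4 * \<epsilon> + 0) * T + (0 + \<epsilon> + 0) + (0 + \<epsilon> + 0) + (0 + \<epsilon> + 0) + (0 + \<epsilon> + 0))"
      by (intro tendsto_intros osc0 integral_interior_error_tendsto_0 c0)
    then have "?l \<le> ?r + (0 + (4 * \<epsilon> + 0) * T + (0 + \<epsilon> + 0) + (0 + \<epsilon> + 0) + (0 + \<epsilon> + 0) + (0 + \<epsilon> + 0))"
      by (rule LIMSEQ_le_const) (use main in blast)
    then show ?thesis by (simp add: algebra_simps)
  qed
  show ?thesis
  proof (rule field_le_epsilon)
    fix e :: real assume "0 < e"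
    then show "?l \<le> ?r + e" using eps[of "e / (4 * T + 4)"] T by simp
  qed
qed

end

section \<open>Lebesgue integrals through Borel functions\<close>

text \<open>
  In a completed measure every subset of a null set is measurable.
\<close>

lemma measurable_completion_cong_AE:
  fixes g h :: "'a \<Rightarrow> real"
  assumes g [measurable]: "g \<in> borel_measurable (completion M)" and eq: "AE x in M. h x = g x"
  shows "h \<in> borel_measurable (completion M)"
proof (rule measurableI)
  fix A :: "real set" assume [measurable]: "A \<in> sets borel"
  have [measurable]: "Measurable.pred (completion M) (\<lambda>x. h x \<noteq> g x)"
    "Measurable.pred (completion M) (\<lambda>x. h x \<in> A \<and> h x \<noteq> g x)"
    by (intro sets_completion_AE; use eq in eventually_elim; simp)+
  have "Measurable.pred (completion M) (\<lambda>x. (g x \<in> A \<and> \<not> h x \<noteq> g x) \<or> (h x \<in> A \<and> h x \<noteq> g x))"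
    by measurable
  also have "(\<lambda>x. (g x \<in> A \<and> \<not> h x \<noteq> g x) \<or> (h x \<in> A \<and> h x \<noteq> g x)) = (\<lambda>x. h x \<in> A)" by auto
  finally show "h -` A \<inter> space (completion M) \<in> sets (completion M)"
    by (simp add: pred_def vimage_def Int_def conj_commute)
qed simp

lemma integral_lebesgue_cong:
  fixes g h :: "'a :: euclidean_space \<Rightarrow> real"
  assumes "g \<in> borel_measurable lborel" "AE x in lborel. h x = g x"
  shows "(\<integral>x. h x \<partial>lebesgue) = (\<integral>x. g x \<partial>lborel)"
proof -
  have g: "g \<in> borel_measurable lebesgue" using assms(1) by (rule measurable_completion)
  have "(\<integral>x. h x \<partial>lebesgue) = (\<integral>x. g x \<partial>lebesgue)"
    by (rule integral_cong_AE[OF measurable_completion_cong_AE[OF g assms(2)] g AE_completion[OF assms(2)]])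
  also have "\<dots> = (\<integral>x. g x \<partial>lborel)" using assms(1) by (rule integral_completion)
  finally show ?thesis .
qed

lemma set_integral_lebesgue_eq_leb:
  fixes g h :: "real \<Rightarrow> real"
  assumes [measurable]: "g \<in> borel_measurable borel"
    and eq: "AE x in lborel. indicator S x * h x = indicator {a..b} x * g x"
  shows "(LINT x:S|lebesgue. h x) = (\<integral>x. g x \<partial>leb {a..b})"
proof -
  have "(LINT x:S|lebesgue. h x) = (\<integral>x. indicator {a..b} x * g x \<partial>lborel)"
    unfolding set_lebesgue_integral_def
  proof (rule integral_lebesgue_cong)
    show "AE x in lborel. indicator S x *\<^sub>R h x = indicator {a..b} x * g x"
      using eq by simp
  qed measurable
  also have "\<dots> = (\<integral>x. g x \<partial>leb {a..b})" by (subst integral_leb) (simp_all add: mult.commute)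
  finally show ?thesis .
qed

lemma AE_lborel_not_endpoint: "AE x in lborel. x \<noteq> (a::real) \<and> x \<noteq> b"
  using AE_lborel_singleton[of a] AE_lborel_singleton[of b] by eventually_elim simp

lemma L1_norm_eq_leb:
  assumes "g \<in> borel_measurable borel" "AE x in lborel. x \<in> {0<..<1} \<longrightarrow> h x = g x"
  shows "L1_norm h = (\<integral>x. \<bar>g x\<bar> \<partial>leb {0..1})"
  unfolding L1_norm_def
proof (rule set_integral_lebesgue_eq_leb)
  show "AE x in lborel. indicator {0<..<1} x * \<bar>h x\<bar> = indicator {0..1} x * \<bar>g x\<bar>"
    using assms(2) AE_lborel_not_endpoint[of 0 1] by eventually_elim (auto simp: indicator_def)
qed (use assms(1) in measurable)

lemma leb_pair: "leb {a..b} \<Otimes>\<^sub>M leb {c..d} = density lborel (indicator ({a..b} \<times> {c..d}))"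
proof -
  have "sigma_finite_measure (density lborel (indicator {c..d} :: real \<Rightarrow> ennreal))"
    using finite_measure_leb[of c d] unfolding leb_def by (rule finite_measure.axioms(1))
  then have "leb {a..b} \<Otimes>\<^sub>M leb {c..d} = density (lborel \<Otimes>\<^sub>M lborel) (\<lambda>(x, y). indicator {a..b} x * indicator {c..d} y)"
    unfolding leb_def by (intro pair_measure_density) (auto intro: lborel.sigma_finite_measure_axioms)
  also have "(\<lambda>(x, y). indicator {a..b} x * indicator {c..d} y) = (indicator ({a..b} \<times> {c..d}) :: _ \<Rightarrow> ennreal)"
    by (auto simp: indicator_def fun_eq_iff)
  finally show ?thesis by (simp add: lborel_prod)
qed

lemma set_integral_lebesgue_PiT:
  fixes g h :: "real \<times> real \<Rightarrow> real"
  assumes [measurable]: "g \<in> borel_measurable (borel \<Otimes>\<^sub>M borel)" and "bdd_fun g"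
    and eq: "AE p in lborel. p \<in> PiT T \<longrightarrow> h p = g p"
  shows "(LINT p:PiT T|lebesgue. h p) = (\<integral>t. (\<integral>x. g (t, x) \<partial>leb {0..1}) \<partial>leb {0..T})"
proof -
  have [measurable]: "g \<in> borel_measurable borel" using assms(1) by (simp add: borel_prod)
  have S [measurable]: "PiT T \<in> sets borel"
    unfolding PiT_def by (intro borel_closed closed_Times) auto
  have "(LINT p:PiT T|lebesgue. h p) = (\<integral>p. indicator (PiT T) p * g p \<partial>lborel)"
    unfolding set_lebesgue_integral_def
  proof (rule integral_lebesgue_cong)
    show "AE x in lborel. indicator (PiT T) x *\<^sub>R h x = indicator (PiT T) x * g x"
      using eq by eventually_elim (auto simp: indicator_def)
  qed measurable
  also have "\<dots> = (\<integral>p. g p \<partial>density lborel (indicator (PiT T)))"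
    using integral_density[of g lborel "indicator (PiT T)"] by (simp add: ennreal_indicator)
  also have "\<dots> = (\<integral>p. g p \<partial>(leb {0..T} \<Otimes>\<^sub>M leb {0..1}))"
    unfolding leb_pair PiT_def ..
  also have "\<dots> = (\<integral>t. (\<integral>x. g (t, x) \<partial>leb {0..1}) \<partial>leb {0..T})"
    by (rule integral_leb_pair) fact+
  finally show ?thesis .
qed

lemma AE_lborel_in_interval:
  assumes "AE t in lborel. P t" "a < (b :: real)"
  shows "\<exists>t\<in>{a<..<b}. P t"
proof (rule ccontr)
  assume "\<not> ?thesis"
  then have "AE t in lborel. t \<notin> {a<..<b}" using assms(1) by (auto elim!: eventually_mono)
  then have "{a<..<b} \<in> null_sets lborel" by (subst (asm) AE_iff_null_sets[symmetric]) auto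
  then show False using assms(2) by (auto simp: null_sets_def)
qed

section \<open>Test functions\<close>

text \<open>
  Closed under derivatives and containing the factors of the test functions; this is all that
  smoothness of a product \<open>a(t) b(x)\<close> requires.
\<close>

inductive_set elementary :: "(real \<Rightarrow> real) set" where
  const: "(\<lambda>x. c) \<in> elementary"
| sin: "(\<lambda>x. sin (a * x + b)) \<in> elementary"
| cos: "(\<lambda>x. cos (a * x + b)) \<in> elementary"
| exp: "(\<lambda>x. exp (a * x + b)) \<in> elementary"
| add: "g \<in> elementary \<Longrightarrow> h \<in> elementary \<Longrightarrow> (\<lambda>x. g x + h x) \<in> elementary"
| mult: "g \<in> elementary \<Longrightarrow> h \<in> elementary \<Longrightarrow> (\<lambda>x. g x * h x) \<in> elementary"

lemma elementary_has_derivative: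
  "g \<in> elementary \<Longrightarrow> \<exists>g'\<in>elementary. \<forall>x. (g has_real_derivative g' x) (at x)"
proof (induction rule: elementary.induct)
  case (const c)
  show ?case by (rule bexI[OF _ elementary.const[of 0]]) simp
next
  case (sin a b)
  show ?case
    by (rule bexI[OF _ elementary.mult[OF elementary.cos[of a b] elementary.const[of a]]])
       (auto intro!: derivative_eq_intros)
next
  case (cos a b)
  show ?case
    by (rule bexI[OF _ elementary.mult[OF elementary.sin[of a b] elementary.const[of "- a"]]])
       (auto intro!: derivative_eq_intros)
next
  case (exp a b)
  show ?case
    by (rule bexI[OF _ elementary.mult[OF elementary.exp[of a b] elementary.const[of a]]])
       (auto intro!: derivative_eq_intros)
next
  case (add g h)
  then obtain g' h' where "g' \<in> elementary" "h' \<in> elementary"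
    "\<forall>x. (g has_real_derivative g' x) (at x)" "\<forall>x. (h has_real_derivative h' x) (at x)" by blast
  then show ?case
    by (intro bexI[OF _ elementary.add[of g' h']]) (auto intro: DERIV_add)
next
  case (mult g h)
  then obtain g' h' where "g' \<in> elementary" "h' \<in> elementary"
    and D: "\<And>x. (g has_real_derivative g' x) (at x)" "\<And>x. (h has_real_derivative h' x) (at x)" by blast
  then have "(\<lambda>x. g' x * h x + h' x * g x) \<in> elementary"
    using mult.hyps by (intro elementary.add elementary.mult)
  moreover have "((\<lambda>x. g x * h x) has_real_derivative g' x * h x + h' x * g x) (at x)" for x
    by (rule DERIV_mult[OF D])
  ultimately show ?case by (intro bexI[of _ "\<lambda>x. g' x * h x + h' x * g x"] allI)
qed

lemma Ck_elementary_mult: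
  "a \<in> elementary \<Longrightarrow> b \<in> elementary \<Longrightarrow> Ck n (\<lambda>t x. a t * b x)"
proof (induction n arbitrary: a b)
  have cont: "continuous_on UNIV (\<lambda>(t, x). a t * b x)" if "a \<in> elementary" "b \<in> elementary" for a b :: "real \<Rightarrow> real"
  proof -
    have "continuous_on UNIV a" "continuous_on UNIV b"
      using that elementary_has_derivative DERIV_continuous_on has_field_derivative_at_within by metis+
    then show ?thesis
      unfolding case_prod_unfold
      by (intro continuous_on_mult) (auto intro: continuous_on_compose2[OF _ continuous_on_fst[OF continuous_on_id]]
         continuous_on_compose2[OF _ continuous_on_snd[OF continuous_on_id]])
  qed
  {
    case 0
    then show ?case using cont by simp
  next
    case (Suc n)
    obtain a' b' where ab: "a' \<in> elementary" "b' \<in> elementary"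
      and D: "\<And>x. (a has_real_derivative a' x) (at x)" "\<And>x. (b has_real_derivative b' x) (at x)"
      using Suc.prems elementary_has_derivative by metis
    have D1: "((\<lambda>t. a t * b x) has_real_derivative a' t * b x) (at t)"
      and D2: "((\<lambda>x. a t * b x) has_real_derivative a t * b' x) (at x)" for t x
      using DERIV_cmult_right[OF D(1)] DERIV_cmult[OF D(2)] by blast+
    have "partial1 (\<lambda>t x. a t * b x) = (\<lambda>t x. a' t * b x)" "partial2 (\<lambda>t x. a t * b x) = (\<lambda>t x. a t * b' x)"
      unfolding partial1_def partial2_def using DERIV_imp_deriv[OF D1] DERIV_imp_deriv[OF D2] by blast+
    moreover have "(\<lambda>s. a s * b x) differentiable at t" "(\<lambda>s. a t * b s) differentiable at x" for t x
      using D1 D2 real_differentiable_def by blast+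
    ultimately show ?case using Suc ab cont[OF Suc.prems] by simp
  }
qed

lemma elementary_power: "g \<in> elementary \<Longrightarrow> (\<lambda>x. g x ^ n) \<in> elementary"
  by (induction n) (simp_all add: elementary.const elementary.mult)

lemma elementary_kern: "(\<lambda>x. kern n (a * x + b)) \<in> elementary"
proof -
  have "(\<lambda>x. cos ((pi * a) * x + pi * b) ^ (2 * n) * (1 / cos_mass n)) \<in> elementary"
    by (intro elementary.mult elementary_power elementary.cos elementary.const)
  then show ?thesis by (simp add: kern_def algebra_simps)
qed

text \<open>
  The test function as a product of a function of \<open>t\<close> and a function of \<open>x\<close>, smooth on the whole
  plane; for \<open>t \<ge> 0\<close> it coincides with the weight times the kernel.
\<close>

definition test_fun :: "real \<Rightarrow> nat \<Rightarrow> real \<Rightarrow> real \<Rightarrow> real \<Rightarrow> real \<Rightarrow> real" where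
  "test_fun T n s y t x = (tkern T n t s * (exp (- t) * exp (- \<bar>s\<bar>))) * kern n (x - y)"

lemma test_function_test_fun:
  assumes "0 < T"
  shows "test_function (test_fun T n s y)"
proof -
  have "(\<lambda>t. kern n (1 / (2 * T) * t + - s / (2 * T)) * (1 / (2 * T)) * (exp (-1 * t + 0) * exp (- \<bar>s\<bar>))) \<in> elementary"
    by (intro elementary.mult elementary_kern elementary.exp elementary.const)
  also have "(\<lambda>t. kern n (1 / (2 * T) * t + - s / (2 * T)) * (1 / (2 * T)) * (exp (-1 * t + 0) * exp (- \<bar>s\<bar>)))
      = (\<lambda>t. tkern T n t s * (exp (- t) * exp (- \<bar>s\<bar>)))"
    by (simp add: tkern_def diff_divide_distrib)
  finally have a: "(\<lambda>t. tkern T n t s * (exp (- t) * exp (- \<bar>s\<bar>))) \<in> elementary" .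
  have b: "(\<lambda>x. kern n (x - y)) \<in> elementary"
    using elementary_kern[of n 1 "- y"] by simp
  have "smooth (test_fun T n s y)"
    unfolding smooth_def test_fun_def[abs_def] using Ck_elementary_mult[OF a b] by blast
  moreover have "kern n (x + 1 - y) = kern n (x - y)" for x
  proof -
    have "cos (pi * (x + 1 - y)) = - cos (pi * (x - y))"
      using cos_periodic_pi[of "pi * (x - y)"] by (simp add: algebra_simps)
    then show ?thesis by (simp add: kern_def)
  qed
  ultimately show ?thesis
    using assms unfolding test_function_def by (simp add: test_fun_def kern_nonneg tkern_nonneg)
qed

lemma test_fun_eq: "0 \<le> t \<Longrightarrow> test_fun T n s y t x = weight T n t s * kern n (x - y)"
  by (simp add: test_fun_def weight_def)

lemma partial1_test_fun:
  assumes "0 < T" "0 \<le> t"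
  shows "partial1 (test_fun T n s y) t x = dweight T n t s * kern n (x - y)"
proof -
  have "((\<lambda>t. kern n ((t - s) / (2 * T))) has_real_derivative dkern n ((t - s) / (2 * T)) * (1 / (2 * T))) (at t)"
    by (rule DERIV_chain2[where f = "kern n", OF DERIV_kern]) (use assms in \<open>auto intro!: derivative_eq_intros\<close>)
  note k = DERIV_cdivide[OF this, of "2 * T"]
  have e: "((\<lambda>t. exp (- t) * exp (- \<bar>s\<bar>)) has_real_derivative - exp (- t) * exp (- \<bar>s\<bar>)) (at t)"
    by (auto intro!: derivative_eq_intros)
  have "((\<lambda>t. test_fun T n s y t x) has_real_derivative
     (dkern n ((t - s) / (2 * T)) * (1 / (2 * T)) / (2 * T) * (exp (- t) * exp (- \<bar>s\<bar>))
       + - exp (- t) * exp (- \<bar>s\<bar>) * (kern n ((t - s) / (2 * T)) / (2 * T))) * kern n (x - y)) (at t)"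
    unfolding test_fun_def tkern_def by (rule DERIV_cmult_right[OF DERIV_mult[OF k e]])
  then have "partial1 (test_fun T n s y) t x = (dkern n ((t - s) / (2 * T)) * (1 / (2 * T)) / (2 * T) * (exp (- t) * exp (- \<bar>s\<bar>))
       + - exp (- t) * exp (- \<bar>s\<bar>) * (kern n ((t - s) / (2 * T)) / (2 * T))) * kern n (x - y)"
    unfolding partial1_def by (rule DERIV_imp_deriv)
  also have "\<dots> = dweight T n t s * kern n (x - y)"
    using assms(2) by (simp add: dweight_def tkern_def algebra_simps power2_eq_square)
  finally show ?thesis .
qed

lemma partial2_test_fun:
  assumes "0 \<le> t"
  shows "partial2 (test_fun T n s y) t x = weight T n t s * dkern n (x - y)"
proof -
  have "((\<lambda>x. kern n (x - y)) has_real_derivative dkern n (x - y) * 1) (at x)"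
    by (rule DERIV_chain2[where f = "kern n", OF DERIV_kern]) (auto intro!: derivative_eq_intros)
  from DERIV_cmult[OF this, of "tkern T n t s * (exp (- t) * exp (- \<bar>s\<bar>))"]
  show ?thesis
    unfolding partial2_def test_fun_def using assms by (simp add: DERIV_imp_deriv weight_def)
qed

section \<open>Borel representatives of entropy solutions\<close>

lemma L1_norm_triangle:
  assumes "set_integrable lebesgue {0<..<1} a" "set_integrable lebesgue {0<..<1} b" "set_integrable lebesgue {0<..<1} c"
  shows "L1_norm (\<lambda>x. a x - c x) \<le> L1_norm (\<lambda>x. a x - b x) + L1_norm (\<lambda>x. b x - c x)"
proof -
  have i: "set_integrable lebesgue {0<..<1} (\<lambda>x. \<bar>a x - b x\<bar>)" "set_integrable lebesgue {0<..<1} (\<lambda>x. \<bar>b x - c x\<bar>)"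
    "set_integrable lebesgue {0<..<1} (\<lambda>x. \<bar>a x - c x\<bar>)"
    by (intro set_integrable_abs set_integral_diff(1) assms)+
  have "L1_norm (\<lambda>x. a x - c x) \<le> (LINT x:{0<..<1}|lebesgue. \<bar>a x - b x\<bar> + \<bar>b x - c x\<bar>)"
    unfolding L1_norm_def by (rule set_integral_mono[OF i(3) set_integral_add(1)[OF i(1,2)]]) simp
  also have "\<dots> = L1_norm (\<lambda>x. a x - b x) + L1_norm (\<lambda>x. b x - c x)"
    unfolding L1_norm_def by (rule set_integral_add(2)[OF i(1,2)])
  finally show ?thesis .
qed

lemma L1_norm_commute: "L1_norm (\<lambda>x. a x - b x) = L1_norm (\<lambda>x. b x - a x)"
  unfolding L1_norm_def by (simp add: abs_minus_commute)

lemma integrable_slice_representative: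
  fixes w :: "real \<Rightarrow> real"
  assumes "set_integrable lebesgue {0<..<1} w"
  shows "\<exists>g. g \<in> borel_measurable borel \<and> (AE x in lborel. x \<in> {0<..<1} \<longrightarrow> w x = g x) \<and> integrable (leb {0..1}) g"
proof -
  let ?w = "\<lambda>x. indicator {0<..<1} x * w x"
  have w: "integrable lebesgue ?w" using assms unfolding set_integrable_def by simp
  then have "?w \<in> borel_measurable lebesgue" by (rule borel_measurable_integrable)
  then obtain g where g: "g \<in> borel_measurable lborel" and eq: "AE x in lborel. ?w x = g x"
    using completion_ex_borel_measurable_real by blast
  have gl: "g \<in> borel_measurable lebesgue" using g by (rule measurable_completion)
  have "integrable lebesgue g"
    using w integrable_cong_AE[of ?w lebesgue g] gl AE_completion[OF eq] borel_measurable_integrable[OF w] by blast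
  then have gi: "integrable lborel g" using integrable_completion[OF g] by simp
  have gb: "g \<in> borel_measurable borel" using g by simp
  have "integrable lborel (\<lambda>x. indicator {0..1} x *\<^sub>R g x)"
    by (rule integrable_mult_indicator) (use gi in auto)
  then have "integrable (leb {0..1}) g"
    using integrable_density[of g lborel "indicator {0..1}"] g by (simp add: leb_def ennreal_indicator)
  moreover have "AE x in lborel. x \<in> {0<..<1} \<longrightarrow> w x = g x"
    using eq by eventually_elim (auto simp: indicator_def)
  ultimately show ?thesis using gb by blast
qed

lemma AE_fst:
  assumes "AE t in lborel. Q (t :: real)"
  shows "AE p in (lborel :: (real \<times> real) measure). Q (fst p)"
proof -
  obtain Z where Z: "Z \<in> null_sets lborel" "{t. \<not> Q t} \<subseteq> Z"
    using assms by (auto simp: eventually_ae_filter)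
  have [measurable]: "Z \<in> sets borel" using Z(1) by (auto simp: null_sets_def)
  have "AE p in lborel \<Otimes>\<^sub>M lborel. fst (p :: real \<times> real) \<notin> Z"
  proof (rule lborel_pair.AE_pair_measure)
    show "AE x in lborel. AE y in lborel. fst (x, y :: real) \<notin> Z"
      using AE_not_in[OF Z(1)] by eventually_elim simp
  qed measurable
  then show ?thesis unfolding lborel_prod by eventually_elim (use Z(2) in auto)
qed

lemma nonlocal_P_eq_source:
  assumes [measurable]: "w \<in> borel_measurable borel" and eq: "AE y in lborel. y \<in> {0<..<1} \<longrightarrow> u t y = w y"
    and x: "x \<in> {0..1}"
  shows "nonlocal_P u t x = source w x"
proof -
  have 1: "(LINT y:{0..x}|lebesgue. u t y) = (\<integral>y. (if y \<le> x then w y else 0) \<partial>leb {0..1})" if "x \<in> {0..1}" for x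
  proof (rule set_integral_lebesgue_eq_leb)
    show "AE y in lborel. indicator {0..x} y * u t y = indicator {0..1} y * (if y \<le> x then w y else 0)"
      using eq AE_lborel_not_endpoint[of 0 1] by eventually_elim (use that in \<open>auto simp: indicator_def\<close>)
  qed measurable
  have "(LINT y:{0..1}|lebesgue. (LINT z:{0..y}|lebesgue. u t z)) =
    (\<integral>y. (\<integral>z. (if z \<le> y then w z else 0) \<partial>leb {0..1}) \<partial>leb {0..1})"
  proof (rule set_integral_lebesgue_eq_leb)
    show "AE y in lborel. indicator {0..1} y * (LINT z:{0..y}|lebesgue. u t z) =
       indicator {0..1} y * (\<integral>z. (if z \<le> y then w z else 0) \<partial>leb {0..1})"
      using 1 by (intro AE_I2) (auto simp: indicator_def)
  qed measurable
  with 1[OF x] show ?thesis unfolding nonlocal_P_def source_def by simp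
qed

lemma continuous_L1D:
  assumes "continuous_L1 T u" "t \<in> {0..T}" "0 < \<epsilon>"
  shows "\<exists>d>0. \<forall>s\<in>{0..T}. \<bar>s - t\<bar> < d \<longrightarrow> L1_norm (\<lambda>x. u s x - u t x) < \<epsilon>"
proof -
  have "((\<lambda>s. L1_norm (\<lambda>x. u s x - u t x)) \<longlongrightarrow> 0) (at t within {0..T})"
    using assms(1,2) unfolding continuous_L1_def by blast
  from tendstoD[OF this assms(3)]
  obtain d where d: "d > 0" "\<And>s. s \<in> {0..T} \<Longrightarrow> s \<noteq> t \<Longrightarrow> dist s t < d \<Longrightarrow> dist (L1_norm (\<lambda>x. u s x - u t x)) 0 < \<epsilon>"
    unfolding eventually_at by blast
  have "L1_norm (\<lambda>x. u s x - u t x) < \<epsilon>" if "s \<in> {0..T}" "\<bar>s - t\<bar> < d" for s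
  proof (cases "s = t")
    case True
    then show ?thesis using assms(3) by (simp add: L1_norm_def set_lebesgue_integral_def)
  next
    case False
    then show ?thesis using d(2)[of s] that by (simp add: dist_real_def)
  qed
  with d(1) show ?thesis by blast
qed

text \<open>
  The distance of two slices is a continuous function on the square of times and vanishes on the
  diagonal, where alone the squared sine is zero.
\<close>

lemma continuous_L1_modulus:
  assumes u: "continuous_L1 T u" and T: "0 < T" and \<epsilon>: "0 < \<epsilon>"
  shows "\<exists>K\<ge>0. \<forall>t\<in>{0..T}. \<forall>s\<in>{0..T}.
    L1_norm (\<lambda>x. u t x - u s x) \<le> \<epsilon> + K * sin (pi * ((t - s) / (2 * T))) ^ 2"
proof -
  let ?X = "{0..T} \<times> {0..T}"
  define D where "D p = L1_norm (\<lambda>x. u (fst p) x - u (snd p) x)" for p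
  have int: "set_integrable lebesgue {0<..<1} (u t)" if "t \<in> {0..T}" for t
    using u that unfolding continuous_L1_def by blast
  have D_le: "D p \<le> D (fst p, fst q) + D q + D (snd p, snd q)" if "p \<in> ?X" "q \<in> ?X" for p q
  proof -
    have pq: "fst p \<in> {0..T}" "snd p \<in> {0..T}" "fst q \<in> {0..T}" "snd q \<in> {0..T}" using that by auto
    have "D p \<le> D (fst p, fst q) + D (fst q, snd p)"
      using L1_norm_triangle[OF int[OF pq(1)] int[OF pq(3)] int[OF pq(2)]] by (simp add: D_def)
    also have "D (fst q, snd p) \<le> D q + D (snd q, snd p)"
      using L1_norm_triangle[OF int[OF pq(3)] int[OF pq(4)] int[OF pq(2)]] by (simp add: D_def)
    also have "D (snd q, snd p) = D (snd p, snd q)" unfolding D_def fst_conv snd_conv by (rule L1_norm_commute)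
    finally show ?thesis by simp
  qed
  have D_sym: "D (s, t) = D (t, s)" for s t unfolding D_def fst_conv snd_conv by (rule L1_norm_commute)
  have cont: "continuous_on ?X D"
    unfolding continuous_on_iff
  proof (intro ballI allI impI)
    fix q :: "real \<times> real" and e :: real assume q: "q \<in> ?X" and e: "0 < e"
    obtain d1 where d1: "d1 > 0" "\<And>s. s \<in> {0..T} \<Longrightarrow> \<bar>s - fst q\<bar> < d1 \<Longrightarrow> D (s, fst q) < e / 2"
      using continuous_L1D[OF u, of "fst q" "e / 2"] q e unfolding D_def by auto
    obtain d2 where d2: "d2 > 0" "\<And>s. s \<in> {0..T} \<Longrightarrow> \<bar>s - snd q\<bar> < d2 \<Longrightarrow> D (s, snd q) < e / 2"
      using continuous_L1D[OF u, of "snd q" "e / 2"] q e unfolding D_def by auto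
    show "\<exists>d>0. \<forall>p\<in>?X. dist p q < d \<longrightarrow> dist (D p) (D q) < e"
    proof (intro exI[of _ "min d1 d2"] conjI ballI impI)
      fix p assume p: "p \<in> ?X" "dist p q < min d1 d2"
      have "D (fst p, fst q) < e / 2"
        using d1(2)[of "fst p"] p dist_fst_le[of p q] by (auto simp: dist_real_def)
      moreover have "D (snd p, snd q) < e / 2"
        using d2(2)[of "snd p"] p dist_snd_le[of p q] by (auto simp: dist_real_def)
      ultimately show "dist (D p) (D q) < e"
        using D_le[OF p(1) q] D_le[OF q p(1)] D_sym[of "fst q" "fst p"] D_sym[of "snd q" "snd p"]
        by (simp add: dist_real_def abs_less_iff)
    qed (use d1 d2 in auto)
  qed
  have "\<exists>K\<ge>0. \<forall>p\<in>?X. D p \<le> \<epsilon> + K * sin (pi * ((fst p - snd p) / (2 * T))) ^ 2"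
  proof (rule bound_by_small_plus_multiple[OF _ cont _ _ _ \<epsilon>])
    show "continuous_on ?X (\<lambda>p. sin (pi * ((fst p - snd p) / (2 * T))) ^ 2)"
      using T by (intro continuous_on_power continuous_on_sin continuous_on_mult continuous_on_divide continuous_on_diff
        continuous_on_fst continuous_on_snd continuous_on_const continuous_on_id) auto
    fix p assume p: "p \<in> ?X" and "sin (pi * ((fst p - snd p) / (2 * T))) ^ 2 = 0"
    then have s0: "sin (pi * ((fst p - snd p) / (2 * T))) = 0" by simp
    have "\<bar>fst p - snd p\<bar> \<le> T" using p by auto
    then have "\<bar>(fst p - snd p) / (2 * T)\<bar> \<le> 1 / 2" using T by (simp add: field_simps)
    from abs_le_abs_sin_pi[OF this] have "\<bar>(fst p - snd p) / (2 * T)\<bar> \<le> 0" unfolding s0 by simp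
    then have "(fst p - snd p) / (2 * T) = 0" by (simp only: abs_le_zero_iff)
    then have "fst p = snd p" using T by simp
    then show "D p \<le> 0" by (simp add: D_def L1_norm_def set_lebesgue_integral_def)
  qed (auto intro: compact_Times)
  then show ?thesis by (force simp: D_def)
qed

text \<open>
  An essential bound at almost all times passes to the end points, since the positive part of
  \<open>|g| - C\<close> is at most the distance to a nearby bounded slice.
\<close>

lemma slice_bound:
  assumes u: "continuous_L1 T u" and T: "0 < T" and \<tau>: "\<tau> = 0 \<or> \<tau> = T"
    and g [measurable]: "g \<in> borel_measurable borel" and gi: "integrable (leb {0..1}) g"
    and eq: "AE x in lborel. x \<in> {0<..<1} \<longrightarrow> u \<tau> x = g x"
    and W [measurable]: "case_prod W \<in> borel_measurable (borel \<Otimes>\<^sub>M borel)" and C: "\<And>t x. \<bar>W t x\<bar> \<le> C"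
    and W_eq: "AE t in lborel. t \<in> {0..T} \<longrightarrow> (AE x in lborel. x \<in> {0<..<1} \<longrightarrow> u t x = W t x)"
  shows "AE x in leb {0..1}. \<bar>g x\<bar> \<le> C"
proof -
  let ?q = "\<lambda>x. max 0 (\<bar>g x\<bar> - C)"
  have "0 \<le> C" using C[of 0 0] by linarith
  have qi: "integrable (leb {0..1}) ?q"
    by (rule Bochner_Integration.integrable_bound[OF gi]) (use \<open>0 \<le> C\<close> in \<open>auto intro!: AE_I2\<close>)
  have "(\<integral>x. ?q x \<partial>leb {0..1}) \<le> \<epsilon>" if "0 < \<epsilon>" for \<epsilon>
  proof -
    have "\<tau> \<in> {0..T}" using \<tau> T by auto
    from continuous_L1D[OF u this \<open>0 < \<epsilon>\<close>]
    obtain d where d: "0 < d" "\<And>s. s \<in> {0..T} \<Longrightarrow> \<bar>s - \<tau>\<bar> < d \<Longrightarrow> L1_norm (\<lambda>x. u s x - u \<tau> x) < \<epsilon>" by blast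
    \<comment> \<open>a one-sided neighbourhood of \<open>\<tau>\<close> in \<open>[0, T]\<close>; having positive length it contains a time with a bounded slice\<close>
    define a where "a = (if \<tau> = 0 then 0 else max 0 (T - d))"
    define b where "b = (if \<tau> = 0 then min d T else T)"
    have "a < b" using T d(1) \<tau> by (auto simp: a_def b_def)
    from AE_lborel_in_interval[OF W_eq this] obtain t where t: "a < t" "t < b"
      and te: "t \<in> {0..T} \<longrightarrow> (AE x in lborel. x \<in> {0<..<1} \<longrightarrow> u t x = W t x)" by (meson greaterThanLessThan_iff)
    have tT: "t \<in> {0..T}" "\<bar>t - \<tau>\<bar> < d" using t \<tau> T by (auto simp: a_def b_def split: if_splits)
    have Wt [measurable]: "W t \<in> borel_measurable borel" using W by (rule measurable_slice)
    have Wi: "integrable (leb {0..1}) (W t)" by (rule integrable_leb[OF Wt]) (rule bdd_funI, rule C)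
    have "(\<integral>x. ?q x \<partial>leb {0..1}) \<le> (\<integral>x. \<bar>W t x - g x\<bar> \<partial>leb {0..1})"
    proof (rule integral_mono[OF qi])
      show "integrable (leb {0..1}) (\<lambda>x. \<bar>W t x - g x\<bar>)" using Wi gi by simp
      show "?q x \<le> \<bar>W t x - g x\<bar>" for x using C[of t x] by linarith
    qed
    also have "\<dots> = L1_norm (\<lambda>x. u t x - u \<tau> x)"
    proof (rule L1_norm_eq_leb[symmetric])
      have "AE x in lborel. x \<in> {0<..<1} \<longrightarrow> u t x = W t x" using te tT(1) by blast
      then show "AE x in lborel. x \<in> {0<..<1} \<longrightarrow> u t x - u \<tau> x = W t x - g x"
        using eq by eventually_elim simp
    qed measurable
    also have "\<dots> < \<epsilon>" using d(2) tT by blast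
    finally show ?thesis by simp
  qed
  then have "(\<integral>x. ?q x \<partial>leb {0..1}) \<le> 0" by (rule field_le_epsilon[of _ 0, simplified])
  moreover have "0 \<le> (\<integral>x. ?q x \<partial>leb {0..1})" by (intro Bochner_Integration.integral_nonneg) simp
  ultimately have "(\<integral>x. ?q x \<partial>leb {0..1}) = 0" by linarith
  then have "AE x in leb {0..1}. ?q x = 0"
    using integral_nonneg_eq_0_iff_AE[OF qi] by simp
  then show ?thesis by eventually_elim linarith
qed

lemma end_slice_representative:
  assumes u: "continuous_L1 T u" and T: "0 < T" and \<tau>: "\<tau> = 0 \<or> \<tau> = T"
    and W: "case_prod W \<in> borel_measurable (borel \<Otimes>\<^sub>M borel)" and C: "\<And>t x. \<bar>W t x\<bar> \<le> C"
    and W_eq: "AE t in lborel. t \<in> {0..T} \<longrightarrow> (AE x in lborel. x \<in> {0<..<1} \<longrightarrow> u t x = W t x)"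
  shows "\<exists>g. g \<in> borel_measurable borel \<and> (\<forall>x. \<bar>g x\<bar> \<le> C) \<and> (AE x in lborel. x \<in> {0<..<1} \<longrightarrow> u \<tau> x = g x)"
proof -
  have "set_integrable lebesgue {0<..<1} (u \<tau>)" using u \<tau> T unfolding continuous_L1_def by force
  then obtain g where g [measurable]: "g \<in> borel_measurable borel" and eq: "AE x in lborel. x \<in> {0<..<1} \<longrightarrow> u \<tau> x = g x"
    and gi: "integrable (leb {0..1}) g" using integrable_slice_representative by blast
  have "0 \<le> C" using C[of 0 0] by linarith
  have "AE x in leb {0..1}. \<bar>g x\<bar> \<le> C" by (rule slice_bound[OF u T \<tau> g gi eq W C W_eq])
  then have "AE x in lborel. x \<in> {0..1} \<longrightarrow> \<bar>g x\<bar> \<le> C" by (simp add: AE_leb)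
  with eq have "AE x in lborel. x \<in> {0<..<1} \<longrightarrow> u \<tau> x = max (- C) (min C (g x))"
    by eventually_elim auto
  then show ?thesis
    using \<open>0 \<le> C\<close> by (intro exI[of _ "\<lambda>x. max (- C) (min C (g x))"]) (auto simp: abs_le_iff)
qed


lemma Linf_representative:
  assumes "Linf T u"
  shows "\<exists>W C. case_prod W \<in> borel_measurable (borel \<Otimes>\<^sub>M borel) \<and> (\<forall>t x. \<bar>W t x\<bar> \<le> C) \<and>
    (AE p in lborel. p \<in> PiT T \<longrightarrow> u (fst p) (snd p) = W (fst p) (snd p))"
proof -
  let ?w = "\<lambda>p. indicator (PiT T) p *\<^sub>R (case p of (t, x) \<Rightarrow> u t x)"
  have "?w \<in> borel_measurable lebesgue"
    using assms unfolding Linf_def set_borel_measurable_def by blast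
  then obtain g where g: "g \<in> borel_measurable lborel" and eq: "AE p in lborel. ?w p = g p"
    using completion_ex_borel_measurable_real by blast
  obtain C where "AE p in lebesgue. case p of (t, x) \<Rightarrow> (t, x) \<in> PiT T \<longrightarrow> \<bar>u t x\<bar> \<le> C"
    using assms unfolding Linf_def by blast
  then have C: "AE p in lborel. p \<in> PiT T \<longrightarrow> \<bar>u (fst p) (snd p)\<bar> \<le> C"
    unfolding AE_completion_iff by eventually_elim auto
  let ?C = "max 0 C"
  define W where "W t x = max (- ?C) (min ?C (g (t, x)))" for t x
  have "g \<in> borel_measurable (borel \<Otimes>\<^sub>M borel)" using g by (simp add: borel_prod)
  then have "case_prod W \<in> borel_measurable (borel \<Otimes>\<^sub>M borel)"
    unfolding W_def case_prod_unfold by measurable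
  moreover have "\<bar>W t x\<bar> \<le> ?C" for t x by (auto simp: W_def abs_le_iff)
  moreover have "AE p in lborel. p \<in> PiT T \<longrightarrow> u (fst p) (snd p) = W (fst p) (snd p)"
    using eq C by eventually_elim (auto simp: W_def split_beta)
  ultimately show ?thesis by blast
qed

text \<open>
  The representative of the function on the rectangle says nothing about the slices at \<open>0\<close> and \<open>T\<close>, so
  these are put in by hand; they occupy a null set of the rectangle.
\<close>

lemma borel_representative:
  assumes T: "0 < T" and u: "continuous_L1 T u" "Linf T u"
  obtains U C G where "case_prod U \<in> borel_measurable (borel \<Otimes>\<^sub>M borel)" "\<And>t x. \<bar>U t x\<bar> \<le> C"
    "G \<subseteq> {0..T}" "0 \<in> G" "T \<in> G" "AE t in lborel. t \<in> {0..T} \<longrightarrow> t \<in> G"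
    "\<And>t. t \<in> G \<Longrightarrow> AE x in lborel. x \<in> {0<..<1} \<longrightarrow> u t x = U t x"
    "AE p in lborel. p \<in> PiT T \<longrightarrow> u (fst p) (snd p) = U (fst p) (snd p)"
proof -
  obtain W C where W [measurable]: "case_prod W \<in> borel_measurable (borel \<Otimes>\<^sub>M borel)" and C: "\<And>t x. \<bar>W t x\<bar> \<le> C"
    and eq: "AE p in lborel. p \<in> PiT T \<longrightarrow> u (fst p) (snd p) = W (fst p) (snd p)"
    using Linf_representative[OF u(2)] by blast
  have "AE t in lborel. AE x in lborel. (t, x) \<in> PiT T \<longrightarrow> u t x = W t x"
  proof -
    have "AE p in lborel \<Otimes>\<^sub>M lborel. p \<in> PiT T \<longrightarrow> u (fst p) (snd p) = W (fst p) (snd p)"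
      using eq unfolding lborel_prod .
    from lborel_pair.AE_pair[OF this] show ?thesis by simp
  qed
  then have W_eq: "AE t in lborel. t \<in> {0..T} \<longrightarrow> (AE x in lborel. x \<in> {0<..<1} \<longrightarrow> u t x = W t x)"
  proof eventually_elim
    case (elim t)
    show ?case
    proof
      assume "t \<in> {0..T}"
      then show "AE x in lborel. x \<in> {0<..<1} \<longrightarrow> u t x = W t x"
        using elim by (auto simp: PiT_def elim!: eventually_mono)
    qed
  qed
  obtain g0 where g0 [measurable]: "g0 \<in> borel_measurable borel" and g0C: "\<And>x. \<bar>g0 x\<bar> \<le> C"
    and g0_eq: "AE x in lborel. x \<in> {0<..<1} \<longrightarrow> u 0 x = g0 x"
    using end_slice_representative[OF u(1) T _ W C W_eq, of 0] by blast
  obtain gT where gT [measurable]: "gT \<in> borel_measurable borel" and gTC: "\<And>x. \<bar>gT x\<bar> \<le> C"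
    and gT_eq: "AE x in lborel. x \<in> {0<..<1} \<longrightarrow> u T x = gT x"
    using end_slice_representative[OF u(1) T _ W C W_eq, of T] by blast
  define U where "U t x = (if t = 0 then g0 x else if t = T then gT x else W t x)" for t x
  define G where "G = {t \<in> {0..T}. AE x in lborel. x \<in> {0<..<1} \<longrightarrow> u t x = U t x}"
  show thesis
  proof (rule that[of U C G])
    show "case_prod U \<in> borel_measurable (borel \<Otimes>\<^sub>M borel)"
      unfolding U_def case_prod_unfold by measurable
    show "\<bar>U t x\<bar> \<le> C" for t x using C g0C gTC by (simp add: U_def)
    show "0 \<in> G" "T \<in> G" using g0_eq gT_eq T by (auto simp: G_def U_def)
    show "AE t in lborel. t \<in> {0..T} \<longrightarrow> t \<in> G"
      using W_eq AE_lborel_not_endpoint[of 0 T]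
      by eventually_elim (auto simp: G_def U_def)
    show "AE p in lborel. p \<in> PiT T \<longrightarrow> u (fst p) (snd p) = U (fst p) (snd p)"
      using eq AE_fst[OF AE_lborel_not_endpoint[of 0 T]] by eventually_elim (simp add: U_def)
    show "G \<subseteq> {0..T}" by (auto simp: G_def)
    show "AE x in lborel. x \<in> {0<..<1} \<longrightarrow> u t x = U t x" if "t \<in> G" for t using that by (simp add: G_def)
  qed
qed

lemma Ck_borel_measurable:
  assumes "Ck n g" shows "case_prod g \<in> borel_measurable (borel \<Otimes>\<^sub>M borel)"
proof -
  have "continuous_on UNIV (\<lambda>(a, b). g a b)" using assms by (cases n) auto
  then show ?thesis unfolding borel_prod by (rule borel_measurable_continuous_onI)
qed

text \<open>
  The bound \<open>C\<close> may be enlarged, which lets two solutions share one constant.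
\<close>

lemma kruzkov_representative:
  assumes T: "0 < T" and f: "Ck 2 f" and per: "\<And>x w. f (x + 1) w = f x w" and sol: "entropy_solution T f u0 u"
  shows "\<exists>U C G. (\<forall>C'\<ge>C. kruzkov_solution T f C' G U) \<and> (\<forall>t\<in>G. AE x in lborel. x \<in> {0<..<1} \<longrightarrow> u t x = U t x)"
proof -
  have u: "continuous_L1 T u" "Linf T u" using sol unfolding entropy_solution_def by blast+
  obtain U C G where U [measurable]: "case_prod U \<in> borel_measurable (borel \<Otimes>\<^sub>M borel)" and C: "\<And>t x. \<bar>U t x\<bar> \<le> C"
    and G: "G \<subseteq> {0..T}" "0 \<in> G" "T \<in> G" "AE t in lborel. t \<in> {0..T} \<longrightarrow> t \<in> G"
    and slice: "\<And>t. t \<in> G \<Longrightarrow> AE x in lborel. x \<in> {0<..<1} \<longrightarrow> u t x = U t x"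
    and eq: "AE p in lborel. p \<in> PiT T \<longrightarrow> u (fst p) (snd p) = U (fst p) (snd p)"
    by (rule borel_representative[OF T u]) (rule that; assumption)
  have Ut [measurable]: "U t \<in> borel_measurable borel" for t using U by (rule measurable_slice)
  have [measurable]: "case_prod f \<in> borel_measurable (borel \<Otimes>\<^sub>M borel)" using f by (rule Ck_borel_measurable)
  have [measurable]: "case_prod (partial1 f) \<in> borel_measurable (borel \<Otimes>\<^sub>M borel)"
    using f by (intro Ck_borel_measurable[of 1]) (simp add: numeral_2_eq_2)
  have modulus: "\<exists>K\<ge>0. \<forall>t\<in>G. \<forall>s\<in>G. L1_dist (U t) (U s) \<le> \<epsilon> + K * sin (pi * ((t - s) / (2 * T))) ^ 2"
    if "0 < \<epsilon>" for \<epsilon>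
  proof -
    have "L1_norm (\<lambda>x. u t x - u s x) = L1_dist (U t) (U s)" if "t \<in> G" "s \<in> G" for t s
      unfolding L1_dist_def
    proof (rule L1_norm_eq_leb)
      show "AE x in lborel. x \<in> {0<..<1} \<longrightarrow> u t x - u s x = U t x - U s x"
        using slice[OF that(1)] slice[OF that(2)] by eventually_elim simp
    qed measurable
    note L = this
    obtain K where K: "0 \<le> K" and le: "\<forall>t\<in>{0..T}. \<forall>s\<in>{0..T}. L1_norm (\<lambda>x. u t x - u s x) \<le> \<epsilon> + K * sin (pi * ((t - s) / (2 * T))) ^ 2"
      using continuous_L1_modulus[OF u(1) T \<open>0 < \<epsilon>\<close>] by (elim exE conjE)
    show ?thesis
    proof (intro exI[of _ K] conjI ballI K)
      fix t s assume ts: "t \<in> G" "s \<in> G"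
      then have "t \<in> {0..T}" "s \<in> {0..T}" using G(1) by auto
      then show "L1_dist (U t) (U s) \<le> \<epsilon> + K * sin (pi * ((t - s) / (2 * T))) ^ 2"
        using le unfolding L[OF ts, symmetric] by blast
    qed
  qed
  have entropy: "0 \<le> (\<integral>t. (\<integral>x. entropy_density T f n U k t s x y \<partial>leb {0..1}) \<partial>leb {0..T})
        - (\<integral>x. \<bar>U T x - k\<bar> * weight T n T s * kern n (x - y) \<partial>leb {0..1})
        + (\<integral>x. \<bar>U 0 x - k\<bar> * weight T n 0 s * kern n (x - y) \<partial>leb {0..1})" for n s y k
  proof -
    let ?\<phi> = "test_fun T n s y"
    let ?e = "\<lambda>t x. entropy_eta (u t x) k * partial1 ?\<phi> t x
               + entropy_q f x (u t x) k * partial2 ?\<phi> t x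
               - sgn (u t x - k) * partial1 f x k * ?\<phi> t x
               + sgn (u t x - k) * nonlocal_P u t x * ?\<phi> t x"
    have bdry: "(LINT x:{0..1}|lebesgue. entropy_eta (u \<tau> x) k * ?\<phi> \<tau> x) =
        (\<integral>x. \<bar>U \<tau> x - k\<bar> * weight T n \<tau> s * kern n (x - y) \<partial>leb {0..1})" if "\<tau> \<in> G" for \<tau>
    proof (rule set_integral_lebesgue_eq_leb)
      have "0 \<le> \<tau>" using that G(1) by auto
      show "AE x in lborel. indicator {0..1} x * (entropy_eta (u \<tau> x) k * ?\<phi> \<tau> x) =
          indicator {0..1} x * (\<bar>U \<tau> x - k\<bar> * weight T n \<tau> s * kern n (x - y))"
        using slice[OF that] AE_lborel_not_endpoint[of 0 1]
        by eventually_elim (auto simp: entropy_eta_def test_fun_eq[OF \<open>0 \<le> \<tau>\<close>] indicator_def)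
    qed measurable
    have "(LINT p:PiT T|lebesgue. (case p of (t, x) \<Rightarrow> ?e t x)) =
        (\<integral>t. (\<integral>x. (case (t, x) of (t, x) \<Rightarrow> entropy_density T f n U k t s x y) \<partial>leb {0..1}) \<partial>leb {0..T})"
    proof (rule set_integral_lebesgue_PiT)
      show "(\<lambda>(t, x). entropy_density T f n U k t s x y) \<in> borel_measurable (borel \<Otimes>\<^sub>M borel)"
        unfolding entropy_density_def case_prod_unfold by measurable
      \<comment> \<open>the constant \<open>k\<close> may exceed the bound of \<open>U\<close>\<close>
      obtain B where B: "flux_const f (max C \<bar>k\<bar>) B" using flux_const_exists[OF f per] by blast
      then have fb: "\<bar>w\<bar> \<le> max C \<bar>k\<bar> \<Longrightarrow> \<bar>f x w\<bar> \<le> B"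
        and fxb: "\<bar>w\<bar> \<le> max C \<bar>k\<bar> \<Longrightarrow> \<bar>partial1 f x w\<bar> \<le> B" for x w
        unfolding flux_const_def by blast+
      have UB: "\<bar>U t x\<bar> \<le> max C \<bar>k\<bar>" for t x using C[of t x] by simp
      have b1: "bdd_fun (\<lambda>p. f (h p) (U (g p) (h p)))" for g h :: "real \<times> real \<Rightarrow> real"
        by (rule bdd_funI, rule fb, rule UB)
      have b2: "bdd_fun (\<lambda>p. f (h p) k)" "bdd_fun (\<lambda>p. partial1 f (h p) k)" for h :: "real \<times> real \<Rightarrow> real"
        by (rule bdd_funI, rule fb, simp) (rule bdd_funI, rule fxb, simp)
      have b3: "bdd_fun (\<lambda>p. U (g p) (h p))" "bdd_fun (\<lambda>p. source (U (g p)) (h p))" for g h :: "real \<times> real \<Rightarrow> real"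
        by (rule bdd_fun_compose2[OF C], rule bdd_fun_source, rule bdd_fun_compose2[OF C])
      show "bdd_fun (\<lambda>(t, x). entropy_density T f n U k t s x y)"
        unfolding entropy_density_def case_prod_unfold by (intro bdd_fun_intros b1 b2 b3)
      show "AE p in lborel. p \<in> PiT T \<longrightarrow> (case p of (t, x) \<Rightarrow> ?e t x) = (case p of (t, x) \<Rightarrow> entropy_density T f n U k t s x y)"
        using eq AE_fst[OF G(4)]
      proof eventually_elim
        case (elim p)
        show ?case
        proof
          assume p: "p \<in> PiT T"
          obtain t x where tx: "p = (t, x)" by (cases p)
          have t: "t \<in> {0..T}" "x \<in> {0..1}" using p tx by (auto simp: PiT_def)
          then have "t \<in> G" and ux: "u t x = U t x" using elim p tx by auto
          have P: "nonlocal_P u t x = source (U t) x"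
            using nonlocal_P_eq_source[where u = u and t = t and w = "U t", OF Ut slice[OF \<open>t \<in> G\<close>] t(2)] .
          have "0 \<le> t" using t by simp
          then show "(case p of (t, x) \<Rightarrow> ?e t x) = (case p of (t, x) \<Rightarrow> entropy_density T f n U k t s x y)"
            unfolding tx prod.case P ux entropy_density_def entropy_eta_def entropy_q_def
              test_fun_eq[OF \<open>0 \<le> t\<close>] partial1_test_fun[OF T \<open>0 \<le> t\<close>] partial2_test_fun[OF \<open>0 \<le> t\<close>]
            by (simp add: algebra_simps)
        qed
      qed
    qed
    moreover have "0 \<le> (LINT p:PiT T|lebesgue. (case p of (t, x) \<Rightarrow> ?e t x))
       - ((LINT x:{0..1}|lebesgue. entropy_eta (u T x) k * ?\<phi> T x)
               - (LINT x:{0..1}|lebesgue. entropy_eta (u 0 x) k * ?\<phi> 0 x))"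
      using sol test_function_test_fun[OF T, of n s y] unfolding entropy_solution_def by blast
    ultimately show ?thesis using bdry[OF G(2)] bdry[OF G(3)] by simp
  qed
  have "kruzkov_solution T f C' G U" if "C' \<ge> C" for C'
  proof -
    have UC': "\<bar>U t x\<bar> \<le> C'" for t x using C[of t x] that by linarith
    show ?thesis
      unfolding kruzkov_solution_def
    proof (intro conjI allI impI)
      show "AE t in leb {0..T}. t \<in> G" using G(4) by (simp add: AE_leb)
    qed (rule U UC' G(1-3) entropy | rule modulus, assumption)+
  qed
  with slice show ?thesis by blast
qed

section \<open>The contraction estimate\<close>

theorem theorem10:
  fixes T :: real
    and f :: "real \<Rightarrow> real \<Rightarrow> real"
    and u v :: "real \<Rightarrow> real \<Rightarrow> real"
    and u0 v0 :: "real \<Rightarrow> real"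
  assumes "0 < T"
    and "Ck 2 f"
    and "\<And>x w. f (x + 1) w = f x w"
    and "BV01 u0" and "BV01 v0"
    and "(LINT x:{0..1}|lebesgue. u0 x) = 0"
    and "(LINT x:{0..1}|lebesgue. v0 x) = 0"
    and "entropy_solution T f u0 u"
    and "entropy_solution T f v0 v"
  shows "L1_norm (\<lambda>x. u T x - v T x) \<le> exp (2 * T) * L1_norm (\<lambda>x. u0 x - v0 x)"
proof -
  obtain U C1 G where U: "\<And>C'. C' \<ge> C1 \<Longrightarrow> kruzkov_solution T f C' G U"
    and Ueq: "\<And>t. t \<in> G \<Longrightarrow> AE x in lborel. x \<in> {0<..<1} \<longrightarrow> u t x = U t x"
    using kruzkov_representative[OF assms(1,2,3,8)] by blast
  obtain V C2 H where V: "\<And>C'. C' \<ge> C2 \<Longrightarrow> kruzkov_solution T f C' H V"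
    and Veq: "\<And>t. t \<in> H \<Longrightarrow> AE x in lborel. x \<in> {0<..<1} \<longrightarrow> v t x = V t x"
    using kruzkov_representative[OF assms(1,2,3,9)] by blast
  define C where "C = max C1 C2"
  obtain B where B: "flux_const f C B" using flux_const_exists[OF assms(2,3)] by blast
  interpret kruzkov_pair T f C B U V G H
  proof
    show "case_prod f \<in> borel_measurable (borel \<Otimes>\<^sub>M borel)"
      using assms(2) by (rule Ck_borel_measurable)
    show "case_prod (partial1 f) \<in> borel_measurable (borel \<Otimes>\<^sub>M borel)"
      using assms(2) by (intro Ck_borel_measurable[of 1]) (simp add: numeral_2_eq_2)
  qed (use assms(1) B U V in \<open>auto simp: C_def\<close>)
  interpret sw: kruzkov_pair T f C B V U H G by (rule swapped)
  have "L1_norm (\<lambda>x. u T x - v T x) = L1_dist (U T) (V T)"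
    unfolding L1_dist_def
  proof (rule L1_norm_eq_leb)
    show "AE x in lborel. x \<in> {0<..<1} \<longrightarrow> u T x - v T x = U T x - V T x"
      using Ueq[OF sw.H_ends(2)] Veq[OF H_ends(2)] by eventually_elim simp
  qed measurable
  moreover have "L1_norm (\<lambda>x. u0 x - v0 x) = L1_dist (U 0) (V 0)"
    unfolding L1_dist_def
  proof (rule L1_norm_eq_leb)
    have "AE x in lborel. x \<in> {0<..<1} \<longrightarrow> u 0 x = u0 x" "AE x in lborel. x \<in> {0<..<1} \<longrightarrow> v 0 x = v0 x"
      using assms(8,9) unfolding entropy_solution_def AE_completion_iff by blast+
    then show "AE x in lborel. x \<in> {0<..<1} \<longrightarrow> u0 x - v0 x = U 0 x - V 0 x"
      using Ueq[OF sw.H_ends(1)] Veq[OF H_ends(1)] by eventually_elim simp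
  qed measurable
  moreover have "L1_dist (U T) (V T) \<le> exp (2 * T) * L1_dist (U 0) (V 0)"
    using mult_left_mono[OF L1_contraction, of "exp (2 * T)"] by (simp add: mult.assoc[symmetric] exp_minus)
  ultimately show ?thesis by simp
qed

end
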